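(* Let $(X,d,A)$ be a metric pair with $A\neq\emptyset$ and $(X,d)$ complete, separable and boundedly compact. Let $T$ be an element of the sequentially order continuous dual of $\mathrm{Lip}_c(X,A)$ such that both $T$ and $|T|$ are bounded. Then $T$ is represented by some $\mu\in\mathcal{M}_1(X,A)$, i.e. $T(f)=\mu^+(f)-\mu^-(f)$ for all $f\in\mathrm{Lip}_c(X,A)$. Furthermore, $\|T\|_{\mathrm{op}}=W_1(\mu^+,\mu^-)$.
   Context: A metric pair $(X,d,A)$ is a metric space $(X,d)$ with a closed subset $A\subset X$; $d_A(x)=\inf_{a\in A}d(x,a)$. $X$ is boundedly compact if every closed bounded subset is compact. Measures take values in $[0,\infty]$. Let $\mathcal{B}^+(X)$ be the commutative monoid of Borel measures on $X$ and $\mathcal{B}^+(X,A)=\mathcal{B}^+(X)/\mathcal{B}^+(A)$ the quotient monoid: $\mu\sim\nu$ iff $\mu+\sigma=\nu+\tau$ for some Borel measures $\sigma,\tau$ concentrated on $A$; equivalently $\mu,\nu$ agree on Borel subsets of $X\setminus A$, so relative Borel measures correspond bijectively to Borel measures on $X\setminus A$. For $f$ vanishing on $A$, $\mu(f)=\int_X f\,d\mu$ is well defined. $\mu$ is tight if $\mu(E)=\sup\{\mu(K): K\subset E \text{ compact}\}$ for every Borel $E\subset X\setminus A$. $\mathcal{M}_1^+(X,A)$ is the set of tight $\mu\in\mathcal{B}^+(X,A)$ with $\mu(d_A)<\infty$. $\mathcal{M}_1(X,A)$ is its Grothendieck group (formal differences), a Riesz space (vector lattice) with positive cone $\mathcal{M}_1^+(X,A)$;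 each $\mu\in\mathcal{M}_1(X,A)$ is uniquely $\mu=\mu^+-\mu^-$ with $\mu^\pm\in\mathcal{M}_1^+(X,A)$ and $\mu^+\wedge\mu^-=0$. $\mathrm{Lip}_c(X,A)$ is the Riesz space of compactly supported Lipschitz functions $f:X\to\mathbb{R}$ with $f|_A=0$, ordered pointwise and normed by the Lipschitz number $L(f)$ (least Lipschitz constant). "Bounded" and $\|\cdot\|_{\mathrm{op}}$ for linear functionals on $\mathrm{Lip}_c(X,A)$ are with respect to the norm $L$. In a Riesz space $E$, $x_n\xrightarrow{o}0$ means there is a decreasing sequence $(y_n)$ in $E$ with infimum $0$ in $E$ and $|x_n|\le y_n$. The sequentially order continuous dual of $E$ consists of the order bounded linear functionals $T$ (mapping order intervals to bounded sets) such that $x_n\xrightarrow{o}0$ implies $T(x_n)\to0$. $|T|=T\vee(-T)$ is taken in the Riesz space of order bounded linear functionals, ordered by the cone of positive functionals. The product pair is $(X\times X,d+d,A\times A)$, with $\mathcal{B}^+(X^2,A^2)$ defined in the same way. $\Pi(\mu,\nu)$ is the set of $\pi\in\mathcal{B}^+(X^2,A^2)$ whose pushforwards under the two projections $X^2\to X$ are $\mu$ and $\nu$ in $\mathcal{B}^+(X,A)$. With $\bar d(x,y)=\min(d(x,y),d_A(x)+d_A(y))$, $W_1(\mu,\nu)=\inf_{\pi\in\Pi(\mu,\nu)}\int_{X\times X}\bar d\,d\pi$. *)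

theory Defs
  imports "HOL-Analysis.Analysis"
begin

section \<open>Relative Borel measures\<close>

text \<open>
  Metric pairs \<open>(X, A)\<close> are given by a metric space type (the whole space \<open>X\<close>) and a set \<open>A\<close>.
  Elements of the quotient monoid \<open>B\<^sup>+(X) / B\<^sup>+(A)\<close> are handled through representatives, i.e. Borel
  measures on all of \<open>X\<close>; equality in the quotient is the relation \<open>rel_eq A\<close>.  Every notion
  below is invariant under that relation.
\<close>

definition borel_measures :: "'a::topological_space measure set" where
  "borel_measures = {\<mu>. sets \<mu> = sets borel}"

definition add_measure :: "'a measure \<Rightarrow> 'a measure \<Rightarrow> 'a measure" where
  "add_measure \<mu> \<nu> = measure_of (space \<mu>) (sets \<mu>) (\<lambda>E. emeasure \<mu> E + emeasure \<nu> E)"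

lemma sets_add_measure [simp]: "sets (add_measure \<mu> \<nu>) = sets \<mu>"
  by (simp add: add_measure_def)

lemma space_add_measure [simp]: "space (add_measure \<mu> \<nu>) = space \<mu>"
  by (simp add: add_measure_def)

lemma emeasure_add_measure:
  assumes "sets \<mu> = sets \<nu>"
  shows "emeasure (add_measure \<mu> \<nu>) E = emeasure \<mu> E + emeasure \<nu> E"
proof (cases "E \<in> sets \<mu>")
  case True
  show ?thesis
  proof (rule emeasure_measure_of[OF add_measure_def])
    show "countably_additive (sets (add_measure \<mu> \<nu>)) (\<lambda>E. emeasure \<mu> E + emeasure \<nu> E)"
    proof (rule countably_additiveI)
      fix F :: "nat \<Rightarrow> 'a set"
      assume "range F \<subseteq> sets (add_measure \<mu> \<nu>)" "disjoint_family F"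
      then have "range F \<subseteq> sets \<mu>" "range F \<subseteq> sets \<nu>" "disjoint_family F"
        using assms by auto
      then show "(\<Sum>i. emeasure \<mu> (F i) + emeasure \<nu> (F i))
          = emeasure \<mu> (\<Union> (range F)) + emeasure \<nu> (\<Union> (range F))"
        by (simp add: suminf_emeasure suminf_add[symmetric])
    qed
  qed (use True sets.sets_into_space in \<open>auto simp: positive_def\<close>)
next
  case False
  then show ?thesis
    using assms by (simp add: emeasure_notin_sets)
qed

definition concentrated_on :: "'a::topological_space set \<Rightarrow> 'a measure set" where
  "concentrated_on A = {\<sigma> \<in> borel_measures. emeasure \<sigma> (- A) = 0}"

definition rel_eq :: "'a::topological_space set \<Rightarrow> 'a measure \<Rightarrow> 'a measure \<Rightarrow> bool" where
  "rel_eq A \<mu> \<nu> \<longleftrightarrow>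
     (\<exists>\<sigma>\<in>concentrated_on A. \<exists>\<tau>\<in>concentrated_on A. add_measure \<mu> \<sigma> = add_measure \<nu> \<tau>)"

definition rel_tight :: "'a::topological_space set \<Rightarrow> 'a measure \<Rightarrow> bool" where
  "rel_tight A \<mu> \<longleftrightarrow>
     (\<forall>E\<in>sets borel. E \<subseteq> - A \<longrightarrow>
        emeasure \<mu> E = (SUP K\<in>{K. compact K \<and> K \<subseteq> E}. emeasure \<mu> K))"

section \<open>The positive cone of the space of relative measures, and its Grothendieck group\<close>

definition M1_pos :: "'a::metric_space set \<Rightarrow> 'a measure set" where
  "M1_pos A = {\<mu> \<in> borel_measures. rel_tight A \<mu> \<and> (\<integral>\<^sup>+ x. ennreal (infdist x A) \<partial>\<mu>) < \<infinity>}"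

text \<open>
  Elements of the Grothendieck group are formal differences \<open>\<mu> - \<nu>\<close>, encoded as pairs
  \<open>(\<mu>, \<nu>)\<close>.  Equality and the order whose positive cone is \<open>M1_pos A\<close> are the
  relations \<open>M1_eq A\<close> and \<open>M1_le A\<close>.
\<close>

definition M1 :: "'a::metric_space set \<Rightarrow> ('a measure \<times> 'a measure) set" where
  "M1 A = M1_pos A \<times> M1_pos A"

definition M1_eq ::
  "'a::metric_space set \<Rightarrow> 'a measure \<times> 'a measure \<Rightarrow> 'a measure \<times> 'a measure \<Rightarrow> bool" where
  "M1_eq A \<xi> \<eta> \<longleftrightarrow>
     (\<exists>\<kappa>\<in>M1_pos A. rel_eq A (add_measure (add_measure (fst \<xi>) (snd \<eta>)) \<kappa>)
                              (add_measure (add_measure (fst \<eta>) (snd \<xi>)) \<kappa>))"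

definition M1_le ::
  "'a::metric_space set \<Rightarrow> 'a measure \<times> 'a measure \<Rightarrow> 'a measure \<times> 'a measure \<Rightarrow> bool" where
  "M1_le A \<xi> \<eta> \<longleftrightarrow> (\<exists>\<rho>\<in>M1_pos A. M1_eq A (add_measure (fst \<xi>) \<rho>, snd \<xi>) \<eta>)"

definition M1_of_pos :: "'a::topological_space measure \<Rightarrow> 'a measure \<times> 'a measure" where
  "M1_of_pos \<mu> = (\<mu>, null_measure borel)"

text \<open>\<open>\<mu> \<and> \<nu> = 0\<close>: the greatest lower bound of \<open>\<mu>\<close> and \<open>\<nu>\<close> in the Grothendieck group is zero.\<close>

definition M1_disjoint :: "'a::metric_space set \<Rightarrow> 'a measure \<Rightarrow> 'a measure \<Rightarrow> bool" where
  "M1_disjoint A \<mu> \<nu> \<longleftrightarrow>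
     M1_le A (M1_of_pos (null_measure borel)) (M1_of_pos \<mu>) \<and>
     M1_le A (M1_of_pos (null_measure borel)) (M1_of_pos \<nu>) \<and>
     (\<forall>\<xi>\<in>M1 A. M1_le A \<xi> (M1_of_pos \<mu>) \<and> M1_le A \<xi> (M1_of_pos \<nu>) \<longrightarrow>
        M1_le A \<xi> (M1_of_pos (null_measure borel)))"

definition is_pos_neg_parts ::
  "'a::metric_space set \<Rightarrow> 'a measure \<times> 'a measure \<Rightarrow> 'a measure \<Rightarrow> 'a measure \<Rightarrow> bool" where
  "is_pos_neg_parts A \<mu> \<mu>p \<mu>n \<longleftrightarrow>
     \<mu>p \<in> M1_pos A \<and> \<mu>n \<in> M1_pos A \<and> M1_eq A \<mu> (\<mu>p, \<mu>n) \<and> M1_disjoint A \<mu>p \<mu>n"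

section \<open>Compactly supported Lipschitz functions\<close>

definition Lip_c :: "'a::metric_space set \<Rightarrow> ('a \<Rightarrow> real) set" where
  "Lip_c A = {f. (\<exists>C. C-lipschitz_on UNIV f) \<and> compact (closure {x. f x \<noteq> 0}) \<and> (\<forall>x\<in>A. f x = 0)}"

definition Lip_number :: "('a::metric_space \<Rightarrow> real) \<Rightarrow> real" where
  "Lip_number f = Inf {C. C-lipschitz_on UNIV f}"

section \<open>Functionals on Riesz spaces of functions\<close>

text \<open>
  Here \<open>E\<close> is a vector lattice of real functions under the pointwise operations.  A functional
  on \<open>E\<close> is a function whose values outside \<open>E\<close> are irrelevant.
\<close>

definition linear_functional :: "('a \<Rightarrow> real) set \<Rightarrow> (('a \<Rightarrow> real) \<Rightarrow> real) \<Rightarrow> bool" where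
  "linear_functional E T \<longleftrightarrow>
     (\<forall>f\<in>E. \<forall>g\<in>E. T (\<lambda>x. f x + g x) = T f + T g) \<and>
     (\<forall>c. \<forall>f\<in>E. T (\<lambda>x. c * f x) = c * T f)"

definition order_bounded_dual :: "('a \<Rightarrow> real) set \<Rightarrow> (('a \<Rightarrow> real) \<Rightarrow> real) set" where
  "order_bounded_dual E =
     {T. linear_functional E T \<and> (\<forall>u\<in>E. \<forall>v\<in>E. bounded (T ` {f\<in>E. u \<le> f \<and> f \<le> v}))}"

text \<open>The infimum of \<open>y\<close> is taken within \<open>E\<close>; it may differ from the pointwise infimum.\<close>

definition order_null_sequence :: "('a \<Rightarrow> real) set \<Rightarrow> (nat \<Rightarrow> 'a \<Rightarrow> real) \<Rightarrow> bool" where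
  "order_null_sequence E x \<longleftrightarrow>
     (\<exists>y. (\<forall>n. y n \<in> E) \<and> decseq y \<and>
          (\<forall>n. (\<lambda>_. 0) \<le> y n) \<and> (\<forall>g\<in>E. (\<forall>n. g \<le> y n) \<longrightarrow> g \<le> (\<lambda>_. 0)) \<and>
          (\<forall>n. (\<lambda>t. \<bar>x n t\<bar>) \<le> y n))"

definition seq_order_continuous_dual :: "('a \<Rightarrow> real) set \<Rightarrow> (('a \<Rightarrow> real) \<Rightarrow> real) set" where
  "seq_order_continuous_dual E =
     {T \<in> order_bounded_dual E.
        \<forall>x. (\<forall>n. x n \<in> E) \<and> order_null_sequence E x \<longrightarrow> (\<lambda>n. T (x n)) \<longlonglongrightarrow> 0}"

definition functional_le ::
  "('a \<Rightarrow> real) set \<Rightarrow> (('a \<Rightarrow> real) \<Rightarrow> real) \<Rightarrow> (('a \<Rightarrow> real) \<Rightarrow> real) \<Rightarrow> bool" where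
  "functional_le E S T \<longleftrightarrow> (\<forall>f\<in>E. (\<lambda>_. 0) \<le> f \<longrightarrow> S f \<le> T f)"

text \<open>\<open>M\<close> is \<open>|T|\<close>, the least upper bound of \<open>T\<close> and \<open>-T\<close> among the order bounded functionals.\<close>

definition is_functional_abs ::
  "('a \<Rightarrow> real) set \<Rightarrow> (('a \<Rightarrow> real) \<Rightarrow> real) \<Rightarrow> (('a \<Rightarrow> real) \<Rightarrow> real) \<Rightarrow> bool" where
  "is_functional_abs E T M \<longleftrightarrow>
     M \<in> order_bounded_dual E \<and> functional_le E T M \<and> functional_le E (\<lambda>f. - T f) M \<and>
     (\<forall>S\<in>order_bounded_dual E.
        functional_le E T S \<and> functional_le E (\<lambda>f. - T f) S \<longrightarrow> functional_le E M S)"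

definition Lip_bounded :: "'a::metric_space set \<Rightarrow> (('a \<Rightarrow> real) \<Rightarrow> real) \<Rightarrow> bool" where
  "Lip_bounded A T \<longleftrightarrow> (\<exists>C. \<forall>f\<in>Lip_c A. \<bar>T f\<bar> \<le> C * Lip_number f)"

definition Lip_op_norm :: "'a::metric_space set \<Rightarrow> (('a \<Rightarrow> real) \<Rightarrow> real) \<Rightarrow> real" where
  "Lip_op_norm A T = (SUP f\<in>{f\<in>Lip_c A. Lip_number f \<le> 1}. \<bar>T f\<bar>)"

section \<open>Relative optimal transport\<close>

definition dbar :: "'a::metric_space set \<Rightarrow> 'a \<times> 'a \<Rightarrow> real" where
  "dbar A = (\<lambda>(x, y). min (dist x y) (infdist x A + infdist y A))"

text \<open>
  Representatives of relative measures on \<open>(X \<times> X, A \<times> A)\<close>.  The metric of the product pair enters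
  only through its Borel sets, which are those of the product topology.  Since \<open>dbar A\<close> vanishes
  on \<open>A \<times> A\<close>, the transport cost does not depend on the representative.
\<close>

definition rel_couplings ::
  "'a::metric_space set \<Rightarrow> 'a measure \<Rightarrow> 'a measure \<Rightarrow> ('a \<times> 'a) measure set" where
  "rel_couplings A \<mu> \<nu> =
     {\<pi> \<in> borel_measures. rel_eq A (distr \<pi> borel fst) \<mu> \<and> rel_eq A (distr \<pi> borel snd) \<nu>}"

definition W1 :: "'a::metric_space set \<Rightarrow> 'a measure \<Rightarrow> 'a measure \<Rightarrow> ennreal" where
  "W1 A \<mu> \<nu> = (INF \<pi>\<in>rel_couplings A \<mu> \<nu>. \<integral>\<^sup>+ z. ennreal (dbar A z) \<partial>\<pi>)"

end

theory Submission
  imports Defs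
begin

text \<open>
  The positive part \<open>f \<mapsto> sup {T g | 0 \<le> g \<le> f}\<close> of \<open>T\<close> and its difference with \<open>T\<close> are positive
  functionals that are continuous along decreasing sequences, so a Riesz construction represents both
  by measures; these have finite first moment because \<open>|T|\<close> is bounded.  The Radon--Nikodym theorem
  makes the two measures mutually singular.

  For the norm formula, \<open>\<parallel>T\<parallel> \<le> W\<^sub>1\<close> is integration of \<open>f x - f y \<le> dbar (x, y)\<close> against a coupling.
  Conversely, up to a small error all mass lies in a compact set disjoint from \<open>A\<close>, which is cut into
  finitely many small cells.  By Farkas' lemma the resulting finite transport problem, with \<open>A\<close> as an
  additional point that absorbs and emits mass, either has a cheap plan, which is spread out over the
  cells, or has a dual solution, whose Lipschitz extension would contradict the norm of \<open>T\<close>.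
\<close>

section \<open>Lipschitz functions with compact support\<close>

text \<open>Boundedness alone does not produce a measure. If points off \<open>A\<close> accumulate
  at \<open>A\<close>, a generalised limit of the quotients \<open>f x / infdist x A\<close> along
  such points is a positive functional bounded by the Lipschitz number, yet it lives at
  \<open>A\<close>; order continuity excludes it. Boundedness of \<open>T\<close> does not control
  the moments of its two parts either, because masses of opposite sign at close points nearly cancel
  in \<open>T\<close>; hence the separate hypothesis on \<open>|T|\<close>. The measures obtained
  may have infinite mass near \<open>A\<close>. Only the moment against \<open>infdist x A\<close>
  is finite, so whatever needs finite mass (cancellation, inner regularity, product measures) is
  done at a positive distance from \<open>A\<close> and extended by exhaustion. \<open>W1\<close> is
  an infimum, so near-optimal couplings suffice, and these come from finite problems with an
  arbitrarily small error in place of a compactness argument for couplings.\<close>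

lemma Lip_cE:
  assumes "f \<in> Lip_c A"
  obtains C where "C-lipschitz_on UNIV f" "compact (closure {x. f x \<noteq> 0})" "\<And>x. x \<in> A \<Longrightarrow> f x = 0"
  using assms unfolding Lip_c_def by auto

lemma Lip_c_zero_on: "f \<in> Lip_c A \<Longrightarrow> x \<in> A \<Longrightarrow> f x = 0"
  by (auto simp: Lip_c_def)

lemma Lip_c_continuous: "f \<in> Lip_c A \<Longrightarrow> continuous_on UNIV f"
  using lipschitz_on_continuous_on by (auto elim!: Lip_cE)

lemma Lip_c_borel [measurable_dest]: "f \<in> Lip_c A \<Longrightarrow> f \<in> borel_measurable borel"
  by (intro borel_measurable_continuous_onI Lip_c_continuous)

lemma Lip_c_if_support:
  assumes "C-lipschitz_on UNIV g" "compact S" "\<And>x. x \<notin> S \<Longrightarrow> g x = 0" "\<And>x. x \<in> A \<Longrightarrow> g x = 0"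
  shows "g \<in> Lip_c A"
proof -
  have "closure {x. g x \<noteq> 0} \<subseteq> S"
    using assms by (intro closure_minimal compact_imp_closed) auto
  then have "compact (closure {x. g x \<noteq> 0})"
    using compact_Int_closed[OF \<open>compact S\<close>, of "closure {x. g x \<noteq> 0}"] by (simp add: Int_absorb1)
  with assms show ?thesis by (auto simp: Lip_c_def)
qed

lemma zero_outside_support: "x \<notin> closure {x. f x \<noteq> 0} \<Longrightarrow> f x = 0"
  using closure_subset[of "{x. f x \<noteq> 0}"] by auto

lemma Lip_c_if_dominated:
  assumes "f \<in> Lip_c A" "C-lipschitz_on UNIV g" "\<And>x. f x = 0 \<Longrightarrow> g x = 0"
  shows "g \<in> Lip_c A"
proof (rule Lip_cE[OF assms(1)])
  assume "compact (closure {x. f x \<noteq> 0})" "\<And>x. x \<in> A \<Longrightarrow> f x = 0"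
  with assms show ?thesis
    by (intro Lip_c_if_support[of C g "closure {x. f x \<noteq> 0}"])
       (auto dest: zero_outside_support)
qed

lemma lipschitz_on_abs_diff:
  "C-lipschitz_on X f \<longleftrightarrow> 0 \<le> C \<and> (\<forall>x\<in>X. \<forall>y\<in>X. \<bar>f x - f y\<bar> \<le> C * dist x y)"
  for f :: "'a::metric_space \<Rightarrow> real"
  by (auto simp: lipschitz_on_def dist_real_def)

lemma lipschitz_on_min:
  fixes f g :: "'a::metric_space \<Rightarrow> real"
  assumes "C-lipschitz_on X f" "D-lipschitz_on X g"
  shows "(max C D)-lipschitz_on X (\<lambda>x. min (f x) (g x))"
  unfolding lipschitz_on_abs_diff
proof (intro conjI ballI)
  show "0 \<le> max C D" using assms(1) by (auto dest: lipschitz_on_nonneg)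
  fix x y assume "x \<in> X" "y \<in> X"
  then have "\<bar>f x - f y\<bar> \<le> C * dist x y" "\<bar>g x - g y\<bar> \<le> D * dist x y"
    using assms unfolding lipschitz_on_abs_diff by auto
  moreover have "C * dist x y \<le> max C D * dist x y" "D * dist x y \<le> max C D * dist x y"
    by (auto intro!: mult_right_mono)
  ultimately show "\<bar>min (f x) (g x) - min (f y) (g y)\<bar> \<le> max C D * dist x y"
    by linarith
qed

lemma lipschitz_on_max:
  fixes f g :: "'a::metric_space \<Rightarrow> real"
  assumes "C-lipschitz_on X f" "D-lipschitz_on X g"
  shows "(max C D)-lipschitz_on X (\<lambda>x. max (f x) (g x))"
proof -
  have "(max C D)-lipschitz_on X (\<lambda>x. - min (- f x) (- g x))"
    using assms by (intro lipschitz_on_minus lipschitz_on_min)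
  then show ?thesis by (simp add: minus_min_eq_max)
qed

lemma Lip_c_zero: "(\<lambda>_. 0) \<in> Lip_c A"
  by (rule Lip_c_if_support[of 0 _ "{}"]) (auto intro: lipschitz_on_constant)

lemma Lip_c_add:
  assumes "f \<in> Lip_c A" "g \<in> Lip_c A"
  shows "(\<lambda>x. f x + g x) \<in> Lip_c A"
proof -
  obtain C D where *: "C-lipschitz_on UNIV f" "D-lipschitz_on UNIV g"
    using assms by (auto elim!: Lip_cE)
  have c: "compact (closure {x. f x \<noteq> 0} \<union> closure {x. g x \<noteq> 0})"
    using assms by (intro compact_Un) (auto elim: Lip_cE)
  show ?thesis
  proof (rule Lip_c_if_support[OF lipschitz_on_add[OF *] c])
    fix x assume "x \<notin> closure {x. f x \<noteq> 0} \<union> closure {x. g x \<noteq> 0}"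
    then have "f x = 0" "g x = 0" by (auto intro: zero_outside_support)
    then show "f x + g x = 0" by simp
  qed (use assms in \<open>simp add: Lip_c_zero_on\<close>)
qed

lemma Lip_c_cmult: "f \<in> Lip_c A \<Longrightarrow> (\<lambda>x. c * f x) \<in> Lip_c A"
  by (rule Lip_cE, assumption) (rule Lip_c_if_dominated[OF _ lipschitz_on_cmult_real], auto)

lemma Lip_c_minus: "f \<in> Lip_c A \<Longrightarrow> (\<lambda>x. - f x) \<in> Lip_c A"
  using Lip_c_cmult[of f A "-1"] by simp

lemma Lip_c_diff: "f \<in> Lip_c A \<Longrightarrow> g \<in> Lip_c A \<Longrightarrow> (\<lambda>x. f x - g x) \<in> Lip_c A"
  using Lip_c_add[of f A "\<lambda>x. - g x"] Lip_c_minus[of g A] by simp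

text \<open>The cutting function \<open>g\<close> may be nonzero on \<open>A\<close> and have
  unbounded support: because it is nonnegative, the minimum is 0 wherever \<open>f\<close> is. This
  admits positive constants and the sums of bumps in \<open>content_UN\<close>.\<close>

lemma Lip_c_min_lipschitz:
  assumes "f \<in> Lip_c A" "D-lipschitz_on UNIV g" "\<And>x. 0 \<le> g x"
  shows "(\<lambda>x. min (f x) (g x)) \<in> Lip_c A"
proof (rule Lip_cE[OF assms(1)])
  fix C assume "C-lipschitz_on UNIV f"
  from Lip_c_if_dominated[OF assms(1) lipschitz_on_min[OF this assms(2)]] assms(3)
  show ?thesis by (simp add: min_def)
qed

lemma Lip_c_max:
  assumes "f \<in> Lip_c A" "g \<in> Lip_c A"
  shows "(\<lambda>x. max (f x) (g x)) \<in> Lip_c A"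
proof -
  obtain C D where *: "C-lipschitz_on UNIV f" "D-lipschitz_on UNIV g"
    using assms by (auto elim!: Lip_cE)
  have c: "compact (closure {x. f x \<noteq> 0} \<union> closure {x. g x \<noteq> 0})"
    using assms by (intro compact_Un) (auto elim: Lip_cE)
  show ?thesis
  proof (rule Lip_c_if_support[OF lipschitz_on_max[OF *] c])
    fix x assume "x \<notin> closure {x. f x \<noteq> 0} \<union> closure {x. g x \<noteq> 0}"
    then have "f x = 0" "g x = 0" by (auto intro: zero_outside_support)
    then show "max (f x) (g x) = 0" by simp
  qed (use assms in \<open>simp add: Lip_c_zero_on\<close>)
qed

lemma Lip_c_min:
  assumes "f \<in> Lip_c A" "g \<in> Lip_c A"
  shows "(\<lambda>x. min (f x) (g x)) \<in> Lip_c A"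
  using Lip_c_minus[OF Lip_c_max[OF Lip_c_minus[OF assms(1)] Lip_c_minus[OF assms(2)]]]
  by (simp add: minus_max_eq_min)

lemma Lip_c_min_const:
  assumes "f \<in> Lip_c A" "0 \<le> c"
  shows "(\<lambda>x. min (f x) c) \<in> Lip_c A"
  by (rule Lip_c_min_lipschitz[OF assms(1) lipschitz_on_constant assms(2)])

lemma Lip_c_bounded:
  assumes "f \<in> Lip_c A"
  obtains B where "\<And>x. \<bar>f x\<bar> \<le> B" "0 < B"
proof -
  let ?S = "closure {x. f x \<noteq> 0}"
  have "compact (f ` ?S)"
    using assms by (intro compact_continuous_image)
      (auto elim: Lip_cE intro: continuous_on_subset[OF Lip_c_continuous[OF assms]])
  then obtain B where B: "\<And>y. y \<in> f ` ?S \<Longrightarrow> norm y \<le> B" "0 < B"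
    using compact_imp_bounded bounded_pos by metis
  have "\<bar>f x\<bar> \<le> B" for x
    using B zero_outside_support[of x f] by (cases "f x = 0") auto
  with B that show ?thesis by blast
qed

definition Lip_pos :: "'a::metric_space set \<Rightarrow> ('a \<Rightarrow> real) set" where
  "Lip_pos A = {f \<in> Lip_c A. \<forall>x. 0 \<le> f x}"

lemma Lip_posD: "f \<in> Lip_pos A \<Longrightarrow> f \<in> Lip_c A" "f \<in> Lip_pos A \<Longrightarrow> 0 \<le> f x"
  by (auto simp: Lip_pos_def)

lemma Lip_pos_zero: "(\<lambda>_. 0) \<in> Lip_pos A"
  by (simp add: Lip_pos_def Lip_c_zero)

lemma Lip_pos_add: "f \<in> Lip_pos A \<Longrightarrow> g \<in> Lip_pos A \<Longrightarrow> (\<lambda>x. f x + g x) \<in> Lip_pos A"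
  by (simp add: Lip_pos_def Lip_c_add)

lemma Lip_pos_cmult: "f \<in> Lip_pos A \<Longrightarrow> 0 \<le> c \<Longrightarrow> (\<lambda>x. c * f x) \<in> Lip_pos A"
  by (simp add: Lip_pos_def Lip_c_cmult)

lemma Lip_pos_diff:
  "f \<in> Lip_pos A \<Longrightarrow> g \<in> Lip_pos A \<Longrightarrow> (\<And>x. g x \<le> f x) \<Longrightarrow> (\<lambda>x. f x - g x) \<in> Lip_pos A"
  by (simp add: Lip_pos_def Lip_c_diff)

lemma Lip_pos_min: "f \<in> Lip_pos A \<Longrightarrow> g \<in> Lip_pos A \<Longrightarrow> (\<lambda>x. min (f x) (g x)) \<in> Lip_pos A"
  by (simp add: Lip_pos_def Lip_c_min)

lemma Lip_pos_min_const: "f \<in> Lip_pos A \<Longrightarrow> 0 \<le> c \<Longrightarrow> (\<lambda>x. min (f x) c) \<in> Lip_pos A"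
  by (simp add: Lip_pos_def Lip_c_min_const)

lemma Lip_pos_min_lipschitz:
  "f \<in> Lip_pos A \<Longrightarrow> D-lipschitz_on UNIV g \<Longrightarrow> (\<And>x. 0 \<le> g x) \<Longrightarrow> (\<lambda>x. min (f x) (g x)) \<in> Lip_pos A"
  by (simp add: Lip_pos_def Lip_c_min_lipschitz)

lemma Lip_pos_sum:
  "finite I \<Longrightarrow> (\<And>i. i \<in> I \<Longrightarrow> f i \<in> Lip_pos A) \<Longrightarrow> (\<lambda>x. \<Sum>i\<in>I. f i x) \<in> Lip_pos A"
  by (induction I rule: finite_induct) (simp_all add: Lip_pos_zero Lip_pos_add)

section \<open>Riesz representation of positive functionals\<close>

text \<open>Everything is required on the cone only, because the functionals to be represented come
  from a supremum over functions between 0 and \<open>f\<close>, and there are none as soon as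
  \<open>f\<close> takes a negative value. \<open>sigma_continuous\<close> is the Daniell
  condition.\<close>

locale positive_lip_functional =
  fixes A :: "'a::metric_space set" and L :: "('a \<Rightarrow> real) \<Rightarrow> real"
  assumes nonempty: "A \<noteq> {}"
    and closed: "closed A"
    and nonneg: "f \<in> Lip_pos A \<Longrightarrow> 0 \<le> L f"
    and add: "f \<in> Lip_pos A \<Longrightarrow> g \<in> Lip_pos A \<Longrightarrow> L (\<lambda>x. f x + g x) = L f + L g"
    and cmult: "f \<in> Lip_pos A \<Longrightarrow> 0 \<le> c \<Longrightarrow> L (\<lambda>x. c * f x) = c * L f"
    and sigma_continuous: "(\<And>n. F n \<in> Lip_pos A) \<Longrightarrow> (\<And>n x. F (Suc n) x \<le> F n x) \<Longrightarrow>
          (\<And>x. (\<lambda>n. F n x) \<longlonglongrightarrow> 0) \<Longrightarrow> (\<lambda>n. L (F n)) \<longlonglongrightarrow> 0"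
begin

lemma zero: "L (\<lambda>_. 0) = 0"
  using cmult[OF Lip_pos_zero, of 0] by simp

lemma diff:
  assumes "f \<in> Lip_pos A" "g \<in> Lip_pos A" "\<And>x. g x \<le> f x"
  shows "L (\<lambda>x. f x - g x) = L f - L g"
  using add[OF Lip_pos_diff[OF assms] assms(2)] by simp

lemma mono:
  assumes "f \<in> Lip_pos A" "g \<in> Lip_pos A" "\<And>x. g x \<le> f x"
  shows "L g \<le> L f"
  using diff[OF assms] nonneg[OF Lip_pos_diff[OF assms]] by simp

lemma sum:
  "finite I \<Longrightarrow> (\<And>i. i \<in> I \<Longrightarrow> f i \<in> Lip_pos A) \<Longrightarrow> L (\<lambda>x. \<Sum>i\<in>I. f i x) = (\<Sum>i\<in>I. L (f i))"
  by (induction I rule: finite_induct) (simp_all add: zero add Lip_pos_sum)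

text \<open>Cutting a function at a positive level creates room around the set where it is positive;
  the limit here undoes the cut, both in the proof that open sets are measurable and in the
  comparison with the integral.\<close>

lemma tendsto_min_const:
  assumes "f \<in> Lip_pos A"
  shows "(\<lambda>n. L (\<lambda>x. min (f x) (1 / Suc n))) \<longlonglongrightarrow> 0"
proof (rule sigma_continuous)
  show "(\<lambda>x. min (f x) (1 / Suc n)) \<in> Lip_pos A" for n
    by (rule Lip_pos_min_const[OF assms]) simp
  show "min (f x) (1 / Suc (Suc n)) \<le> min (f x) (1 / Suc n)" for n x
    by (intro min.mono) (auto simp: field_simps)
  show "(\<lambda>n. min (f x) (1 / Suc n)) \<longlonglongrightarrow> 0" for x
  proof -
    have "(\<lambda>n. min (f x) (1 / Suc n)) \<longlonglongrightarrow> min (f x) 0"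
      using LIMSEQ_Suc[OF lim_1_over_n[where 'a=real]] by (intro tendsto_min tendsto_const) simp
    then show ?thesis using Lip_posD(2)[OF assms, of x] by (simp add: min_absorb2)
  qed
qed

section \<open>The content of open sets and its outer measure\<close>

definition below :: "'a set \<Rightarrow> ('a \<Rightarrow> real) set" where
  "below U = {f \<in> Lip_pos A. \<forall>x. f x \<le> indicator U x}"

definition content :: "'a set \<Rightarrow> ennreal" where
  "content U = (SUP f\<in>below U. ennreal (L f))"

text \<open>Covering only \<open>E - A\<close> makes subsets of \<open>A\<close> null. Test
  functions vanish on \<open>A\<close>, so the functional carries no information about mass there;
  this picks the representative without any.\<close>

definition outer :: "'a set \<Rightarrow> ennreal" where
  "outer E = (INF U\<in>{U. open U \<and> E - A \<subseteq> U}. content U)"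

lemma zero_below: "(\<lambda>_. 0) \<in> below U"
  by (simp add: below_def Lip_pos_zero)

lemma content_upper: "f \<in> below U \<Longrightarrow> ennreal (L f) \<le> content U"
  unfolding content_def by (rule SUP_upper)

lemma content_mono:
  assumes "U - A \<subseteq> V" shows "content U \<le> content V"
proof -
  have "f \<in> below V" if "f \<in> below U" for f
    unfolding below_def
  proof (safe)
    show "f \<in> Lip_pos A" using that by (simp add: below_def)
    fix x
    have "f x = 0" if "x \<in> A" using \<open>f \<in> Lip_pos A\<close> that Lip_c_zero_on Lip_posD(1) by blast
    moreover have "f x \<le> indicator U x" using that by (auto simp: below_def)
    ultimately show "f x \<le> indicator V x" using assms by (cases "x \<in> U"; cases "x \<in> V"; cases "x \<in> A") auto
  qed
  then show ?thesis unfolding content_def by (intro SUP_subset_mono) auto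
qed

lemma outer_open: "open U \<Longrightarrow> outer U = content U"
  unfolding outer_def
  by (intro antisym INF_lower2[of U] INF_greatest content_mono) auto

lemma outer_mono: "E \<subseteq> F \<Longrightarrow> outer E \<le> outer F"
  unfolding outer_def by (rule INF_superset_mono) auto

lemma outer_subset_A: "E \<subseteq> A \<Longrightarrow> outer E = 0"
proof -
  assume "E \<subseteq> A"
  then have "outer E \<le> content {}" unfolding outer_def by (intro INF_lower) auto
  moreover have "below {} = {\<lambda>_. 0}"
    using zero_below[of "{}"] by (auto simp: below_def Lip_pos_def intro: antisym)
  ultimately show ?thesis by (simp add: content_def zero)
qed

lemma min_sum_le:
  fixes a :: real assumes "finite I" "\<And>i. i \<in> I \<Longrightarrow> 0 \<le> q i" "0 \<le> a"
  shows "min a (\<Sum>i\<in>I. q i) \<le> (\<Sum>i\<in>I. min a (q i))"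
  using assms(1,2)
proof (induction I rule: finite_induct)
  case (insert i I)
  have "0 \<le> (\<Sum>i\<in>I. q i)" by (rule sum_nonneg) (use insert in auto)
  with insert assms(3) show ?case by (simp, smt (verit))
qed (use assms(3) in simp)

text \<open>For fixed \<open>i\<close> the bumps \<open>q n i\<close> increase to the indicator of
  \<open>U i - A\<close>. Hence the minimum \<open>h n\<close> of \<open>f\<close> with the sum of
  the first \<open>n\<close> bumps increases to \<open>f\<close>, and \<open>min_sum_le\<close>
  dominates it by pieces below the single sets \<open>U i\<close>. The Daniell condition, applied to
  \<open>f - h n\<close>, takes the place of the usual extraction of a finite subcover.\<close>

lemma content_UN:
  fixes U :: "nat \<Rightarrow> 'a set"
  assumes "\<And>i. open (U i)"
  shows "content (\<Union>i. U i) \<le> (\<Sum>i. content (U i))"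
  unfolding content_def[of "\<Union>i. U i"]
proof (rule SUP_least)
  fix f assume f: "f \<in> below (\<Union>i. U i)"
  then have fp: "f \<in> Lip_pos A" by (simp add: below_def)
  \<comment> \<open>The distance is taken to a set containing \<open>A\<close>, hence nonempty even
    for \<open>U i = UNIV\<close>: \<open>infdist\<close> to the empty set is 0 by convention, and
    the bump would vanish. Enlarging the set by \<open>A\<close> loses nothing, since
    \<open>f\<close> is 0 there.\<close>
  define q where "q n i x = min 1 (real n * infdist x (A \<union> - U i))" for n i x
  define h where "h n x = min (f x) (\<Sum>i<n. q n i x)" for n x
  have q0: "0 \<le> q n i x" for n i x by (simp add: q_def infdist_nonneg)
  have q_outside: "q n i x = 0" if "x \<notin> U i" for n i x using that by (simp add: q_def)
  have "1-lipschitz_on UNIV (\<lambda>x. infdist x B)" for B :: "'a set"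
    by (simp add: lipschitz_on_abs_diff infdist_triangle_abs)
  then have qlip: "(max 0 (real n * 1))-lipschitz_on UNIV (\<lambda>x. q n i x)" for n i
    unfolding q_def by (intro lipschitz_on_min lipschitz_on_constant lipschitz_on_cmult_real_nonneg) auto
  have slip: "(\<Sum>i<m. max 0 (real n * 1))-lipschitz_on UNIV (\<lambda>x. \<Sum>i<m. q n i x)" for n m :: nat
  proof (induction m)
    case (Suc m)
    from lipschitz_on_add[OF Suc qlip[of n m]] show ?case by (simp add: algebra_simps)
  qed (simp add: lipschitz_on_constant)
  have hp: "h n \<in> Lip_pos A" for n
    unfolding h_def by (rule Lip_pos_min_lipschitz[OF fp slip]) (auto intro: sum_nonneg q0)
  have minp: "(\<lambda>x. min (f x) (q n i x)) \<in> below (U i)" for n i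
  proof -
    have "min (f x) (q n i x) \<le> indicator (U i) x" for x
      by (cases "x \<in> U i") (auto simp: q_outside min.coboundedI2, simp add: q_def)
    then show ?thesis using Lip_pos_min_lipschitz[OF fp qlip q0] by (simp add: below_def)
  qed
  have hL: "ennreal (L (h n)) \<le> (\<Sum>i. content (U i))" for n
  proof -
    have "L (h n) \<le> L (\<lambda>x. \<Sum>i<n. min (f x) (q n i x))"
      using minp hp unfolding h_def
      by (intro mono Lip_pos_sum min_sum_le) (auto simp: below_def q0 Lip_posD(2)[OF fp])
    also have "\<dots> = (\<Sum>i<n. L (\<lambda>x. min (f x) (q n i x)))"
      using minp by (intro sum) (auto simp: below_def)
    finally have "ennreal (L (h n)) \<le> (\<Sum>i<n. ennreal (L (\<lambda>x. min (f x) (q n i x))))"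
      using minp by (subst sum_ennreal) (auto intro!: nonneg ennreal_leI simp: below_def)
    also have "\<dots> \<le> (\<Sum>i<n. content (U i))" by (intro sum_mono content_upper minp)
    also have "\<dots> \<le> (\<Sum>i. content (U i))" by (rule sum_le_suminf) auto
    finally show ?thesis .
  qed
  have "(\<lambda>n. L (\<lambda>x. f x - h n x)) \<longlonglongrightarrow> 0"
  proof (rule sigma_continuous)
    show "(\<lambda>x. f x - h n x) \<in> Lip_pos A" for n
      by (rule Lip_pos_diff[OF fp hp]) (simp add: h_def)
    show "f x - h (Suc n) x \<le> f x - h n x" for n x
    proof -
      have "q n i x \<le> q (Suc n) i x" for i
        unfolding q_def by (intro min.mono mult_right_mono infdist_nonneg) auto
      then have "(\<Sum>i<n. q n i x) \<le> (\<Sum>i<n. q (Suc n) i x)" by (intro sum_mono)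
      also have "\<dots> \<le> (\<Sum>i<Suc n. q (Suc n) i x)" using q0 by simp
      finally show ?thesis by (simp add: h_def)
    qed
    fix x
    show "(\<lambda>n. f x - h n x) \<longlonglongrightarrow> 0"
    proof (cases "f x = 0")
      case True
      then have "h n x = 0" for n by (simp add: h_def q0 sum_nonneg)
      with True show ?thesis by simp
    next
      case False
      moreover have fx: "f x \<le> indicator (\<Union>i. U i) x" using f by (simp add: below_def)
      ultimately obtain i where i: "x \<in> U i"
        using Lip_posD(2)[OF fp, of x] by (cases "x \<in> (\<Union>i. U i)") auto
      have "x \<notin> A" using False Lip_c_zero_on Lip_posD(1)[OF fp] by blast
      then have "infdist x (A \<union> - U i) > 0"
        using i assms closed nonempty by (intro infdist_pos_not_in_closed) auto
      then obtain N where N: "1 < real N * infdist x (A \<union> - U i)" by (metis reals_Archimedean3)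
      have "f x - h n x = 0" if "n \<ge> max N (Suc i)" for n
      proof -
        have "real N * infdist x (A \<union> - U i) \<le> real n * infdist x (A \<union> - U i)"
          using that by (intro mult_right_mono infdist_nonneg) auto
        with N have "q n i x = 1" by (simp add: q_def)
        moreover have "q n i x \<le> (\<Sum>i<n. q n i x)" using that q0 by (intro member_le_sum) auto
        ultimately have "1 \<le> (\<Sum>i<n. q n i x)" by simp
        moreover have "f x \<le> 1" using fx by (rule order_trans) (simp add: indicator_def)
        ultimately show ?thesis by (simp add: h_def)
      qed
      then show ?thesis
        by (intro tendsto_eventually) (auto simp: eventually_sequentially intro!: exI[of _ "max N (Suc i)"])
    qed
  qed
  moreover have "L (\<lambda>x. f x - h n x) = L f - L (h n)" for n
    by (rule diff[OF fp hp]) (simp add: h_def)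
  ultimately have "(\<lambda>n. L f - (L f - L (h n))) \<longlonglongrightarrow> L f - 0"
    by (intro tendsto_diff tendsto_const) simp
  then have "(\<lambda>n. ennreal (L (h n))) \<longlonglongrightarrow> ennreal (L f)" by (intro tendsto_ennrealI) simp
  then show "ennreal (L f) \<le> (\<Sum>i. content (U i))"
    by (rule LIMSEQ_le_const2) (use hL in auto)
qed

lemma outer_UN:
  fixes E :: "nat \<Rightarrow> 'a set"
  shows "outer (\<Union>i. E i) \<le> (\<Sum>i. outer (E i))"
proof (rule ennreal_le_epsilon)
  fix e :: real
  assume e: "0 < e" and fin: "(\<Sum>i. outer (E i)) < top"
  have "\<exists>U. open U \<and> E i - A \<subseteq> U \<and> content U \<le> outer (E i) + ennreal (e * (1/2)^Suc i)" for i
  proof -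
    have "outer (E i) < top" using fin by (metis ennreal_suminf_lessD)
    moreover have "0 < ennreal (e * (1/2)^Suc i)" using e by simp
    ultimately have "outer (E i) < outer (E i) + ennreal (e * (1/2)^Suc i)"
      using ennreal_add_left_cancel_less[of "outer (E i)" 0] by simp
    then show ?thesis unfolding outer_def[of "E i"] INF_less_iff by (auto intro: less_imp_le)
  qed
  then obtain U where U: "\<And>i. open (U i)" "\<And>i. E i - A \<subseteq> U i"
    "\<And>i. content (U i) \<le> outer (E i) + ennreal (e * (1/2)^Suc i)" by metis
  have "outer (\<Union>i. E i) \<le> content (\<Union>i. U i)"
    unfolding outer_def by (rule INF_lower) (use U in auto)
  also have "\<dots> \<le> (\<Sum>i. content (U i))" by (rule content_UN[OF U(1)])
  also have "\<dots> \<le> (\<Sum>i. outer (E i) + ennreal (e * (1/2)^Suc i))"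
    by (intro suminf_le U(3)) auto
  also have "\<dots> = (\<Sum>i. outer (E i)) + (\<Sum>i. ennreal (e * (1/2)^Suc i))"
    by (rule suminf_add[symmetric]) auto
  also have "(\<Sum>i. ennreal (e * (1/2)^Suc i)) = ennreal e"
    using e sums_mult[OF power_half_series, of e]
    by (intro suminf_ennreal_eq) (auto simp: sums_iff)
  finally show "outer (\<Union>i. E i) \<le> (\<Sum>i. outer (E i)) + ennreal e" .
qed

lemma outer_measure: "outer_measure_space (Pow UNIV) outer"
  unfolding outer_measure_space_def positive_def increasing_def countably_subadditive_def
  using outer_UN by (auto intro: outer_mono outer_subset_A)

lemma outer_Un: "outer (E \<union> F) \<le> outer E + outer F"
proof -
  define G :: "nat \<Rightarrow> 'a set" where "G i = (if i = 0 then E else if i = 1 then F else {})" for i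
  have "outer (\<Union>i. G i) \<le> (\<Sum>i. outer (G i))" by (rule outer_UN)
  also have "\<dots> = (\<Sum>i<2. outer (G i))"
    by (rule suminf_finite) (auto simp: G_def outer_subset_A)
  also have "\<dots> = outer E + outer F" by (simp add: G_def numeral_2_eq_2)
  also have "(\<Union>i. G i) = E \<union> F" by (auto simp: G_def split: if_splits)
  finally show ?thesis .
qed

text \<open>Cutting a function below the indicator of \<open>U \<inter> V\<close> at a positive level leaves a closed set
  inside \<open>V\<close>, away from which the content of \<open>U - V\<close> can be computed.\<close>

lemma outer_split_open:
  assumes "open V" "open U"
  shows "content (U \<inter> V) + outer (U - V) \<le> content U"
proof -
  have main: "ennreal (L f) + outer (U - V) \<le> content U" if f: "f \<in> below (U \<inter> V)" for f
  proof -
    have fp: "f \<in> Lip_pos A" using f by (simp add: below_def)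
    have step: "ennreal (L f - L (\<lambda>x. min (f x) c)) + outer (U - V) \<le> content U" if "c > 0" for c
    proof -
      define g where "g x = f x - min (f x) c" for x
      have gp: "g \<in> Lip_pos A"
        unfolding g_def using that by (intro Lip_pos_diff fp Lip_pos_min_const) auto
      have Lg: "L g = L f - L (\<lambda>x. min (f x) c)"
        unfolding g_def using that by (intro diff fp Lip_pos_min_const) auto
      \<comment> \<open>\<open>g\<close> vanishes on \<open>W\<close>, so \<open>g\<close> plus any
        function below \<open>W\<close> stays below \<open>U\<close>. As \<open>f\<close> is 0 off
        \<open>V\<close> and \<open>c\<close> is positive, \<open>W\<close> contains
        \<open>U - V\<close>.\<close>
      define W where "W = U \<inter> {x. f x < c}"
      have "open W"
        unfolding W_def using assms
        by (intro open_Int open_Collect_less Lip_c_continuous[OF Lip_posD(1)[OF fp]]) auto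
      have "f x \<le> 0" if "x \<notin> V" for x using f that by (auto simp: below_def dest!: spec[of _ x])
      then have "outer (U - V) \<le> content W"
        unfolding outer_def W_def using that \<open>open W\<close> W_def
        by (intro INF_lower) (auto intro: le_less_trans)
      moreover have "ennreal (L g) + content W \<le> content U"
        unfolding content_def[of W]
      proof -
        have ne: "below W \<noteq> {}" using zero_below by auto
        have "(SUP k\<in>below W. ennreal (L g) + ennreal (L k)) \<le> content U"
        proof (rule SUP_least)
          fix k assume k: "k \<in> below W"
          then have kp: "k \<in> Lip_pos A" by (simp add: below_def)
          have "g x + k x \<le> indicator U x" for x
          proof -
            have 1: "k x \<le> indicator W x" "f x \<le> indicator (U \<inter> V) x"
              using k f by (auto simp: below_def)
            have "0 \<le> f x" by (rule Lip_posD(2)[OF fp])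
            show ?thesis
            proof (cases "x \<in> W")
              case True
              with 1 show ?thesis by (simp add: g_def W_def min_absorb1)
            next
              case False
              with 1 have "k x \<le> 0" "g x \<le> f x" using \<open>0 \<le> f x\<close> that by (auto simp: g_def)
              moreover have "f x \<le> indicator U x" using 1(2) by (cases "x \<in> U"; cases "x \<in> V") auto
              ultimately show ?thesis by linarith
            qed
          qed
          then have "(\<lambda>x. g x + k x) \<in> below U" using gp kp by (simp add: below_def Lip_pos_add)
          from content_upper[OF this] show "ennreal (L g) + ennreal (L k) \<le> content U"
            unfolding add[OF gp kp] by (simp add: nonneg gp kp)
        qed
        then show "ennreal (L g) + (SUP k\<in>below W. ennreal (L k)) \<le> content U"
          by (subst ennreal_SUP_add_right[OF ne])
      qed
      ultimately show ?thesis unfolding Lg[symmetric]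
        by (meson add_left_mono order_trans)
    qed
    have "(\<lambda>n. L f - L (\<lambda>x. min (f x) (1 / Suc n))) \<longlonglongrightarrow> L f - 0"
      by (intro tendsto_diff tendsto_const tendsto_min_const fp)
    then have "(\<lambda>n. ennreal (L f - L (\<lambda>x. min (f x) (1 / Suc n))) + outer (U - V))
        \<longlonglongrightarrow> ennreal (L f) + outer (U - V)"
      by (intro tendsto_add tendsto_const tendsto_ennrealI) simp
    then show ?thesis
      by (rule LIMSEQ_le_const2) (auto intro!: exI[of _ 0] step)
  qed
  show ?thesis
    unfolding content_def[of "U \<inter> V"]
    by (subst ennreal_SUP_add_left[symmetric]) (use zero_below main in \<open>auto intro: SUP_least\<close>)
qed

section \<open>Caratheodory extension and the integral\<close>

lemma open_lambda_system: "open V \<Longrightarrow> V \<in> lambda_system UNIV (Pow UNIV) outer"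
proof -
  assume V: "open V"
  have "outer (V \<inter> E) + outer (- V \<inter> E) = outer E" for E
  proof (rule antisym)
    show "outer E \<le> outer (V \<inter> E) + outer (- V \<inter> E)"
      using outer_Un[of "V \<inter> E" "- V \<inter> E"] by (simp add: Int_Un_distrib2[symmetric])
    show "outer (V \<inter> E) + outer (- V \<inter> E) \<le> outer E"
      unfolding outer_def[of E]
    proof (rule INF_greatest, clarify)
      fix U assume U: "open U" "E - A \<subseteq> U"
      have "outer (V \<inter> E) \<le> content (U \<inter> V)"
        unfolding outer_def by (rule INF_lower) (use U V in auto)
      moreover have "outer (- V \<inter> E) \<le> outer (U - V)"
        unfolding outer_def by (rule INF_superset_mono) (use U in auto)
      ultimately show "outer (V \<inter> E) + outer (- V \<inter> E) \<le> content U"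
        using outer_split_open[OF V U(1)] by (meson add_mono order_trans)
    qed
  qed
  then show ?thesis by (auto simp: lambda_system_def Compl_eq_Diff_UNIV)
qed

definition representing :: "'a measure" where
  "representing = measure_of UNIV (sets borel) outer"

lemma sets_representing [simp, measurable_cong]: "sets representing = sets borel"
  using sets.sigma_sets_eq[of "borel :: 'a measure"] by (simp add: representing_def)

lemma space_representing [simp]: "space representing = UNIV"
  by (simp add: representing_def)

lemma emeasure_representing:
  assumes "E \<in> sets borel" shows "emeasure representing E = outer E"
proof -
  let ?L = "lambda_system UNIV (Pow UNIV) outer"
  have ms: "measure_space UNIV ?L outer"
    by (rule sigma_algebra.caratheodory_lemma[OF sigma_algebra_Pow outer_measure])
  then have sa: "sigma_algebra UNIV ?L" by (simp add: measure_space_def)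
  have "sets (borel :: 'a measure) \<subseteq> ?L"
    unfolding sets_borel using open_lambda_system
    by (intro sigma_algebra.sigma_sets_subset[OF sa]) auto
  then have "measure_space UNIV (sets borel) outer"
    by (intro measure_down[OF ms]) (metis sets.sigma_algebra_axioms space_borel)
  then show ?thesis
    unfolding representing_def using assms
    by (intro emeasure_measure_of_sigma) (auto simp: measure_space_def)
qed

lemma representing_A: "emeasure representing A = 0"
  using closed by (simp add: emeasure_representing outer_subset_A)

lemma representing_open: "open U \<Longrightarrow> emeasure representing U = content U"
  by (simp add: emeasure_representing outer_open)

text \<open>Cut \<open>f\<close> into layers of height \<open>t\<close>.  The layer between \<open>t * k\<close> and \<open>t * (k + 1)\<close> lies between
  \<open>t\<close> times the indicators of \<open>{f > t * (k + 1)}\<close> and \<open>{f > t * k}\<close>, so the functional and the integral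
  differ by at most the lowest layer.\<close>

theorem nn_integral_representing:
  assumes fp: "f \<in> Lip_pos A"
  shows "(\<integral>\<^sup>+ x. ennreal (f x) \<partial>representing) = ennreal (L f)"
proof -
  define u where "u t k x = min (f x) (t * (real k + 1)) - min (f x) (t * real k)" for t k x
  define a where "a t k = emeasure representing {x. f x > t * real k}" for t k
  have f0: "0 \<le> f x" for x by (rule Lip_posD(2)[OF fp])
  have [measurable]: "f \<in> borel_measurable borel" by (rule Lip_c_borel[OF Lip_posD(1)[OF fp]])
  have opn: "open {x. f x > c}" for c
    by (intro open_Collect_less continuous_on_const Lip_c_continuous[OF Lip_posD(1)[OF fp]])
  have up: "u t k \<in> Lip_pos A" if "t > 0" for t k
    unfolding u_def
  proof (rule Lip_pos_diff)
    show "(\<lambda>x. min (f x) (t * (real k + 1))) \<in> Lip_pos A" "(\<lambda>x. min (f x) (t * real k)) \<in> Lip_pos A"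
      using that by (auto intro!: Lip_pos_min_const fp)
    have "t * real k \<le> t * (real k + 1)" using that by simp
    then show "min (f x) (t * real k) \<le> min (f x) (t * (real k + 1))" for x by linarith
  qed
  have u0: "0 \<le> u t k x" if "t > 0" for t k x by (rule Lip_posD(2)[OF up[OF that]])
  have u_lower: "t * indicator {x. f x > t * (real k + 1)} x \<le> u t k x" if "t > 0" for t k x
    using that f0[of x] by (auto simp: u_def indicator_def min_def algebra_simps not_le)
  have u_upper: "u t k x \<le> t * indicator {x. f x > t * real k} x" if "t > 0" for t k x
    using that f0[of x] by (auto simp: u_def indicator_def min_def algebra_simps)
  have um [measurable]: "u t k \<in> borel_measurable borel" for t k by (simp add: u_def[abs_def])
  obtain B where B: "\<And>x. \<bar>f x\<bar> \<le> B" "0 < B" using Lip_c_bounded[OF Lip_posD(1)[OF fp]] by blast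
  have telescope: "(\<Sum>k<n. u t k x) = min (f x) (t * real n)" if "t > 0" for t n x
    using f0[of x] by (induction n) (auto simp: u_def add.commute)
  have L_upper: "ennreal (L (u t k)) \<le> ennreal t * a t k" if t: "t > 0" for t k
  proof -
    have "(\<lambda>x. (1 / t) * u t k x) \<in> below {x. f x > t * real k}"
      unfolding below_def mem_Collect_eq
    proof (intro conjI allI)
      show "(\<lambda>x. (1 / t) * u t k x) \<in> Lip_pos A" using t by (intro Lip_pos_cmult up) auto
      show "(1 / t) * u t k x \<le> indicator {x. f x > t * real k} x" for x
        using u_upper[OF t, of k x] t by (simp add: pos_divide_le_eq mult.commute)
    qed
    from content_upper[OF this] have "ennreal (L (u t k) / t) \<le> a t k"
      using t cmult[OF up[OF t], of "1 / t" k] by (simp add: a_def representing_open opn)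
    then have "ennreal t * ennreal (L (u t k) / t) \<le> ennreal t * a t k" by (intro mult_left_mono) auto
    then show ?thesis using t by (simp add: ennreal_mult[symmetric] nonneg up)
  qed
  have L_lower: "ennreal t * a t (Suc k) \<le> ennreal (L (u t k))" if t: "t > 0" for t k
  proof -
    have "ennreal t * a t (Suc k) = (SUP g\<in>below {x. f x > t * real (Suc k)}. ennreal t * ennreal (L g))"
      unfolding a_def representing_open[OF opn] content_def by (rule SUP_mult_left_ennreal)
    also have "\<dots> \<le> ennreal (L (u t k))"
    proof (rule SUP_least)
      fix g assume g: "g \<in> below {x. f x > t * real (Suc k)}"
      then have gp: "g \<in> Lip_pos A" by (simp add: below_def)
      have "L (\<lambda>x. t * g x) \<le> L (u t k)"
      proof (rule mono[OF up[OF t] Lip_pos_cmult[OF gp]])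
        fix x
        have "t * g x \<le> t * indicator {x. f x > t * (real k + 1)} x"
          using g t by (intro mult_left_mono) (auto simp: below_def add.commute)
        also have "\<dots> \<le> u t k x" by (rule u_lower[OF t])
        finally show "t * g x \<le> u t k x" .
      qed (use t in simp)
      then show "ennreal t * ennreal (L g) \<le> ennreal (L (u t k))"
        using t gp by (simp add: cmult ennreal_mult[symmetric] nonneg ennreal_leI)
    qed
    finally show ?thesis .
  qed
  have I_upper: "(\<integral>\<^sup>+ x. u t k x \<partial>representing) \<le> ennreal t * a t k" if t: "t > 0" for t k
  proof -
    have "(\<integral>\<^sup>+ x. u t k x \<partial>representing) \<le> (\<integral>\<^sup>+ x. ennreal t * indicator {x. f x > t * real k} x \<partial>representing)"
    proof (rule nn_integral_mono)
      fix x
      have "ennreal (u t k x) \<le> ennreal (t * indicator {x. f x > t * real k} x)"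
        by (rule ennreal_leI[OF u_upper[OF t]])
      also have "\<dots> = ennreal t * indicator {x. f x > t * real k} x"
        using t by (simp add: indicator_def)
      finally show "ennreal (u t k x) \<le> ennreal t * indicator {x. f x > t * real k} x" .
    qed
    also have "\<dots> = ennreal t * a t k"
      unfolding a_def by (rule nn_integral_cmult_indicator) simp
    finally show ?thesis .
  qed
  have I_lower: "ennreal t * a t (Suc k) \<le> (\<integral>\<^sup>+ x. u t k x \<partial>representing)" if t: "t > 0" for t k
  proof -
    have "ennreal t * a t (Suc k) = (\<integral>\<^sup>+ x. ennreal t * indicator {x. f x > t * real (Suc k)} x \<partial>representing)"
      unfolding a_def by (rule nn_integral_cmult_indicator[symmetric]) simp
    also have "\<dots> \<le> (\<integral>\<^sup>+ x. u t k x \<partial>representing)"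
    proof (rule nn_integral_mono)
      fix x
      have "ennreal t * indicator {x. f x > t * real (Suc k)} x
          = ennreal (t * indicator {x. f x > t * (real k + 1)} x)"
        using t by (simp add: indicator_def add.commute)
      also have "\<dots> \<le> ennreal (u t k x)" by (rule ennreal_leI[OF u_lower[OF t]])
      finally show "ennreal t * indicator {x. f x > t * real (Suc k)} x \<le> ennreal (u t k x)" .
    qed
    finally show ?thesis .
  qed
  have layers: "(\<Sum>k<n. u t (Suc k) x) = f x - min (f x) t" if "t > 0" "B \<le> t * real n" for t n x
  proof -
    have "t * real n \<le> t * real (Suc n)" using that by (intro mult_left_mono) auto
    with that B(1)[of x] have "f x \<le> t * real (Suc n)" by linarith
    then have "u t 0 x + (\<Sum>k<n. u t (Suc k) x) = f x"
      using telescope[OF that(1), of x "Suc n"] unfolding sum.lessThan_Suc_shift by simp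
    moreover have "u t 0 x = min (f x) t" using f0[of x] by (simp add: u_def)
    ultimately show ?thesis by simp
  qed
  have bound: "\<exists>n. B \<le> t * real n" if "t > 0" for t
    using reals_Archimedean3[OF that, of] by (metis less_imp_le mult.commute)
  \<comment> \<open>The layers are compared with a shift by one: layer \<open>Suc k\<close> of the
    integral lies below the mass of the superlevel set that layer \<open>k\<close> of the functional
    dominates. What stays uncovered is layer 0, that is \<open>min (f x) t\<close>, and it
    disappears as \<open>t\<close> tends to 0. \<open>L_le\<close> exchanges the two roles.\<close>
  have I_le: "(\<integral>\<^sup>+ x. ennreal (f x - min (f x) t) \<partial>representing) \<le> ennreal (L f)" if t: "t > 0" for t
  proof -
    obtain n where n: "B \<le> t * real n" using bound[OF t] by blast
    have "(\<integral>\<^sup>+ x. ennreal (f x - min (f x) t) \<partial>representing)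
        = (\<integral>\<^sup>+ x. (\<Sum>k<n. ennreal (u t (Suc k) x)) \<partial>representing)"
      using u0[OF t] by (simp add: layers[OF t n, symmetric] sum_ennreal)
    also have "\<dots> = (\<Sum>k<n. \<integral>\<^sup>+ x. u t (Suc k) x \<partial>representing)"
      by (rule nn_integral_sum) simp
    also have "\<dots> \<le> (\<Sum>k<n. ennreal t * a t (Suc k))" by (intro sum_mono I_upper t)
    also have "\<dots> \<le> (\<Sum>k<n. ennreal (L (u t k)))" by (intro sum_mono L_lower t)
    also have "\<dots> = ennreal (L (\<lambda>x. \<Sum>k<n. u t k x))"
      using up[OF t] by (simp add: sum sum_ennreal nonneg)
    also have "\<dots> \<le> ennreal (L f)"
      using t by (simp add: telescope) (intro ennreal_leI mono fp Lip_pos_min_const, auto)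
    finally show ?thesis .
  qed
  have L_le: "ennreal (L f - L (\<lambda>x. min (f x) t)) \<le> (\<integral>\<^sup>+ x. f x \<partial>representing)" if t: "t > 0" for t
  proof -
    obtain n where n: "B \<le> t * real n" using bound[OF t] by blast
    have "ennreal (L f - L (\<lambda>x. min (f x) t)) = ennreal (L (\<lambda>x. f x - min (f x) t))"
      using t fp by (subst diff) (auto intro: Lip_pos_min_const)
    also have "\<dots> = (\<Sum>k<n. ennreal (L (u t (Suc k))))"
      using up[OF t] by (simp add: layers[OF t n, symmetric] sum sum_ennreal nonneg)
    also have "\<dots> \<le> (\<Sum>k<n. ennreal t * a t (Suc k))" by (intro sum_mono L_upper t)
    also have "\<dots> \<le> (\<Sum>k<n. \<integral>\<^sup>+ x. u t k x \<partial>representing)" by (intro sum_mono I_lower t)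
    also have "\<dots> = (\<integral>\<^sup>+ x. (\<Sum>k<n. ennreal (u t k x)) \<partial>representing)"
      by (rule nn_integral_sum[symmetric]) simp
    also have "\<dots> \<le> (\<integral>\<^sup>+ x. f x \<partial>representing)"
      using u0[OF t] by (intro nn_integral_mono) (simp add: sum_ennreal telescope t ennreal_leI)
    finally show ?thesis .
  qed
  show ?thesis
  proof (rule antisym)
    have lim: "(\<lambda>n. f x - min (f x) (1 / Suc n)) \<longlonglongrightarrow> f x" for x
      using tendsto_diff[OF tendsto_const[of "f x"]
          tendsto_min[OF tendsto_const[of "f x"] LIMSEQ_Suc[OF lim_1_over_n[where 'a=real]]]] f0[of x]
      by (simp add: min_absorb2)
    have "(\<integral>\<^sup>+ x. ennreal (f x) \<partial>representing)
        = (\<integral>\<^sup>+ x. (SUP n. ennreal (f x - min (f x) (1 / Suc n))) \<partial>representing)"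
    proof (rule nn_integral_cong)
      fix x
      have "(\<lambda>n. ennreal (f x - min (f x) (1 / Suc n))) \<longlonglongrightarrow> (SUP n. ennreal (f x - min (f x) (1 / Suc n)))"
        by (rule LIMSEQ_SUP) (auto intro!: incseq_SucI ennreal_leI diff_left_mono min.mono simp: field_simps)
      moreover have "(\<lambda>n. ennreal (f x - min (f x) (1 / Suc n))) \<longlonglongrightarrow> ennreal (f x)"
        by (intro tendsto_ennrealI lim)
      ultimately show "ennreal (f x) = (SUP n. ennreal (f x - min (f x) (1 / Suc n)))"
        by (rule LIMSEQ_unique[symmetric])
    qed
    also have "\<dots> = (SUP n. \<integral>\<^sup>+ x. ennreal (f x - min (f x) (1 / Suc n)) \<partial>representing)"
      by (rule nn_integral_monotone_convergence_SUP)
         (auto intro!: incseq_SucI le_funI ennreal_leI diff_left_mono min.mono simp: field_simps)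
    also have "\<dots> \<le> ennreal (L f)" by (intro SUP_least I_le) simp
    finally show "(\<integral>\<^sup>+ x. ennreal (f x) \<partial>representing) \<le> ennreal (L f)" .
    have "(\<lambda>n. ennreal (L f - L (\<lambda>x. min (f x) (1 / Suc n)))) \<longlonglongrightarrow> ennreal (L f - 0)"
      by (intro tendsto_ennrealI tendsto_diff tendsto_const tendsto_min_const fp)
    then show "ennreal (L f) \<le> (\<integral>\<^sup>+ x. ennreal (f x) \<partial>representing)"
      by (intro LIMSEQ_le_const2[where X="\<lambda>n. ennreal (L f - L (\<lambda>x. min (f x) (1 / Suc n)))"])
         (auto intro!: exI[of _ 0] L_le)
  qed
qed

end

section \<open>The positive part of a functional\<close>

context
  fixes A :: "'a::metric_space set" and T :: "('a \<Rightarrow> real) \<Rightarrow> real"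
  assumes T: "T \<in> seq_order_continuous_dual (Lip_c A)"
begin

lemma functional_add: "f \<in> Lip_c A \<Longrightarrow> g \<in> Lip_c A \<Longrightarrow> T (\<lambda>x. f x + g x) = T f + T g"
  using T by (auto simp: seq_order_continuous_dual_def order_bounded_dual_def linear_functional_def)

lemma functional_cmult: "f \<in> Lip_c A \<Longrightarrow> T (\<lambda>x. c * f x) = c * T f"
  using T by (auto simp: seq_order_continuous_dual_def order_bounded_dual_def linear_functional_def)

lemma functional_zero: "T (\<lambda>_. 0) = 0"
  using functional_cmult[OF Lip_c_zero, of 0] by simp

lemma functional_minus: "f \<in> Lip_c A \<Longrightarrow> T (\<lambda>x. - f x) = - T f"
  using functional_cmult[of f "-1"] by simp

lemma functional_diff: "f \<in> Lip_c A \<Longrightarrow> g \<in> Lip_c A \<Longrightarrow> T (\<lambda>x. f x - g x) = T f - T g"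
  using functional_add[of f "\<lambda>x. - g x"] by (simp add: functional_minus Lip_c_minus)

text \<open>\<open>F\<close> serves as its own dominating sequence. Its infimum in
  \<open>Lip_c A\<close> is 0 because a lower bound in \<open>Lip_c A\<close> is one at each point,
  where \<open>F\<close> tends to 0.\<close>

lemma functional_sigma_continuous:
  assumes "\<And>n. F n \<in> Lip_pos A" "\<And>n x. F (Suc n) x \<le> F n x" "\<And>x. (\<lambda>n. F n x) \<longlonglongrightarrow> 0"
  shows "(\<lambda>n. T (F n)) \<longlonglongrightarrow> 0"
proof -
  have "order_null_sequence (Lip_c A) F"
    unfolding order_null_sequence_def
  proof (intro exI[of _ F] conjI allI ballI impI)
    show "decseq F" by (rule decseq_SucI) (simp add: le_fun_def assms(2))
    show "F n \<in> Lip_c A" "(\<lambda>_. 0) \<le> F n" "(\<lambda>t. \<bar>F n t\<bar>) \<le> F n" for n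
      using assms(1)[of n] by (auto simp: Lip_pos_def le_fun_def)
    show "g \<le> (\<lambda>_. 0)" if "g \<in> Lip_c A" "\<forall>n. g \<le> F n" for g
      using that by (auto simp: le_fun_def intro!: LIMSEQ_le_const[OF assms(3)])
  qed
  then show ?thesis
    using T Lip_posD(1)[OF assms(1)] by (auto simp: seq_order_continuous_dual_def)
qed

text \<open>The Riesz-Kantorovich formula. For \<open>f\<close> in the cone the supremum is finite
  because \<open>T\<close> is order bounded.\<close>

definition pos_part :: "('a \<Rightarrow> real) \<Rightarrow> real" where
  "pos_part f = (SUP g\<in>{g \<in> Lip_pos A. \<forall>x. g x \<le> f x}. T g)"

lemma pos_part_upper:
  assumes "f \<in> Lip_pos A" "g \<in> Lip_pos A" "\<And>x. g x \<le> f x"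
  shows "T g \<le> pos_part f"
  unfolding pos_part_def
proof (rule cSUP_upper)
  have "bounded (T ` {g \<in> Lip_c A. (\<lambda>_. 0) \<le> g \<and> g \<le> f})"
    using T Lip_c_zero Lip_posD(1)[OF assms(1)]
    by (auto simp: seq_order_continuous_dual_def order_bounded_dual_def)
  then show "bdd_above (T ` {g \<in> Lip_pos A. \<forall>x. g x \<le> f x})"
    by (rule bdd_above_mono[OF bounded_imp_bdd_above]) (auto simp: Lip_pos_def le_fun_def)
qed (use assms in auto)

lemma pos_part_least:
  assumes "f \<in> Lip_pos A" "\<And>g. g \<in> Lip_pos A \<Longrightarrow> (\<And>x. g x \<le> f x) \<Longrightarrow> T g \<le> c"
  shows "pos_part f \<le> c"
  unfolding pos_part_def by (rule cSUP_least) (use assms in auto)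

lemma pos_part_ge: "f \<in> Lip_pos A \<Longrightarrow> T f \<le> pos_part f"
  by (rule pos_part_upper) auto

lemma pos_part_nonneg: "f \<in> Lip_pos A \<Longrightarrow> 0 \<le> pos_part f"
  using pos_part_upper[of f "\<lambda>_. 0"] by (simp add: Lip_pos_zero functional_zero Lip_posD)

text \<open>Superadditivity just adds two competitors. Subadditivity is the Riesz decomposition
  property: a competitor \<open>h\<close> below \<open>f + g\<close> splits into
  \<open>min h f\<close>, below \<open>f\<close>, and the remainder, below \<open>g\<close>.\<close>

lemma pos_part_add:
  assumes "f \<in> Lip_pos A" "g \<in> Lip_pos A"
  shows "pos_part (\<lambda>x. f x + g x) = pos_part f + pos_part g"
proof (rule antisym)
  show "pos_part (\<lambda>x. f x + g x) \<le> pos_part f + pos_part g"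
  proof (rule pos_part_least[OF Lip_pos_add[OF assms]])
    fix h assume h: "h \<in> Lip_pos A" "\<And>x. h x \<le> f x + g x"
    let ?h1 = "\<lambda>x. min (h x) (f x)" and ?h2 = "\<lambda>x. h x - min (h x) (f x)"
    have 1: "?h1 \<in> Lip_pos A" by (rule Lip_pos_min[OF h(1) assms(1)])
    have 2: "?h2 \<in> Lip_pos A" by (rule Lip_pos_diff[OF h(1) 1]) simp
    have "?h2 x \<le> g x" for x using h(2)[of x] Lip_posD(2)[OF assms(2), of x] by linarith
    then have "T ?h2 \<le> pos_part g" by (rule pos_part_upper[OF assms(2) 2])
    moreover have "T ?h1 \<le> pos_part f" by (rule pos_part_upper[OF assms(1) 1]) simp
    moreover have "T h = T ?h1 + T ?h2"
      using functional_add[OF Lip_posD(1)[OF 1] Lip_posD(1)[OF 2]] by simp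
    ultimately show "T h \<le> pos_part f + pos_part g" by simp
  qed
  have "pos_part f \<le> pos_part (\<lambda>x. f x + g x) - pos_part g"
  proof (rule pos_part_least[OF assms(1)])
    fix h assume h: "h \<in> Lip_pos A" "\<And>x. h x \<le> f x"
    have "pos_part g \<le> pos_part (\<lambda>x. f x + g x) - T h"
    proof (rule pos_part_least[OF assms(2)])
      fix k assume k: "k \<in> Lip_pos A" "\<And>x. k x \<le> g x"
      have "T (\<lambda>x. h x + k x) \<le> pos_part (\<lambda>x. f x + g x)"
        using h k by (intro pos_part_upper Lip_pos_add assms) (auto intro: add_mono)
      then show "T k \<le> pos_part (\<lambda>x. f x + g x) - T h"
        using functional_add[OF Lip_posD(1)[OF h(1)] Lip_posD(1)[OF k(1)]] by simp
    qed
    then show "T h \<le> pos_part (\<lambda>x. f x + g x) - pos_part g" by simp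
  qed
  then show "pos_part f + pos_part g \<le> pos_part (\<lambda>x. f x + g x)" by simp
qed

lemma pos_part_zero: "pos_part (\<lambda>_. 0) = 0"
  using pos_part_add[OF Lip_pos_zero Lip_pos_zero] by simp

lemma pos_part_diff:
  assumes "f \<in> Lip_pos A" "g \<in> Lip_pos A" "\<And>x. g x \<le> f x"
  shows "pos_part (\<lambda>x. f x - g x) = pos_part f - pos_part g"
  using pos_part_add[OF Lip_pos_diff[OF assms] assms(2)] by simp

lemma pos_part_cmult_le:
  assumes "f \<in> Lip_pos A" "c > 0"
  shows "pos_part (\<lambda>x. c * f x) \<le> c * pos_part f"
proof (rule pos_part_least)
  show "(\<lambda>x. c * f x) \<in> Lip_pos A" using assms by (simp add: Lip_pos_cmult)
  fix g assume g: "g \<in> Lip_pos A" "\<And>x. g x \<le> c * f x"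
  have g': "(\<lambda>x. 1 / c * g x) \<in> Lip_pos A" using assms g by (intro Lip_pos_cmult) auto
  have "T (\<lambda>x. 1 / c * g x) \<le> pos_part f"
  proof (rule pos_part_upper[OF assms(1) g'])
    show "1 / c * g x \<le> f x" for x using g(2)[of x] assms(2) by (simp add: field_simps)
  qed
  then have "1 / c * T g \<le> pos_part f" by (simp only: functional_cmult[OF Lip_posD(1)[OF g(1)]])
  then show "T g \<le> c * pos_part f" using assms(2) by (simp add: pos_divide_le_eq mult.commute)
qed

lemma pos_part_cmult:
  assumes "f \<in> Lip_pos A" "c \<ge> 0"
  shows "pos_part (\<lambda>x. c * f x) = c * pos_part f"
proof (cases "c = 0")
  case False
  with assms(2) have c: "c > 0" by simp
  then have "pos_part (\<lambda>x. 1 / c * (c * f x)) \<le> 1 / c * pos_part (\<lambda>x. c * f x)"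
    by (intro pos_part_cmult_le Lip_pos_cmult assms) auto
  with c have "c * pos_part f \<le> pos_part (\<lambda>x. c * f x)" by (simp add: field_simps)
  with pos_part_cmult_le[OF assms(1) c] show ?thesis by simp
qed (simp add: pos_part_zero)

text \<open>If \<open>g \<le> F 0\<close> almost attains the supremum defining \<open>pos_part (F 0)\<close>, then
  \<open>T (min g (F n))\<close> almost dominates \<open>pos_part (F n)\<close>, because \<open>g - min g (F n) \<le> F 0 - F n\<close>.\<close>

lemma pos_part_sigma_continuous:
  assumes F: "\<And>n. F n \<in> Lip_pos A" and dec: "\<And>n x. F (Suc n) x \<le> F n x"
    and lim: "\<And>x. (\<lambda>n. F n x) \<longlonglongrightarrow> 0"
  shows "(\<lambda>n. pos_part (F n)) \<longlonglongrightarrow> 0"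
proof (rule LIMSEQ_I)
  fix e :: real assume e: "0 < e"
  have F0: "F n x \<le> F 0 x" for n x by (induction n) (auto intro: order_trans[OF dec])
  obtain g where g: "g \<in> Lip_pos A" "\<And>x. g x \<le> F 0 x" "pos_part (F 0) - e / 2 < T g"
  proof (rule ccontr)
    assume "\<not> thesis"
    then have "pos_part (F 0) \<le> pos_part (F 0) - e / 2"
      using that by (intro pos_part_least F) (meson not_le)
    with e show False by simp
  qed
  let ?g = "\<lambda>n x. min (g x) (F n x)"
  have gn: "?g n \<in> Lip_pos A" for n by (rule Lip_pos_min[OF g(1) F])
  have "(\<lambda>n. T (?g n)) \<longlonglongrightarrow> 0"
  proof (rule functional_sigma_continuous[OF gn])
    show "min (g x) (F (Suc n) x) \<le> min (g x) (F n x)" for n x using dec[of n x] by linarith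
    fix x
    have "(\<lambda>n. ?g n x) \<longlonglongrightarrow> min (g x) 0" by (intro tendsto_min tendsto_const lim)
    then show "(\<lambda>n. ?g n x) \<longlonglongrightarrow> 0" using Lip_posD(2)[OF g(1), of x] by (simp add: min_absorb2)
  qed
  then obtain N where N: "\<And>n. n \<ge> N \<Longrightarrow> \<bar>T (?g n)\<bar> < e / 2"
    using LIMSEQ_D[of _ 0 "e/2"] e by fastforce
  have "\<bar>pos_part (F n)\<bar> < e" if "n \<ge> N" for n
  proof -
    have "T (\<lambda>x. g x - ?g n x) \<le> pos_part (\<lambda>x. F 0 x - F n x)"
    proof (rule pos_part_upper)
      show "(\<lambda>x. F 0 x - F n x) \<in> Lip_pos A" by (rule Lip_pos_diff[OF F F F0])
      show "(\<lambda>x. g x - ?g n x) \<in> Lip_pos A" by (rule Lip_pos_diff[OF g(1) gn]) simp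
      show "g x - ?g n x \<le> F 0 x - F n x" for x using g(2)[of x] F0[of n x] by linarith
    qed
    also have "\<dots> = pos_part (F 0) - pos_part (F n)" by (rule pos_part_diff[OF F F F0])
    also have "T (\<lambda>x. g x - ?g n x) = T g - T (?g n)"
      by (rule functional_diff[OF Lip_posD(1)[OF g(1)] Lip_posD(1)[OF gn]])
    finally show ?thesis using g(3) N[OF that] pos_part_nonneg[OF F, of n] by linarith
  qed
  then show "\<exists>N. \<forall>n\<ge>N. norm (pos_part (F n) - 0) < e" by auto
qed

lemma pos_part_positive_functional:
  assumes "closed A" "A \<noteq> {}"
  shows "positive_lip_functional A pos_part"
  using assms by unfold_locales
    (auto intro: pos_part_nonneg pos_part_add pos_part_cmult pos_part_sigma_continuous)

lemma neg_part_positive_functional: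
  assumes "closed A" "A \<noteq> {}"
  shows "positive_lip_functional A (\<lambda>f. pos_part f - T f)"
proof unfold_locales
  fix f g and c :: real
  assume f: "f \<in> Lip_pos A"
  show "0 \<le> pos_part f - T f" using pos_part_ge[OF f] by simp
  show "pos_part (\<lambda>x. f x + g x) - T (\<lambda>x. f x + g x) = pos_part f - T f + (pos_part g - T g)"
    if "g \<in> Lip_pos A" using f that by (simp add: pos_part_add functional_add Lip_posD)
  show "pos_part (\<lambda>x. c * f x) - T (\<lambda>x. c * f x) = c * (pos_part f - T f)" if "0 \<le> c"
    using f that by (simp add: pos_part_cmult functional_cmult Lip_posD right_diff_distrib)
next
  fix F assume F: "\<And>n. F n \<in> Lip_pos A" "\<And>n x. F (Suc n) x \<le> F n x" "\<And>x. (\<lambda>n. F n x) \<longlonglongrightarrow> (0::real)"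
  from tendsto_diff[OF pos_part_sigma_continuous[OF F] functional_sigma_continuous[OF F]]
  show "(\<lambda>n. pos_part (F n) - T (F n)) \<longlonglongrightarrow> 0" by simp
qed (use assms in auto)

text \<open>For \<open>g\<close> between 0 and \<open>f\<close>, both \<open>T g\<close> and
  \<open>T g - T f = - T (f - g)\<close> are at most \<open>M f\<close>, since \<open>M\<close>
  dominates \<open>T\<close> and \<open>- T\<close> and is monotone on the cone. This carries the
  boundedness of \<open>|T|\<close> over to the two measures.\<close>

lemma pos_neg_part_le_abs:
  assumes M: "is_functional_abs (Lip_c A) T M" and f: "f \<in> Lip_pos A"
  shows "pos_part f \<le> M f" "pos_part f - T f \<le> M f"
proof -
  have ge: "T g \<le> M g" "- T g \<le> M g" if "g \<in> Lip_pos A" for g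
    using M that by (auto simp: is_functional_abs_def functional_le_def Lip_pos_def le_fun_def)
  have add: "M (\<lambda>x. g x + h x) = M g + M h" if "g \<in> Lip_c A" "h \<in> Lip_c A" for g h
    using M that by (auto simp: is_functional_abs_def order_bounded_dual_def linear_functional_def)
  have split: "M f = M g + M (\<lambda>x. f x - g x)" "T f = T g + T (\<lambda>x. f x - g x)"
    "T (\<lambda>x. f x - g x) \<le> M (\<lambda>x. f x - g x)" "- T (\<lambda>x. f x - g x) \<le> M (\<lambda>x. f x - g x)"
    if "g \<in> Lip_pos A" "\<And>x. g x \<le> f x" for g
    using add[of g "\<lambda>x. f x - g x"] functional_add[of g "\<lambda>x. f x - g x"] ge[OF Lip_pos_diff[OF f that]]
      Lip_posD(1)[OF that(1)] Lip_posD(1)[OF Lip_pos_diff[OF f that]]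
    by auto
  show "pos_part f \<le> M f"
    by (rule pos_part_least[OF f]) (smt (verit) split ge)
  have "pos_part f \<le> M f + T f"
    by (rule pos_part_least[OF f]) (smt (verit) split ge)
  then show "pos_part f - T f \<le> M f" by simp
qed

end

section \<open>Relative measures\<close>

definition level :: "'a::metric_space set \<Rightarrow> nat \<Rightarrow> 'a set" where
  "level A n = {x. 1 / Suc n \<le> infdist x A}"

lemma closed_level: "closed (level A n)"
  unfolding level_def by (intro closed_Collect_le continuous_intros)

lemma level_borel [measurable]: "level A n \<in> sets borel"
  by (rule borel_closed[OF closed_level])

lemma borel_measurable_infdist_const [measurable]: "(\<lambda>x. infdist x A) \<in> borel_measurable borel"
  by (intro borel_measurable_continuous_onI continuous_intros)

lemma incseq_level: "incseq (level A)"
proof (rule incseq_SucI)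
  fix n
  have "1 / real (Suc (Suc n)) \<le> 1 / real (Suc n)" by (simp add: frac_le)
  then show "level A n \<subseteq> level A (Suc n)" unfolding level_def by (auto intro: order_trans)
qed

lemma UN_level:
  assumes "closed A" "A \<noteq> {}" shows "(\<Union>n. level A n) = - A"
proof -
  have "x \<in> (\<Union>n. level A n)" if "x \<notin> A" for x
  proof -
    have "0 < infdist x A" by (rule infdist_pos_not_in_closed[OF assms that])
    then obtain n where "1 / Suc n < infdist x A" using reals_Archimedean by (auto simp: inverse_eq_divide)
    then show ?thesis by (auto simp: level_def intro: less_imp_le)
  qed
  moreover have "x \<notin> A" if "x \<in> level A n" for x n
  proof
    assume "x \<in> A"
    then have "1 / real (Suc n) \<le> 0" using that by (simp add: level_def)
    then show False by (simp add: divide_le_0_iff)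
  qed
  ultimately show ?thesis by auto
qed

lemma Lim_emeasure_level:
  assumes "closed A" "A \<noteq> {}" "sets \<mu> = sets borel" "E \<in> sets borel" "E \<subseteq> - A"
  shows "(\<lambda>n. emeasure \<mu> (E \<inter> level A n)) \<longlonglongrightarrow> emeasure \<mu> E"
proof -
  have "(\<lambda>n. emeasure \<mu> (E \<inter> level A n)) \<longlonglongrightarrow> emeasure \<mu> (\<Union>n. E \<inter> level A n)"
    using assms incseq_level[of A] by (intro Lim_emeasure_incseq) (auto simp: incseq_def, blast)
  also have "(\<Union>n. E \<inter> level A n) = E" using UN_level[OF assms(1,2)] assms(5) by blast
  finally show ?thesis .
qed

text \<open>Markov's inequality for the distance to \<open>A\<close>. Near \<open>A\<close> the mass
  may be infinite; cancellation, inner regularity and sigma-finiteness below all rest on this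
  finiteness.\<close>

lemma emeasure_away_finite:
  assumes "sets \<mu> = sets borel" "(\<integral>\<^sup>+ x. ennreal (infdist x A) \<partial>\<mu>) < \<infinity>" "c > 0"
  shows "emeasure \<mu> {x. c \<le> infdist x A} < \<infinity>"
proof -
  have [measurable_cong]: "sets \<mu> = sets borel" by fact
  have "ennreal c * emeasure \<mu> {x. c \<le> infdist x A} = (\<integral>\<^sup>+ x. ennreal c * indicator {x. c \<le> infdist x A} x \<partial>\<mu>)"
    by (rule nn_integral_cmult_indicator[symmetric]) measurable
  also have "\<dots> \<le> (\<integral>\<^sup>+ x. ennreal (infdist x A) \<partial>\<mu>)"
    by (rule nn_integral_mono) (auto simp: indicator_def intro: ennreal_leI)
  also note assms(2)
  finally show ?thesis using \<open>c > 0\<close> by (auto simp: ennreal_mult_less_top)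
qed

lemma emeasure_level_finite:
  assumes "sets \<mu> = sets borel" "(\<integral>\<^sup>+ x. ennreal (infdist x A) \<partial>\<mu>) < \<infinity>"
  shows "emeasure \<mu> (level A n) < \<infinity>"
  unfolding level_def by (rule emeasure_away_finite[OF assms]) simp

text \<open>Replaces the quotient by equality off \<open>A\<close>. For the converse each measure
  receives the restriction of the other to \<open>A\<close>; this exchange involves no subtraction
  and so tolerates infinite mass on \<open>A\<close>.\<close>

lemma rel_eq_iff:
  assumes "closed A" "sets \<mu> = sets borel" "sets \<nu> = sets borel"
  shows "rel_eq A \<mu> \<nu> \<longleftrightarrow> (\<forall>E\<in>sets borel. E \<subseteq> - A \<longrightarrow> emeasure \<mu> E = emeasure \<nu> E)"
proof
  assume "rel_eq A \<mu> \<nu>"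
  then obtain \<sigma> \<tau> where st: "sets \<sigma> = sets borel" "sets \<tau> = sets borel" "emeasure \<sigma> (- A) = 0"
    "emeasure \<tau> (- A) = 0" and eq: "add_measure \<mu> \<sigma> = add_measure \<nu> \<tau>"
    by (auto simp: rel_eq_def concentrated_on_def borel_measures_def)
  show "\<forall>E\<in>sets borel. E \<subseteq> - A \<longrightarrow> emeasure \<mu> E = emeasure \<nu> E"
  proof safe
    fix E :: "'a set" assume E: "E \<in> sets borel" "E \<subseteq> - A"
    have "emeasure \<sigma> E = 0" "emeasure \<tau> E = 0"
      using st assms(1) E emeasure_mono[of E "- A" \<sigma>] emeasure_mono[of E "- A" \<tau>] by auto
    then show "emeasure \<mu> E = emeasure \<nu> E"
      using arg_cong[OF eq, of "\<lambda>M. emeasure M E"] st assms by (simp add: emeasure_add_measure)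
  qed
next
  assume eq: "\<forall>E\<in>sets borel. E \<subseteq> - A \<longrightarrow> emeasure \<mu> E = emeasure \<nu> E"
  have A: "A \<in> sets borel" using assms by auto
  let ?s = "density \<nu> (indicator A)" and ?t = "density \<mu> (indicator A)"
  have "add_measure \<mu> ?s = add_measure \<nu> ?t"
  proof (rule measure_eqI)
    fix E assume "E \<in> sets (add_measure \<mu> ?s)"
    then have E: "E \<in> sets borel" using assms by simp
    have split: "emeasure M E = emeasure M (E - A) + emeasure M (A \<inter> E)" if "sets M = sets borel" for M
      using E A that by (subst plus_emeasure) (auto intro!: arg_cong[where f="emeasure M"])
    have "emeasure \<mu> (E - A) = emeasure \<nu> (E - A)" using eq E A by auto
    then show "emeasure (add_measure \<mu> ?s) E = emeasure (add_measure \<nu> ?t) E"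
      using assms E A by (simp add: emeasure_add_measure emeasure_restricted split[of \<mu>] split[of \<nu>] ac_simps)
  qed (use assms in simp)
  moreover have "?s \<in> concentrated_on A" "?t \<in> concentrated_on A"
    using assms A by (auto simp: concentrated_on_def borel_measures_def emeasure_restricted)
  ultimately show "rel_eq A \<mu> \<nu>" unfolding rel_eq_def by blast
qed

lemma nn_integral_add_measure:
  assumes "sets M = sets N" "f \<in> borel_measurable M"
  shows "(\<integral>\<^sup>+ x. f x \<partial>add_measure M N) = (\<integral>\<^sup>+ x. f x \<partial>M) + (\<integral>\<^sup>+ x. f x \<partial>N)"
  using assms(2)
proof (induction f rule: borel_measurable_induct)
  case (cong f g)
  have "space N = space M" by (rule sets_eq_imp_space_eq[OF assms(1), symmetric])
  then have "integral\<^sup>N L f = integral\<^sup>N L g" if "L \<in> {add_measure M N, M, N}" for L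
    using that cong(3) by (intro nn_integral_cong) auto
  then show ?case using cong(4) by simp
next
  case (set A)
  then show ?case using assms by (simp add: emeasure_add_measure)
next
  have m [simp]: "f \<in> borel_measurable N \<longleftrightarrow> f \<in> borel_measurable M"
    "f \<in> borel_measurable (add_measure M N) \<longleftrightarrow> f \<in> borel_measurable M" for f :: "'a \<Rightarrow> ennreal"
    using assms(1) by (auto cong: measurable_cong_sets)
  case (mult u c)
  then show ?case by (simp add: nn_integral_cmult distrib_left)
next
  have m [simp]: "f \<in> borel_measurable N \<longleftrightarrow> f \<in> borel_measurable M"
    "f \<in> borel_measurable (add_measure M N) \<longleftrightarrow> f \<in> borel_measurable M" for f :: "'a \<Rightarrow> ennreal"
    using assms(1) by (auto cong: measurable_cong_sets)
  case (add u v)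
  then show ?case by (simp add: nn_integral_add ac_simps)
next
  have m [simp]: "f \<in> borel_measurable N \<longleftrightarrow> f \<in> borel_measurable M"
    "f \<in> borel_measurable (add_measure M N) \<longleftrightarrow> f \<in> borel_measurable M" for f :: "'a \<Rightarrow> ennreal"
    using assms(1) by (auto cong: measurable_cong_sets)
  case (seq U)
  have SUP: "(\<integral>\<^sup>+ x. (SUP i. U i) x \<partial>L) = (SUP i. \<integral>\<^sup>+ x. U i x \<partial>L)"
    if "\<And>i. U i \<in> borel_measurable L" for L
    using nn_integral_monotone_convergence_SUP[OF seq(3) that] by (simp add: SUP_apply image_comp)
  have inc: "incseq (\<lambda>i. \<integral>\<^sup>+ x. U i x \<partial>L)" for L
    using seq by (auto simp: incseq_def le_fun_def intro: nn_integral_mono)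
  have "integral\<^sup>N L (SUP i. U i) = (SUP i. integral\<^sup>N L (U i))" if "L \<in> {add_measure M N, M, N}" for L
    by (rule SUP) (use that seq(1) m in auto)
  then show ?case using seq.IH by (simp only: insert_iff simp_thms ennreal_SUP_add[OF inc inc])
qed

lemma nn_integral_eq_off:
  assumes "closed A" "sets \<mu> = sets borel" "sets \<nu> = sets borel"
    and eq: "\<And>E. E \<in> sets borel \<Longrightarrow> E \<subseteq> - A \<Longrightarrow> emeasure \<mu> E = emeasure \<nu> E"
    and f: "f \<in> borel_measurable borel" "\<And>x. x \<in> A \<Longrightarrow> f x = 0"
  shows "(\<integral>\<^sup>+ x. f x \<partial>\<mu>) = (\<integral>\<^sup>+ x. f x \<partial>\<nu>)"
proof -
  have [measurable]: "- A \<in> sets borel" using assms(1) by auto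
  have "density \<mu> (indicator (- A)) = density \<nu> (indicator (- A))"
    by (rule measure_eqI) (use assms in \<open>auto simp: emeasure_restricted intro!: eq\<close>)
  moreover have "(\<integral>\<^sup>+ x. f x \<partial>density M (indicator (- A))) = (\<integral>\<^sup>+ x. f x \<partial>M)" if "sets M = sets borel" for M
  proof -
    note [measurable_cong] = that
    have "(\<integral>\<^sup>+ x. f x \<partial>density M (indicator (- A))) = (\<integral>\<^sup>+ x. indicator (- A) x * f x \<partial>M)"
      using f by (intro nn_integral_density) measurable
    also have "\<dots> = (\<integral>\<^sup>+ x. f x \<partial>M)"
      by (rule nn_integral_cong) (use f in \<open>auto simp: indicator_def\<close>)
    finally show ?thesis .
  qed
  ultimately show ?thesis using assms by metis
qed

text \<open>Finite Borel measures on a Polish space are inner regular. As \<open>\<mu>\<close> may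
  be infinite, this is applied to its restriction to \<open>level A n\<close>; intersecting with
  that closed set keeps compact sets compact, and \<open>n\<close> tends to infinity.\<close>

lemma rel_tight_if_moment_finite:
  fixes A :: "'a::polish_space set"
  assumes "closed A" "A \<noteq> {}" "sets \<mu> = sets borel" "(\<integral>\<^sup>+ x. ennreal (infdist x A) \<partial>\<mu>) < \<infinity>"
  shows "rel_tight A \<mu>"
  unfolding rel_tight_def
proof safe
  fix E :: "'a set" assume E: "E \<in> sets borel" "E \<subseteq> - A"
  let ?S = "SUP K\<in>{K. compact K \<and> K \<subseteq> E}. emeasure \<mu> K"
  have le: "emeasure \<mu> (E \<inter> level A n) \<le> ?S" for n
  proof -
    let ?M = "density \<mu> (indicator (level A n))"
    have M: "sets ?M = sets borel" "emeasure ?M (space ?M) \<noteq> \<infinity>"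
      using assms(3) emeasure_level_finite[OF assms(3,4), of n]
      by (auto simp: emeasure_restricted sets_eq_imp_space_eq[OF assms(3)])
    have "emeasure \<mu> (E \<inter> level A n) = emeasure ?M E"
      using assms(3) E by (simp add: emeasure_restricted Int_commute)
    also have "\<dots> = (SUP K\<in>{K. K \<subseteq> E \<and> compact K}. emeasure ?M K)"
      by (rule inner_regular[OF M E(1)])
    also have "\<dots> \<le> ?S"
    proof (rule SUP_least, clarify)
      fix K assume K: "K \<subseteq> E" "compact K"
      then have "emeasure ?M K = emeasure \<mu> (level A n \<inter> K)"
        using assms(3) by (intro emeasure_restricted) (auto intro: borel_compact)
      also have "\<dots> \<le> ?S"
        using K closed_level[of A n] by (intro SUP_upper) (auto simp: closed_Int_compact)
      finally show "emeasure ?M K \<le> ?S" .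
    qed
    finally show ?thesis .
  qed
  show "emeasure \<mu> E = ?S"
  proof (rule antisym)
    show "emeasure \<mu> E \<le> ?S"
      by (rule LIMSEQ_le_const2[OF Lim_emeasure_level[OF assms(1-3) E]]) (use le in auto)
    show "?S \<le> emeasure \<mu> E"
      using assms(3) E by (intro SUP_least emeasure_mono) auto
  qed
qed

lemma M1_pos_iff:
  fixes A :: "'a::polish_space set"
  assumes "closed A" "A \<noteq> {}"
  shows "\<mu> \<in> M1_pos A \<longleftrightarrow> sets \<mu> = sets borel \<and> (\<integral>\<^sup>+ x. ennreal (infdist x A) \<partial>\<mu>) < \<infinity>"
  using rel_tight_if_moment_finite[OF assms] by (auto simp: M1_pos_def borel_measures_def)

section \<open>The order of the Grothendieck group and Jordan decomposition\<close>

context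
  fixes A :: "'a::polish_space set"
  assumes A: "closed A" "A \<noteq> {}"
begin

lemma M1_pos_null: "null_measure borel \<in> M1_pos A"
  by (simp add: M1_pos_iff[OF A])

lemma M1_pos_add:
  assumes "\<mu> \<in> M1_pos A" "\<nu> \<in> M1_pos A"
  shows "add_measure \<mu> \<nu> \<in> M1_pos A"
proof -
  have s: "sets \<mu> = sets borel" "sets \<nu> = sets borel" using assms by (auto simp: M1_pos_iff[OF A])
  have "(\<lambda>x. ennreal (infdist x A)) \<in> borel_measurable \<mu>"
    unfolding measurable_cong_sets[OF s(1) refl] by measurable
  with assms s show ?thesis by (simp add: M1_pos_iff[OF A] nn_integral_add_measure)
qed

lemma M1_pos_restrict:
  assumes "\<mu> \<in> M1_pos A" "P \<in> sets borel"
  shows "density \<mu> (indicator P) \<in> M1_pos A"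
proof -
  have s [measurable_cong]: "sets \<mu> = sets borel" and m: "(\<integral>\<^sup>+ x. ennreal (infdist x A) \<partial>\<mu>) < \<infinity>"
    using assms(1) by (auto simp: M1_pos_iff[OF A])
  note [measurable] = assms(2)
  have "(\<integral>\<^sup>+ x. ennreal (infdist x A) \<partial>density \<mu> (indicator P))
      = (\<integral>\<^sup>+ x. indicator P x * ennreal (infdist x A) \<partial>\<mu>)"
    by (rule nn_integral_density) measurable
  also have "\<dots> \<le> (\<integral>\<^sup>+ x. ennreal (infdist x A) \<partial>\<mu>)"
    by (rule nn_integral_mono) (simp add: indicator_def)
  finally show ?thesis using s m by (simp add: M1_pos_iff[OF A])
qed

lemma emeasure_eq_if_level:
  assumes "sets \<mu> = sets borel" "sets \<nu> = sets borel" "E \<in> sets borel" "E \<subseteq> - A"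
    and "\<And>n. emeasure \<mu> (E \<inter> level A n) = emeasure \<nu> (E \<inter> level A n)"
  shows "emeasure \<mu> E = emeasure \<nu> E"
  using Lim_emeasure_level[OF A assms(1,3,4)] Lim_emeasure_level[OF A assms(2,3,4)] assms(5)
  by (simp add: LIMSEQ_unique)

text \<open>The auxiliary measure \<open>\<kappa>\<close> can take the value \<infinity>, which does
  not cancel in \<open>ennreal\<close>. It is finite on each \<open>level A n\<close>, so it is
  cancelled there and the equality passes to the union.\<close>

lemma M1_eq_iff:
  assumes "\<xi> \<in> M1 A" "\<eta> \<in> M1 A"
  shows "M1_eq A \<xi> \<eta> \<longleftrightarrow> (\<forall>E\<in>sets borel. E \<subseteq> - A \<longrightarrow>
    emeasure (fst \<xi>) E + emeasure (snd \<eta>) E = emeasure (fst \<eta>) E + emeasure (snd \<xi>) E)"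
proof -
  have m: "fst \<xi> \<in> M1_pos A" "snd \<xi> \<in> M1_pos A" "fst \<eta> \<in> M1_pos A" "snd \<eta> \<in> M1_pos A"
    using assms by (auto simp: M1_def)
  then have s: "sets (fst \<xi>) = sets borel" "sets (snd \<xi>) = sets borel"
    "sets (fst \<eta>) = sets borel" "sets (snd \<eta>) = sets borel"
    by (auto simp: M1_pos_iff[OF A])
  show ?thesis
  proof
    assume "M1_eq A \<xi> \<eta>"
    then obtain \<kappa> where k: "\<kappa> \<in> M1_pos A" and "rel_eq A (add_measure (add_measure (fst \<xi>) (snd \<eta>)) \<kappa>)
                              (add_measure (add_measure (fst \<eta>) (snd \<xi>)) \<kappa>)"
      by (auto simp: M1_eq_def)
    moreover have sk: "sets \<kappa> = sets borel" using k by (simp add: M1_pos_iff[OF A])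
    ultimately have eq: "emeasure (add_measure (fst \<xi>) (snd \<eta>)) E + emeasure \<kappa> E
        = emeasure (add_measure (fst \<eta>) (snd \<xi>)) E + emeasure \<kappa> E" if "E \<in> sets borel" "E \<subseteq> - A" for E
      using that s by (simp add: rel_eq_iff[OF A(1)] emeasure_add_measure)
    show "\<forall>E\<in>sets borel. E \<subseteq> - A \<longrightarrow>
      emeasure (fst \<xi>) E + emeasure (snd \<eta>) E = emeasure (fst \<eta>) E + emeasure (snd \<xi>) E"
    proof safe
      fix E :: "'a set" assume E: "E \<in> sets borel" "E \<subseteq> - A"
      have "emeasure (add_measure (fst \<xi>) (snd \<eta>)) E = emeasure (add_measure (fst \<eta>) (snd \<xi>)) E"
      proof (rule emeasure_eq_if_level)
        fix n
        have "emeasure \<kappa> (E \<inter> level A n) \<le> emeasure \<kappa> (level A n)"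
          using sk by (intro emeasure_mono) auto
        also have "\<dots> < \<infinity>" using k by (intro emeasure_level_finite) (auto simp: M1_pos_iff[OF A])
        finally have "emeasure \<kappa> (E \<inter> level A n) \<noteq> \<infinity>" by simp
        moreover have "E \<inter> level A n \<in> sets borel" "E \<inter> level A n \<subseteq> - A" using E by auto
        ultimately show "emeasure (add_measure (fst \<xi>) (snd \<eta>)) (E \<inter> level A n)
            = emeasure (add_measure (fst \<eta>) (snd \<xi>)) (E \<inter> level A n)"
          using eq[of "E \<inter> level A n"] by (simp add: ennreal_add_left_cancel add.commute[of _ "emeasure \<kappa> _"])
      qed (use s E in auto)
      then show "emeasure (fst \<xi>) E + emeasure (snd \<eta>) E = emeasure (fst \<eta>) E + emeasure (snd \<xi>) E"
        using s by (simp add: emeasure_add_measure)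
    qed
  next
    assume "\<forall>E\<in>sets borel. E \<subseteq> - A \<longrightarrow>
      emeasure (fst \<xi>) E + emeasure (snd \<eta>) E = emeasure (fst \<eta>) E + emeasure (snd \<xi>) E"
    then show "M1_eq A \<xi> \<eta>"
      unfolding M1_eq_def using s M1_pos_null
      by (intro bexI[of _ "null_measure borel"]) (auto simp: rel_eq_iff[OF A(1)] emeasure_add_measure)
  qed
qed

lemma M1_eq_refl: "\<xi> \<in> M1 A \<Longrightarrow> M1_eq A \<xi> \<xi>"
  by (simp add: M1_eq_iff)

lemma M1_of_pos_M1: "\<mu> \<in> M1_pos A \<Longrightarrow> M1_of_pos \<mu> \<in> M1 A"
  by (simp add: M1_of_pos_def M1_def M1_pos_null)

lemma M1_le_of_pos_iff:
  assumes "\<xi> \<in> M1 A" "\<mu> \<in> M1_pos A"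
  shows "M1_le A \<xi> (M1_of_pos \<mu>) \<longleftrightarrow> (\<exists>\<rho>\<in>M1_pos A. \<forall>E\<in>sets borel. E \<subseteq> - A \<longrightarrow>
    emeasure (fst \<xi>) E + emeasure \<rho> E = emeasure \<mu> E + emeasure (snd \<xi>) E)"
  unfolding M1_le_def
proof (rule bex_cong[OF refl])
  fix \<rho> assume r: "\<rho> \<in> M1_pos A"
  have x: "fst \<xi> \<in> M1_pos A" "snd \<xi> \<in> M1_pos A" using assms(1) by (auto simp: M1_def)
  have s: "sets (fst \<xi>) = sets borel" "sets \<rho> = sets borel" using x r by (auto simp: M1_pos_iff[OF A])
  have "(add_measure (fst \<xi>) \<rho>, snd \<xi>) \<in> M1 A" using x r by (simp add: M1_def M1_pos_add)
  from M1_eq_iff[OF this M1_of_pos_M1[OF assms(2)]]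
  show "M1_eq A (add_measure (fst \<xi>) \<rho>, snd \<xi>) (M1_of_pos \<mu>) \<longleftrightarrow> (\<forall>E\<in>sets borel. E \<subseteq> - A \<longrightarrow>
    emeasure (fst \<xi>) E + emeasure \<rho> E = emeasure \<mu> E + emeasure (snd \<xi>) E)"
    using s by (simp add: M1_of_pos_def emeasure_add_measure)
qed

text \<open>Suppose \<open>\<xi> + \<rho>1 = \<mu>\<close> and
  \<open>\<xi> + \<rho>2 = \<nu>\<close> in the group. Off \<open>P\<close> the measure
  \<open>\<mu>\<close> vanishes, so there \<open>\<rho>1\<close> witnesses
  \<open>\<xi> \<le> 0\<close>; on \<open>P\<close> the same holds for \<open>\<nu>\<close> and
  \<open>\<rho>2\<close>. Gluing the two slack measures along \<open>P\<close> gives a global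
  witness.\<close>

lemma M1_disjoint_if_singular:
  assumes m: "\<mu> \<in> M1_pos A" "\<nu> \<in> M1_pos A"
    and P: "P \<in> sets borel" "emeasure \<mu> (- P) = 0" "emeasure \<nu> P = 0"
  shows "M1_disjoint A \<mu> \<nu>"
proof -
  have s: "sets \<mu> = sets borel" "sets \<nu> = sets borel" using m by (auto simp: M1_pos_iff[OF A])
  have pos: "M1_le A (M1_of_pos (null_measure borel)) (M1_of_pos \<rho>)" if "\<rho> \<in> M1_pos A" for \<rho>
    using that by (subst M1_le_of_pos_iff) (auto intro!: M1_of_pos_M1 M1_pos_null simp: M1_of_pos_def M1_def)
  have "M1_le A \<xi> (M1_of_pos (null_measure borel))"
    if \<xi>: "\<xi> \<in> M1 A" "M1_le A \<xi> (M1_of_pos \<mu>)" "M1_le A \<xi> (M1_of_pos \<nu>)" for \<xi>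
  proof -
    obtain \<rho>1 where r1: "\<rho>1 \<in> M1_pos A" "\<forall>E\<in>sets borel. E \<subseteq> - A \<longrightarrow>
        emeasure (fst \<xi>) E + emeasure \<rho>1 E = emeasure \<mu> E + emeasure (snd \<xi>) E"
      using iffD1[OF M1_le_of_pos_iff[OF \<xi>(1) m(1)] \<xi>(2)] by (rule bexE)
    obtain \<rho>2 where r2: "\<rho>2 \<in> M1_pos A" "\<forall>E\<in>sets borel. E \<subseteq> - A \<longrightarrow>
        emeasure (fst \<xi>) E + emeasure \<rho>2 E = emeasure \<nu> E + emeasure (snd \<xi>) E"
      using iffD1[OF M1_le_of_pos_iff[OF \<xi>(1) m(2)] \<xi>(3)] by (rule bexE)
    have sr: "sets \<rho>1 = sets borel" "sets \<rho>2 = sets borel" "sets (fst \<xi>) = sets borel" "sets (snd \<xi>) = sets borel"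
      using r1(1) r2(1) \<xi>(1) unfolding M1_def mem_Times_iff M1_pos_iff[OF A] by simp_all
    define \<rho> where "\<rho> = add_measure (density \<rho>1 (indicator (- P))) (density \<rho>2 (indicator P))"
    have "\<rho> \<in> M1_pos A" unfolding \<rho>_def using P(1) r1(1) r2(1) by (intro M1_pos_add M1_pos_restrict) auto
    moreover have "emeasure (fst \<xi>) E + emeasure \<rho> E = emeasure (snd \<xi>) E"
      if E: "E \<in> sets borel" "E \<subseteq> - A" for E
    proof -
      have split: "emeasure M E = emeasure M (- P \<inter> E) + emeasure M (P \<inter> E)" if "sets M = sets borel" for M
        using that E P by (subst plus_emeasure) (auto intro!: arg_cong[where f="emeasure M"])
      have "emeasure \<mu> (- P \<inter> E) = 0" "emeasure \<nu> (P \<inter> E) = 0"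
        using P s emeasure_mono[of "- P \<inter> E" "- P" \<mu>] emeasure_mono[of "P \<inter> E" P \<nu>] by auto
      then have eq: "emeasure (snd \<xi>) (- P \<inter> E) = emeasure (fst \<xi>) (- P \<inter> E) + emeasure \<rho>1 (- P \<inter> E)"
        "emeasure (snd \<xi>) (P \<inter> E) = emeasure (fst \<xi>) (P \<inter> E) + emeasure \<rho>2 (P \<inter> E)"
        using r1(2)[rule_format, of "- P \<inter> E"] r2(2)[rule_format, of "P \<inter> E"] E P
        by (simp_all add: le_infI2 del: Int_subset_iff)
      have "emeasure \<rho> E = emeasure \<rho>1 (- P \<inter> E) + emeasure \<rho>2 (P \<inter> E)"
        unfolding \<rho>_def using sr E P by (simp add: emeasure_add_measure emeasure_restricted)
      then show ?thesis
        unfolding split[OF sr(3)] split[OF sr(4)] eq by (simp only: ac_simps)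
    qed
    ultimately show ?thesis
      using M1_le_of_pos_iff[OF \<xi>(1) M1_pos_null] by auto
  qed
  then show ?thesis using pos m by (simp add: M1_disjoint_def)
qed

lemma is_pos_neg_parts_if_singular:
  assumes "\<mu> \<in> M1_pos A" "\<nu> \<in> M1_pos A" "P \<in> sets borel" "emeasure \<mu> (- P) = 0" "emeasure \<nu> P = 0"
  shows "is_pos_neg_parts A (\<mu>, \<nu>) \<mu> \<nu>"
  using assms M1_disjoint_if_singular[OF assms] by (simp add: is_pos_neg_parts_def M1_eq_refl M1_def)

text \<open>In terms of densities \<open>a\<close> and \<open>b\<close> with respect to \<open>\<alpha> + \<beta>\<close>, the parts are the truncated
  differences of \<open>a\<close> and \<open>b\<close>.  Truncation is explicit because \<open>\<infinity> - \<infinity> = \<infinity>\<close> for \<open>ennreal\<close>.\<close>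

lemma Jordan_parts:
  fixes \<alpha> \<beta> :: "'a measure"
  assumes "\<alpha> \<in> M1_pos A" "\<beta> \<in> M1_pos A" "emeasure \<alpha> A = 0" "emeasure \<beta> A = 0"
  obtains \<mu> \<nu> P where "\<mu> \<in> M1_pos A" "\<nu> \<in> M1_pos A"
    "P \<in> sets borel" "emeasure \<mu> (- P) = 0" "emeasure \<nu> P = 0"
    "\<And>f. f \<in> borel_measurable borel \<Longrightarrow>
      (\<integral>\<^sup>+ x. f x \<partial>\<alpha>) + (\<integral>\<^sup>+ x. f x \<partial>\<nu>) = (\<integral>\<^sup>+ x. f x \<partial>\<beta>) + (\<integral>\<^sup>+ x. f x \<partial>\<mu>)"
proof -
  have s: "sets \<alpha> = sets borel" "sets \<beta> = sets borel" using assms by (auto simp: M1_pos_iff[OF A])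
  define \<gamma> where "\<gamma> = add_measure \<alpha> \<beta>"
  have g: "\<gamma> \<in> M1_pos A" unfolding \<gamma>_def using assms by (intro M1_pos_add)
  then have sg [measurable_cong, simp]: "sets \<gamma> = sets borel" by (simp add: M1_pos_iff[OF A])
  have spg [simp]: "space \<gamma> = UNIV" using sets_eq_imp_space_eq[OF sg] by simp
  \<comment> \<open>The levels cover only the complement of \<open>A\<close>. The set
    \<open>A\<close> itself can join the cover because both measures are null on it.\<close>
  interpret sigma_finite_measure \<gamma>
  proof
    have "emeasure \<gamma> a \<noteq> \<infinity>" if "a \<in> insert A (range (level A))" for a
    proof (cases "a = A")
      case True
      then show ?thesis using assms s by (simp add: \<gamma>_def emeasure_add_measure)
    next
      case False
      with that have "a \<in> range (level A)" by auto
      then obtain n where "a = level A n" by auto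
      then show ?thesis using emeasure_level_finite[of \<gamma> A n] g by (auto simp: M1_pos_iff[OF A])
    qed
    moreover have "\<Union> (insert A (range (level A))) = space \<gamma>" using UN_level[OF A] by auto
    moreover have "insert A (range (level A)) \<subseteq> sets \<gamma>" using A by auto
    ultimately show "\<exists>B. countable B \<and> B \<subseteq> sets \<gamma> \<and> \<Union> B = space \<gamma> \<and> (\<forall>a\<in>B. emeasure \<gamma> a \<noteq> \<infinity>)"
      by (intro exI[of _ "insert A (range (level A))"]) auto
  qed
  have ac: "absolutely_continuous \<gamma> \<alpha>" "absolutely_continuous \<gamma> \<beta>"
    using s by (auto simp: absolutely_continuous_def null_sets_def \<gamma>_def emeasure_add_measure)
  obtain a where a [measurable]: "a \<in> borel_measurable borel" and \<alpha>: "density \<gamma> a = \<alpha>"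
    using Radon_Nikodym[OF ac(1)] s by (auto cong: measurable_cong_sets)
  obtain b where b [measurable]: "b \<in> borel_measurable borel" and \<beta>: "density \<gamma> b = \<beta>"
    using Radon_Nikodym[OF ac(2)] s by (auto cong: measurable_cong_sets)
  define excess where "excess c d x = (if d x < c x then c x - d x else 0)" for c d :: "'a \<Rightarrow> ennreal" and x
  have [measurable]: "excess c d \<in> borel_measurable borel"
    if [measurable]: "c \<in> borel_measurable borel" "d \<in> borel_measurable borel" for c d
    unfolding excess_def by measurable
  define \<mu> where "\<mu> = density \<gamma> (\<lambda>x. excess a b x)"
  define \<nu> where "\<nu> = density \<gamma> (\<lambda>x. excess b a x)"
  define P where "P = {x. b x < a x}"
  have P [measurable]: "P \<in> sets borel" unfolding P_def by measurable
  have int: "(\<integral>\<^sup>+ x. f x \<partial>density \<gamma> c) = (\<integral>\<^sup>+ x. c x * f x \<partial>\<gamma>)"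
    if [measurable]: "f \<in> borel_measurable borel" "c \<in> borel_measurable borel" for f c
    by (rule nn_integral_density) measurable
  have sub: "density \<gamma> (\<lambda>x. excess c d x) \<in> M1_pos A"
    if [measurable]: "c \<in> borel_measurable borel" "d \<in> borel_measurable borel" and "density \<gamma> c \<in> M1_pos A" for c d
  proof -
    have "(\<integral>\<^sup>+ x. ennreal (infdist x A) \<partial>density \<gamma> (\<lambda>x. excess c d x)) \<le> (\<integral>\<^sup>+ x. ennreal (infdist x A) \<partial>density \<gamma> c)"
      by (simp add: int) (intro nn_integral_mono mult_right_mono, auto simp: excess_def diff_le_self_ennreal)
    also have "\<dots> < \<infinity>" using that(3) by (simp add: M1_pos_iff[OF A])
    finally show ?thesis by (simp add: M1_pos_iff[OF A])
  qed
  show ?thesis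
  proof (rule that[of \<mu> \<nu> P])
    show "\<mu> \<in> M1_pos A" "\<nu> \<in> M1_pos A"
      unfolding \<mu>_def \<nu>_def using assms \<alpha> \<beta> by (auto intro!: sub)
    have "(\<integral>\<^sup>+ x. excess a b x * indicator (- P) x \<partial>\<gamma>) = (\<integral>\<^sup>+ x. 0 \<partial>\<gamma>)"
      by (rule nn_integral_cong) (auto simp: P_def indicator_def excess_def)
    moreover have "(\<integral>\<^sup>+ x. excess b a x * indicator P x \<partial>\<gamma>) = (\<integral>\<^sup>+ x. 0 \<partial>\<gamma>)"
      by (rule nn_integral_cong) (auto simp: P_def indicator_def excess_def)
    ultimately show "emeasure \<mu> (- P) = 0" "emeasure \<nu> P = 0"
      unfolding \<mu>_def \<nu>_def by (simp_all add: emeasure_density)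
    fix f :: "'a \<Rightarrow> ennreal" assume f [measurable]: "f \<in> borel_measurable borel"
    have ab: "a x + excess b a x = b x + excess a b x" for x
    proof (cases "a x" "b x" rule: linorder_cases)
      case less
      then have "excess b a x = b x - a x" "excess a b x = 0" by (simp_all add: excess_def)
      with diff_add_cancel_ennreal[OF less_imp_le[OF less]] show ?thesis by (metis add.commute add_0)
    next
      case greater
      then have "excess a b x = a x - b x" "excess b a x = 0" by (simp_all add: excess_def)
      with diff_add_cancel_ennreal[OF less_imp_le[OF greater]] show ?thesis by (metis add.commute add_0)
    qed (simp add: excess_def)
    have "(\<integral>\<^sup>+ x. f x \<partial>\<alpha>) + (\<integral>\<^sup>+ x. f x \<partial>\<nu>) = (\<integral>\<^sup>+ x. (a x + excess b a x) * f x \<partial>\<gamma>)"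
      unfolding \<alpha>[symmetric] \<nu>_def by (simp add: int nn_integral_add[symmetric] distrib_right)
    also have "\<dots> = (\<integral>\<^sup>+ x. f x \<partial>\<beta>) + (\<integral>\<^sup>+ x. f x \<partial>\<mu>)"
      unfolding ab \<beta>[symmetric] \<mu>_def by (simp add: int nn_integral_add[symmetric] distrib_right)
    finally show "(\<integral>\<^sup>+ x. f x \<partial>\<alpha>) + (\<integral>\<^sup>+ x. f x \<partial>\<nu>) = (\<integral>\<^sup>+ x. f x \<partial>\<beta>) + (\<integral>\<^sup>+ x. f x \<partial>\<mu>)" .
  qed (rule P)
qed

end

section \<open>Duality for finite transport problems\<close>

text \<open>Farkas' lemma by induction on the number of inequalities.  The operation \<open>comb x c y\<close> stands for
  \<open>x + c * y\<close>; no vector space structure is needed beyond the linearity of the forms.\<close>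

lemma Farkas:
  fixes a :: "'k \<Rightarrow> 'v \<Rightarrow> real" and g :: "'v \<Rightarrow> real" and comb :: "'v \<Rightarrow> real \<Rightarrow> 'v \<Rightarrow> 'v"
  assumes "finite K"
    and "\<And>k x c y. k \<in> K \<Longrightarrow> a k (comb x c y) = a k x + c * a k y"
    and "\<And>x c y. g (comb x c y) = g x + c * g y"
    and "\<And>x. (\<forall>k\<in>K. 0 \<le> a k x) \<Longrightarrow> 0 \<le> g x"
  shows "\<exists>l. (\<forall>k\<in>K. 0 \<le> l k) \<and> (\<forall>x. g x = (\<Sum>k\<in>K. l k * a k x))"
  using assms
proof (induction K arbitrary: a g rule: finite_induct)
  case empty
  \<comment> \<open>\<open>comb x (-2) x\<close> plays the role of \<open>- x\<close>, so
    \<open>g\<close> and its negative are both nonnegative.\<close>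
  have "g x = 0" for x
    using empty(3)[of x] empty(3)[of "comb x (-2) x"] empty(2)[of x "-2" x] by simp
  then show ?case by simp
next
  case (insert j K)
  note a_comb = insert.prems(1) and g_comb = insert.prems(2) and pos = insert.prems(3)
  show ?case
  proof (cases "\<forall>x. (\<forall>k\<in>K. 0 \<le> a k x) \<longrightarrow> 0 \<le> g x")
    case True
    have "\<exists>l. (\<forall>k\<in>K. 0 \<le> l k) \<and> (\<forall>x. g x = (\<Sum>k\<in>K. l k * a k x))"
      by (rule insert.IH) (use a_comb g_comb True in auto)
    then obtain l where l: "\<forall>k\<in>K. 0 \<le> l k" "\<And>x. g x = (\<Sum>k\<in>K. l k * a k x)" by blast
    have "(\<Sum>k\<in>insert j K. (l(j := 0)) k * a k x) = (\<Sum>k\<in>K. l k * a k x)" for x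
      using insert.hyps by (simp, intro sum.cong) auto
    with l show ?thesis by (intro exI[of _ "l(j := 0)"]) auto
  next
    case False
    then obtain x0 where x0: "\<And>k. k \<in> K \<Longrightarrow> 0 \<le> a k x0" "g x0 < 0" by force
    then have j: "a j x0 < 0" using pos[of x0] by force
    \<comment> \<open>\<open>a'\<close> and \<open>g'\<close> are the forms composed with the
      projection along \<open>x0\<close> onto the kernel of \<open>a j\<close>. At a projected point
      the constraint \<open>j\<close> holds with equality, so \<open>g'\<close> is nonnegative
      wherever the remaining projected constraints hold.\<close>
    define a' where "a' k x = a k x - a k x0 / a j x0 * a j x" for k x
    define g' where "g' x = g x - g x0 / a j x0 * a j x" for x
    have "\<exists>l. (\<forall>k\<in>K. 0 \<le> l k) \<and> (\<forall>x. g' x = (\<Sum>k\<in>K. l k * a' k x))"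
    proof (rule insert.IH)
      show "a' k (comb x c y) = a' k x + c * a' k y" if "k \<in> K" for k x c y
        using that by (simp add: a'_def a_comb algebra_simps)
      show "g' (comb x c y) = g' x + c * g' y" for x c y
        by (simp add: g'_def a_comb g_comb algebra_simps)
      fix x assume x: "\<forall>k\<in>K. 0 \<le> a' k x"
      let ?x = "comb x (- (a j x / a j x0)) x0"
      have "a j ?x = 0" using j by (simp add: a_comb)
      moreover have "a k ?x = a' k x" if "k \<in> K" for k using that by (simp add: a_comb a'_def)
      ultimately have "0 \<le> g ?x" using x by (intro pos) auto
      also have "g ?x = g' x" by (simp add: g_comb g'_def)
      finally show "0 \<le> g' x" .
    qed
    then obtain l where l: "\<forall>k\<in>K. 0 \<le> l k" "\<And>x. g' x = (\<Sum>k\<in>K. l k * a' k x)" by blast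
    \<comment> \<open>The value forced by evaluating the desired identity at \<open>x0\<close>,
      where \<open>a'\<close> and \<open>g'\<close> vanish. Numerator and denominator are both
      negative.\<close>
    define r where "r = (g x0 - (\<Sum>k\<in>K. l k * a k x0)) / a j x0"
    have "0 \<le> (\<Sum>k\<in>K. l k * a k x0)" using l(1) x0(1) by (intro sum_nonneg) auto
    then have "0 \<le> r" unfolding r_def using x0(2) j by (intro divide_nonpos_neg) auto
    moreover have "g x = (\<Sum>k\<in>insert j K. (l(j := r)) k * a k x)" for x
    proof -
      have "g x = g' x + g x0 / a j x0 * a j x" by (simp add: g'_def)
      also have "g' x = (\<Sum>k\<in>K. l k * a k x) - (\<Sum>k\<in>K. l k * a k x0) / a j x0 * a j x"
        by (simp add: l(2) a'_def right_diff_distrib sum_subtractf sum_distrib_right sum_divide_distrib mult.assoc)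
      finally have "g x = (\<Sum>k\<in>K. l k * a k x) + r * a j x"
        by (simp add: r_def diff_divide_distrib algebra_simps)
      also have "(\<Sum>k\<in>K. l k * a k x) = (\<Sum>k\<in>K. (l(j := r)) k * a k x)"
        using insert.hyps by (intro sum.cong) auto
      finally show ?thesis using insert.hyps by simp
    qed
    ultimately show ?thesis using l(1) by (intro exI[of _ "l(j := r)"]) auto
  qed
qed

text \<open>Transport between the points of \<open>F\<close>, where mass may also be created or absorbed at \<open>b\<close>.\<close>

lemma finite_transport_duality:
  fixes F :: "'i set" and c :: "'i \<Rightarrow> 'i \<Rightarrow> real"
  assumes F: "finite F" "b \<notin> F"
    and no_potential: "\<And>s u v. u b = 0 \<Longrightarrow> v b = 0 \<Longrightarrow>
        (\<And>i j. i \<in> insert b F \<Longrightarrow> j \<in> insert b F \<Longrightarrow> u i + v j \<le> s * c i j) \<Longrightarrow>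
        (\<Sum>i\<in>F. u i * m i) + (\<Sum>j\<in>F. v j * n j) \<le> s * C"
  obtains h where "\<And>i j. i \<in> insert b F \<Longrightarrow> j \<in> insert b F \<Longrightarrow> 0 \<le> h i j"
    "\<And>i. i \<in> F \<Longrightarrow> (\<Sum>j\<in>insert b F. h i j) = m i"
    "\<And>j. j \<in> F \<Longrightarrow> (\<Sum>i\<in>insert b F. h i j) = n j"
    "(\<Sum>i\<in>insert b F. \<Sum>j\<in>insert b F. h i j * c i j) = C"
proof -
  let ?G = "insert b F"
  \<comment> \<open>The variables are total functions; \<open>z\<close> discards their value at
    \<open>b\<close>. Potentials are thereby fixed to be 0 at \<open>b\<close>, which is why no
    marginal is prescribed there.\<close>
  define z where "z u i = (if i = b then 0 else u i)" for u :: "'i \<Rightarrow> real" and i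
  define a where "a = (\<lambda>(i, j) (s, u, v). s * c i j - z u i - z v j)"
  define g where "g = (\<lambda>(s, u, v). s * C - (\<Sum>i\<in>F. u i * m i) - (\<Sum>j\<in>F. v j * n j))"
  define comb where "comb = (\<lambda>(s, u, v) r (s', u', v').
    (s + r * s', \<lambda>i. u i + r * u' i, \<lambda>j. v j + r * v' j :: real) :: real \<times> ('i \<Rightarrow> real) \<times> ('i \<Rightarrow> real))"
  \<comment> \<open>The multipliers of the inequalities form the plan. Comparing coefficients of
    \<open>g\<close> reads off its data: \<open>s\<close> gives the total cost, a unit vector in
    \<open>u\<close> a row sum, one in \<open>v\<close> a column sum. As \<open>s\<close> is itself
    a free variable, the cost comes out equal to \<open>C\<close>, not merely bounded by it.\<close>
  have "\<exists>l. (\<forall>k\<in>?G \<times> ?G. 0 \<le> l k) \<and> (\<forall>x. g x = (\<Sum>k\<in>?G \<times> ?G. l k * a k x))"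
  proof (rule Farkas[where comb = comb])
    show "finite (?G \<times> ?G)" using F by simp
    show "a k (comb x r y) = a k x + r * a k y" for k x r y
      by (auto simp: a_def comb_def z_def algebra_simps split: prod.splits)
    show "g (comb x r y) = g x + r * g y" for x r y
      by (auto simp: g_def comb_def sum.distrib sum_distrib_left algebra_simps split: prod.splits)
    fix x :: "real \<times> ('i \<Rightarrow> real) \<times> ('i \<Rightarrow> real)"
    obtain s u v where x: "x = (s, u, v)" by (cases x)
    assume pos: "\<forall>k\<in>?G \<times> ?G. 0 \<le> a k x"
    have uv: "z u i + z v j \<le> s * c i j" if "i \<in> ?G" "j \<in> ?G" for i j
    proof -
      have "0 \<le> a (i, j) x" using pos that by blast
      then show ?thesis by (simp add: a_def x)
    qed
    have "(\<Sum>i\<in>F. z u i * m i) + (\<Sum>j\<in>F. z v j * n j) \<le> s * C"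
      by (rule no_potential[OF _ _ uv]) (simp_all add: z_def)
    also have "(\<Sum>i\<in>F. z u i * m i) = (\<Sum>i\<in>F. u i * m i)" using F by (intro sum.cong) (auto simp: z_def)
    also have "(\<Sum>i\<in>F. z v i * n i) = (\<Sum>i\<in>F. v i * n i)" using F by (intro sum.cong) (auto simp: z_def)
    finally show "0 \<le> g x" by (simp add: g_def x)
  qed
  then obtain l where l: "\<forall>k\<in>?G \<times> ?G. 0 \<le> l k" "\<forall>x. g x = (\<Sum>k\<in>?G \<times> ?G. l k * a k x)"
    by (elim exE conjE)
  define h where "h i j = l (i, j)" for i j
  have eq: "g (s, u, v) = (\<Sum>i\<in>?G. \<Sum>j\<in>?G. h i j * (s * c i j - z u i - z v j))" for s u v
    unfolding sum.cartesian_product l(2)[rule_format, of "(s, u, v)"]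
    by (rule sum.cong[OF refl]) (simp only: h_def a_def split_def fst_conv snd_conv prod.collapse)
  show thesis
  proof (rule that[of h])
    show "0 \<le> h i j" if "i \<in> ?G" "j \<in> ?G" for i j
      unfolding h_def by (rule bspec[OF l(1)]) (rule SigmaI[OF that])
    show "(\<Sum>i\<in>?G. \<Sum>j\<in>?G. h i j * c i j) = C"
      using eq[of 1 "\<lambda>_. 0" "\<lambda>_. 0"] by (simp add: g_def z_def del: sum.insert)
    fix k assume k: "k \<in> F"
    then have ko: "k \<noteq> b" using F by auto
    define e where "e i = (if i = k then 1 else 0 :: real)" for i
    have z: "z e = e" "z (\<lambda>_. 0) = (\<lambda>_. 0)" using ko by (auto simp: z_def e_def fun_eq_iff)
    have e_sum: "(\<Sum>i\<in>I. f i * e i) = f k" if "finite I" "k \<in> I" for I f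
    proof -
      have "(\<Sum>i\<in>I. f i * e i) = (\<Sum>i\<in>I. if i = k then f i else 0)" by (rule sum.cong) (auto simp: e_def)
      also have "\<dots> = f k" using that by simp
      finally show ?thesis .
    qed
    have kG: "finite ?G" "k \<in> ?G" using F k by auto
    have "g (0, e, \<lambda>_. 0) = - m k" by (simp add: g_def mult.commute[of "e _"] e_sum F k)
    then have "m k = (\<Sum>i\<in>?G. \<Sum>j\<in>?G. h i j * e i)"
      unfolding eq z by (simp add: sum_negf del: sum.insert)
    also have "\<dots> = (\<Sum>i\<in>?G. (\<Sum>j\<in>?G. h i j) * e i)" by (simp only: sum_distrib_right)
    also have "\<dots> = (\<Sum>j\<in>?G. h k j)" by (rule e_sum[OF kG])
    finally show "(\<Sum>j\<in>?G. h k j) = m k" by (rule sym)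
    have "g (0, \<lambda>_. 0, e) = - n k" by (simp add: g_def mult.commute[of "e _"] e_sum F k)
    then have "n k = (\<Sum>i\<in>?G. \<Sum>j\<in>?G. h i j * e j)"
      unfolding eq z by (simp add: sum_negf del: sum.insert)
    also have "\<dots> = (\<Sum>i\<in>?G. h i k)" by (intro sum.cong refl e_sum[OF kG])
    finally show "(\<Sum>i\<in>?G. h i k) = n k" by (rule sym)
  qed
qed

section \<open>Relative transport\<close>

lemma dbar_nonneg: "0 \<le> dbar A z"
  by (auto simp: dbar_def infdist_nonneg split: prod.splits)

lemma continuous_on_dbar: "continuous_on UNIV (dbar A)"
  unfolding dbar_def split_beta
  by (intro continuous_on_min continuous_intros)

lemma dbar_borel [measurable]: "dbar A \<in> borel_measurable borel"
  by (rule borel_measurable_continuous_onI[OF continuous_on_dbar])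

lemma infdist_le_dist_add: "infdist x A \<le> dist x y + infdist y A"
  using infdist_triangle[of x A y] by simp

lemma dbar_le_dist: "dbar A (x, y) \<le> dist x y"
  by (simp add: dbar_def)

lemma dbar_boundary: "a \<in> A \<Longrightarrow> dbar A (x, a) \<le> infdist x A" "a \<in> A \<Longrightarrow> dbar A (a, x) \<le> infdist x A"
  by (simp_all add: dbar_def)

lemma measurable_Pair_borel:
  "(\<lambda>x. (x, a)) \<in> borel \<rightarrow>\<^sub>M (borel :: ('a::topological_space \<times> 'b::topological_space) measure)"
  "(\<lambda>y. (b, y)) \<in> borel \<rightarrow>\<^sub>M (borel :: ('a::topological_space \<times> 'b::topological_space) measure)"
  by (intro borel_measurable_continuous_onI continuous_intros)+

lemma measurable_fst_snd_borel:
  "fst \<in> (borel :: ('a::topological_space \<times> 'b::topological_space) measure) \<rightarrow>\<^sub>M borel"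
  "snd \<in> (borel :: ('a::topological_space \<times> 'b::topological_space) measure) \<rightarrow>\<^sub>M borel"
  by (intro borel_measurable_continuous_onI continuous_intros)+

text \<open>The coupling has density \<open>H\<close> with respect to the product measure on \<open>C \<times> C\<close>; the remaining mass
  of \<open>\<mu>\<close> and \<open>\<nu>\<close>, with densities \<open>w\<close> and \<open>w'\<close>, is transported to and from the point \<open>a\<close> of \<open>A\<close>.\<close>

lemma coupling_from_density:
  fixes A :: "'a::polish_space set"
  assumes A: "closed A" "a \<in> A"
    and s: "sets \<mu> = sets borel" "sets \<nu> = sets borel"
    and C [measurable]: "C \<in> sets borel" and fin: "emeasure \<mu> C < \<infinity>" "emeasure \<nu> C < \<infinity>"
    and H [measurable]: "H \<in> borel_measurable (borel \<Otimes>\<^sub>M borel)"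
    and w [measurable]: "w \<in> borel_measurable borel" "w' \<in> borel_measurable borel"
    and w1: "AE x in \<mu>. indicator C x * (\<integral>\<^sup>+ y. H (x, y) \<partial>density \<nu> (indicator C)) + w x = 1"
    and w2: "AE y in \<nu>. indicator C y * (\<integral>\<^sup>+ x. H (x, y) \<partial>density \<mu> (indicator C)) + w' y = 1"
  shows "\<exists>\<pi>\<in>rel_couplings A \<mu> \<nu>. (\<integral>\<^sup>+ z. ennreal (dbar A z) \<partial>\<pi>) \<le>
    (\<integral>\<^sup>+ x. (\<integral>\<^sup>+ y. H (x, y) * ennreal (dbar A (x, y)) \<partial>density \<nu> (indicator C)) \<partial>density \<mu> (indicator C))
    + (\<integral>\<^sup>+ x. w x * ennreal (infdist x A) \<partial>\<mu>) + (\<integral>\<^sup>+ y. w' y * ennreal (infdist y A) \<partial>\<nu>)"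
proof -
  \<comment> \<open>The measures \<open>\<mu>\<close> and \<open>\<nu>\<close> may be infinite
    outside \<open>C\<close>. Their restrictions to \<open>C\<close> are finite, as the product
    measure and Fubini require; mass outside \<open>C\<close> moves only along \<open>\<pi>2\<close>
    and \<open>\<pi>3\<close>.\<close>
  define M where "M = density \<mu> (indicator C)"
  define N where "N = density \<nu> (indicator C)"
  note [measurable_cong] = s
  have sMN [measurable_cong]: "sets M = sets borel" "sets N = sets borel" using s by (simp_all add: M_def N_def)
  have spM: "space M = UNIV" "space N = UNIV" using sMN[THEN sets_eq_imp_space_eq] by auto
  have sP [measurable_cong]: "sets (M \<Otimes>\<^sub>M N) = sets (borel \<Otimes>\<^sub>M borel)"
    by (rule sets_pair_measure_cong[OF sMN])
  have "emeasure M UNIV = emeasure \<mu> C" "emeasure N UNIV = emeasure \<nu> C"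
    unfolding M_def N_def using s by (simp_all add: emeasure_restricted)
  then interpret M: finite_measure M + N: finite_measure N
    using fin by (auto intro!: finite_measureI simp: spM)
  interpret pair_sigma_finite M N ..
  have borelP: "(borel :: ('a \<times> 'a) measure) = borel \<Otimes>\<^sub>M borel" by (simp add: borel_prod)
  define \<pi>1 where "\<pi>1 = density (M \<Otimes>\<^sub>M N) H"
  define \<pi>2 where "\<pi>2 = distr (density \<mu> w) borel (\<lambda>x. (x, a))"
  define \<pi>3 where "\<pi>3 = distr (density \<nu> w') borel (\<lambda>y. (a, y))"
  define \<pi> where "\<pi> = add_measure (add_measure \<pi>1 \<pi>2) \<pi>3"
  have s1: "sets \<pi>1 = sets borel" by (simp add: \<pi>1_def sP borelP)
  have s2: "sets \<pi>2 = sets borel" "sets \<pi>3 = sets borel" by (simp_all add: \<pi>2_def \<pi>3_def)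
  have s\<pi>: "sets \<pi> = sets borel" by (simp add: \<pi>_def s1)
  have sp: "space \<pi> = UNIV" using sets_eq_imp_space_eq[OF s\<pi>] by simp
  have em: "emeasure \<pi> Z = emeasure \<pi>1 Z + emeasure \<pi>2 Z + emeasure \<pi>3 Z" for Z
    unfolding \<pi>_def using s1 s2 by (simp add: emeasure_add_measure)
  have int1: "(\<integral>\<^sup>+ z. f z \<partial>\<pi>1) = (\<integral>\<^sup>+ x. (\<integral>\<^sup>+ y. H (x, y) * f (x, y) \<partial>N) \<partial>M)"
    "(\<integral>\<^sup>+ z. f z \<partial>\<pi>1) = (\<integral>\<^sup>+ y. (\<integral>\<^sup>+ x. H (x, y) * f (x, y) \<partial>M) \<partial>N)"
    if [measurable]: "f \<in> borel_measurable (borel \<Otimes>\<^sub>M borel)" for f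
  proof -
    have "(\<integral>\<^sup>+ z. f z \<partial>\<pi>1) = (\<integral>\<^sup>+ z. H z * f z \<partial>(M \<Otimes>\<^sub>M N))"
      unfolding \<pi>1_def by (rule nn_integral_density) measurable
    moreover have "(\<lambda>z. H z * f z) \<in> borel_measurable (M \<Otimes>\<^sub>M N)" by measurable
    ultimately show "(\<integral>\<^sup>+ z. f z \<partial>\<pi>1) = (\<integral>\<^sup>+ x. (\<integral>\<^sup>+ y. H (x, y) * f (x, y) \<partial>N) \<partial>M)"
      "(\<integral>\<^sup>+ z. f z \<partial>\<pi>1) = (\<integral>\<^sup>+ y. (\<integral>\<^sup>+ x. H (x, y) * f (x, y) \<partial>M) \<partial>N)"
      using N.nn_integral_fst[of "\<lambda>z. H z * f z" M] nn_integral_snd[of "\<lambda>z. H z * f z"] by auto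
  qed
  have restr: "(\<integral>\<^sup>+ x. f x \<partial>M) = (\<integral>\<^sup>+ x. indicator C x * f x \<partial>\<mu>)" "(\<integral>\<^sup>+ x. f x \<partial>N) = (\<integral>\<^sup>+ x. indicator C x * f x \<partial>\<nu>)"
    if [measurable]: "f \<in> borel_measurable borel" for f
    unfolding M_def N_def by (rule nn_integral_density; measurable)+
  have kernels [measurable]: "(\<lambda>x. \<integral>\<^sup>+ y. H (x, y) \<partial>N) \<in> borel_measurable borel"
    "(\<lambda>y. \<integral>\<^sup>+ x. H (x, y) \<partial>M) \<in> borel_measurable borel"
    by measurable
  have marginal1: "emeasure (distr \<pi> borel fst) E = emeasure \<mu> E" if E [measurable]: "E \<in> sets borel" "E \<subseteq> - A" for E
  proof -
    have m [measurable]: "E \<times> UNIV \<in> sets (borel \<Otimes>\<^sub>M borel)" by simp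
    have "emeasure (distr \<pi> borel fst) E = emeasure \<pi> (fst -` E)"
      using emeasure_distr[of fst \<pi> borel E] measurable_fst_snd_borel(1) E
      by (simp add: sp measurable_cong_sets[OF s\<pi> refl])
    also have "fst -` E = E \<times> UNIV" by auto
    finally have "emeasure (distr \<pi> borel fst) E = emeasure \<pi> (E \<times> UNIV)" .
    moreover have "emeasure \<pi>1 (E \<times> UNIV) = (\<integral>\<^sup>+ x. indicator C x * (\<integral>\<^sup>+ y. H (x, y) \<partial>N) * indicator E x \<partial>\<mu>)"
    proof -
      have "emeasure \<pi>1 (E \<times> UNIV) = (\<integral>\<^sup>+ z. indicator (E \<times> UNIV) z \<partial>\<pi>1)"
        using s1 m by (simp add: borelP)
      also have "\<dots> = (\<integral>\<^sup>+ x. (\<integral>\<^sup>+ y. H (x, y) * indicator (E \<times> UNIV) (x, y) \<partial>N) \<partial>M)"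
        by (rule int1(1)) measurable
      also have "\<dots> = (\<integral>\<^sup>+ x. (\<integral>\<^sup>+ y. H (x, y) \<partial>N) * indicator E x \<partial>M)"
        by (rule nn_integral_cong) (auto simp: indicator_def)
      also have "\<dots> = (\<integral>\<^sup>+ x. indicator C x * ((\<integral>\<^sup>+ y. H (x, y) \<partial>N) * indicator E x) \<partial>\<mu>)"
        by (rule restr(1)) measurable
      finally show ?thesis by (simp only: mult.assoc)
    qed
    moreover have "emeasure \<pi>2 (E \<times> UNIV) = (\<integral>\<^sup>+ x. w x * indicator E x \<partial>\<mu>)"
    proof -
      have "emeasure \<pi>2 (E \<times> UNIV) = emeasure (density \<mu> w) E"
        unfolding \<pi>2_def using m measurable_Pair_borel(1)[of a]
        by (subst emeasure_distr) (auto simp: measurable_cong_sets[OF s(1) refl] borelP sets_eq_imp_space_eq[OF s(1)] vimage_def)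
      then show ?thesis by (simp add: emeasure_density)
    qed
    \<comment> \<open>All of \<open>\<pi>3\<close> projects to the point \<open>a\<close> of
      \<open>A\<close>, which a relative marginal does not see.\<close>
    moreover have "emeasure \<pi>3 (E \<times> UNIV) = 0"
    proof -
      have "a \<notin> E" using A E by auto
      then show ?thesis
        unfolding \<pi>3_def using m measurable_Pair_borel(2)[of a]
        by (subst emeasure_distr) (auto simp: measurable_cong_sets[OF s(2) refl] borelP vimage_def)
    qed
    ultimately have "emeasure (distr \<pi> borel fst) E
        = (\<integral>\<^sup>+ x. indicator C x * (\<integral>\<^sup>+ y. H (x, y) \<partial>N) * indicator E x + w x * indicator E x \<partial>\<mu>)"
      unfolding em by (subst nn_integral_add) auto
    also have "\<dots> = (\<integral>\<^sup>+ x. indicator E x \<partial>\<mu>)"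
      using w1 unfolding N_def[symmetric] by (intro nn_integral_cong_AE) (auto simp: distrib_right[symmetric])
    finally show ?thesis by simp
  qed
  have marginal2: "emeasure (distr \<pi> borel snd) E = emeasure \<nu> E" if E [measurable]: "E \<in> sets borel" "E \<subseteq> - A" for E
  proof -
    have m [measurable]: "UNIV \<times> E \<in> sets (borel \<Otimes>\<^sub>M borel)" by simp
    have "emeasure (distr \<pi> borel snd) E = emeasure \<pi> (snd -` E)"
      using emeasure_distr[of snd \<pi> borel E] measurable_fst_snd_borel(2) E
      by (simp add: sp measurable_cong_sets[OF s\<pi> refl])
    also have "snd -` E = UNIV \<times> E" by auto
    finally have "emeasure (distr \<pi> borel snd) E = emeasure \<pi> (UNIV \<times> E)" .
    moreover have "emeasure \<pi>1 (UNIV \<times> E) = (\<integral>\<^sup>+ y. indicator C y * (\<integral>\<^sup>+ x. H (x, y) \<partial>M) * indicator E y \<partial>\<nu>)"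
    proof -
      have "emeasure \<pi>1 (UNIV \<times> E) = (\<integral>\<^sup>+ z. indicator (UNIV \<times> E) z \<partial>\<pi>1)"
        using s1 m by (simp add: borelP)
      also have "\<dots> = (\<integral>\<^sup>+ y. (\<integral>\<^sup>+ x. H (x, y) * indicator (UNIV \<times> E) (x, y) \<partial>M) \<partial>N)"
        by (rule int1(2)) measurable
      also have "\<dots> = (\<integral>\<^sup>+ y. (\<integral>\<^sup>+ x. H (x, y) \<partial>M) * indicator E y \<partial>N)"
        by (rule nn_integral_cong) (auto simp: indicator_def)
      also have "\<dots> = (\<integral>\<^sup>+ y. indicator C y * ((\<integral>\<^sup>+ x. H (x, y) \<partial>M) * indicator E y) \<partial>\<nu>)"
        by (rule restr(2)) measurable
      finally show ?thesis by (simp only: mult.assoc)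
    qed
    moreover have "emeasure \<pi>3 (UNIV \<times> E) = (\<integral>\<^sup>+ y. w' y * indicator E y \<partial>\<nu>)"
    proof -
      have "emeasure \<pi>3 (UNIV \<times> E) = emeasure (density \<nu> w') E"
        unfolding \<pi>3_def using m measurable_Pair_borel(2)[of a]
        by (subst emeasure_distr) (auto simp: measurable_cong_sets[OF s(2) refl] borelP sets_eq_imp_space_eq[OF s(2)] vimage_def)
      then show ?thesis by (simp add: emeasure_density)
    qed
    moreover have "emeasure \<pi>2 (UNIV \<times> E) = 0"
    proof -
      have "a \<notin> E" using A E by auto
      then show ?thesis
        unfolding \<pi>2_def using m measurable_Pair_borel(1)[of a]
        by (subst emeasure_distr) (auto simp: measurable_cong_sets[OF s(1) refl] borelP vimage_def)
    qed
    ultimately have "emeasure (distr \<pi> borel snd) E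
        = (\<integral>\<^sup>+ y. indicator C y * (\<integral>\<^sup>+ x. H (x, y) \<partial>M) * indicator E y + w' y * indicator E y \<partial>\<nu>)"
      unfolding em by (subst nn_integral_add) auto
    also have "\<dots> = (\<integral>\<^sup>+ y. indicator E y \<partial>\<nu>)"
      using w2 unfolding M_def[symmetric] by (intro nn_integral_cong_AE) (auto simp: distrib_right[symmetric])
    finally show ?thesis by simp
  qed
  have "\<pi> \<in> rel_couplings A \<mu> \<nu>"
    using marginal1 marginal2 s A by (auto simp: rel_couplings_def borel_measures_def s\<pi> rel_eq_iff)
  moreover have "(\<integral>\<^sup>+ z. ennreal (dbar A z) \<partial>\<pi>) \<le>
    (\<integral>\<^sup>+ x. (\<integral>\<^sup>+ y. H (x, y) * ennreal (dbar A (x, y)) \<partial>N) \<partial>M)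
    + (\<integral>\<^sup>+ x. w x * ennreal (infdist x A) \<partial>\<mu>) + (\<integral>\<^sup>+ y. w' y * ennreal (infdist y A) \<partial>\<nu>)"
  proof -
    have mb: "(\<lambda>z. ennreal (dbar A z)) \<in> borel_measurable borel" by measurable
    have m2: "(\<lambda>z. ennreal (dbar A z)) \<in> borel_measurable (borel \<Otimes>\<^sub>M borel)" using mb by (simp add: borelP)
    have mp: "(\<lambda>x. ennreal (dbar A (x, a))) \<in> borel_measurable borel" "(\<lambda>y. ennreal (dbar A (a, y))) \<in> borel_measurable borel"
      using measurable_compose[OF measurable_Pair_borel(1) mb] measurable_compose[OF measurable_Pair_borel(2) mb] by auto
    have "(\<integral>\<^sup>+ z. ennreal (dbar A z) \<partial>\<pi>) = (\<integral>\<^sup>+ z. ennreal (dbar A z) \<partial>\<pi>1) + (\<integral>\<^sup>+ z. ennreal (dbar A z) \<partial>\<pi>2) + (\<integral>\<^sup>+ z. ennreal (dbar A z) \<partial>\<pi>3)"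
      unfolding \<pi>_def using s1 s2 mb by (simp add: nn_integral_add_measure cong: measurable_cong_sets)
    also have "(\<integral>\<^sup>+ z. ennreal (dbar A z) \<partial>\<pi>1) = (\<integral>\<^sup>+ x. (\<integral>\<^sup>+ y. H (x, y) * ennreal (dbar A (x, y)) \<partial>N) \<partial>M)"
      by (rule int1(1)[OF m2])
    also have "(\<integral>\<^sup>+ z. ennreal (dbar A z) \<partial>\<pi>2) = (\<integral>\<^sup>+ x. w x * ennreal (dbar A (x, a)) \<partial>\<mu>)"
      unfolding \<pi>2_def using mb mp measurable_Pair_borel(1)[of a] s w
      by (subst nn_integral_distr) (auto simp: nn_integral_density cong: measurable_cong_sets)
    \<comment> \<open>\<open>dbar\<close> charges a trip to any point of \<open>A\<close> no more
      than the distance to \<open>A\<close>, however far away \<open>a\<close> is.\<close>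
    also have "\<dots> \<le> (\<integral>\<^sup>+ x. w x * ennreal (infdist x A) \<partial>\<mu>)"
      by (intro nn_integral_mono mult_left_mono ennreal_leI dbar_boundary A) auto
    also have "(\<integral>\<^sup>+ z. ennreal (dbar A z) \<partial>\<pi>3) = (\<integral>\<^sup>+ y. w' y * ennreal (dbar A (a, y)) \<partial>\<nu>)"
      unfolding \<pi>3_def using mb mp measurable_Pair_borel(2)[of a] s w
      by (subst nn_integral_distr) (auto simp: nn_integral_density cong: measurable_cong_sets)
    also have "\<dots> \<le> (\<integral>\<^sup>+ y. w' y * ennreal (infdist y A) \<partial>\<nu>)"
      by (intro nn_integral_mono mult_left_mono ennreal_leI dbar_boundary A) auto
    finally show ?thesis by (simp add: add_mono)
  qed
  ultimately show ?thesis unfolding M_def N_def by blast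
qed

section \<open>Lipschitz integrands and the tail of the first moment\<close>

lemma lipschitz_abs_le_infdist:
  fixes f :: "'a::metric_space \<Rightarrow> real"
  assumes "s-lipschitz_on UNIV f" "A \<noteq> {}" "\<And>x. x \<in> A \<Longrightarrow> f x = 0"
  shows "\<bar>f x\<bar> \<le> s * infdist x A"
proof (cases "s = 0")
  case True
  obtain a where "a \<in> A" using assms(2) by blast
  have "\<bar>f x - f a\<bar> \<le> s * dist x a" using assms(1) unfolding lipschitz_on_abs_diff by blast
  with True assms(3)[OF \<open>a \<in> A\<close>] show ?thesis by simp
next
  case False
  with assms(1) have s: "s > 0" by (simp add: lipschitz_on_abs_diff)
  have "\<bar>f x\<bar> / s \<le> dist x a" if "a \<in> A" for a
  proof -
    have "\<bar>f x - f a\<bar> \<le> s * dist x a" using assms(1) unfolding lipschitz_on_abs_diff by blast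
    with assms(3)[OF that] s show ?thesis by (simp add: pos_divide_le_eq mult.commute)
  qed
  then have "\<bar>f x\<bar> / s \<le> infdist x A"
    unfolding infdist_notempty[OF assms(2)] by (intro cINF_greatest assms(2))
  then show ?thesis using s by (simp add: pos_divide_le_eq mult.commute)
qed

lemma integrable_infdist:
  fixes A :: "'a::polish_space set"
  assumes "closed A" "A \<noteq> {}" "\<mu> \<in> M1_pos A"
  shows "integrable \<mu> (\<lambda>x. infdist x A)"
  using assms by (intro integrableI_nonneg)
    (auto simp: M1_pos_iff infdist_nonneg cong: measurable_cong_sets)

lemma integrable_lipschitz:
  fixes A :: "'a::polish_space set"
  assumes "closed A" "A \<noteq> {}" "\<mu> \<in> M1_pos A"
    and "s-lipschitz_on UNIV f" "\<And>x. x \<in> A \<Longrightarrow> f x = (0 :: real)"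
  shows "integrable \<mu> f"
proof (rule Bochner_Integration.integrable_bound)
  show "integrable \<mu> (\<lambda>x. s * infdist x A)" using integrable_infdist[OF assms(1-3)] by simp
  have "f \<in> borel_measurable borel"
    by (rule borel_measurable_continuous_onI[OF lipschitz_on_continuous_on[OF assms(4)]])
  then show "f \<in> borel_measurable \<mu>"
    using assms by (simp add: M1_pos_iff cong: measurable_cong_sets)
  show "AE x in \<mu>. norm (f x) \<le> norm (s * infdist x A)"
    using lipschitz_abs_le_infdist[OF assms(4,2,5)] by (intro AE_I2) (simp, smt (verit))
qed

text \<open>The measure with density \<open>infdist x A\<close> is finite although
  \<open>\<mu>\<close> may be infinite. The complements of
  \<open>level A n \<inter> cball a (real n)\<close> decrease to \<open>A\<close>, where this
  density is 0. In a boundedly compact space these intersections are compact.\<close>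

lemma eventually_tail_small:
  fixes A :: "'a::polish_space set"
  assumes A: "closed A" "a \<in> A" and \<mu>: "\<mu> \<in> M1_pos A" and e: "0 < e"
  shows "\<forall>\<^sub>F n in sequentially.
    (\<integral>\<^sup>+ x. ennreal (infdist x A) * indicator (- (level A n \<inter> cball a (real n))) x \<partial>\<mu>) \<le> ennreal e"
proof -
  have ne: "A \<noteq> {}" using A by auto
  have s [measurable_cong]: "sets \<mu> = sets borel" and m: "(\<integral>\<^sup>+ x. ennreal (infdist x A) \<partial>\<mu>) < \<infinity>"
    using \<mu> by (auto simp: M1_pos_iff[OF A(1) ne])
  define D where "D = density \<mu> (\<lambda>x. ennreal (infdist x A))"
  define U where "U n = - (level A n \<inter> cball a (real n))" for n
  have sD: "sets D = sets borel" using s by (simp add: D_def)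
  have U [measurable]: "U n \<in> sets borel" for n
    unfolding U_def using closed_level[of A n] by auto
  have [measurable]: "A \<in> sets borel" using A by auto
  have emD: "emeasure D E = (\<integral>\<^sup>+ x. ennreal (infdist x A) * indicator E x \<partial>\<mu>)" if [measurable]: "E \<in> sets borel" for E
    unfolding D_def by (rule emeasure_density) (simp_all add: s)
  have "emeasure D (U n) \<le> (\<integral>\<^sup>+ x. ennreal (infdist x A) \<partial>\<mu>)" for n
    unfolding emD[OF U] by (intro nn_integral_mono) (simp add: indicator_def)
  then have finD: "emeasure D (U n) \<noteq> \<infinity>" for n using m by (metis not_less)
  have "(\<Inter>n. U n) = A"
  proof -
    have "\<exists>n. x \<in> level A n \<inter> cball a (real n)" if x: "x \<notin> A" for x
    proof -
      obtain k where k: "x \<in> level A k" using UN_level[OF A(1) ne] x by blast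
      obtain l where l: "dist a x \<le> real l" using real_arch_simple by blast
      have "x \<in> level A (max k l)" using incseqD[OF incseq_level[of A], of k "max k l"] k by auto
      then show ?thesis using l by (intro exI[of _ "max k l"]) auto
    qed
    moreover have "x \<notin> level A n" if "x \<in> A" for x n using UN_level[OF A(1) ne] that by blast
    ultimately show ?thesis unfolding U_def by fast
  qed
  moreover have "emeasure D A = (\<integral>\<^sup>+ x. 0 \<partial>\<mu>)"
    unfolding emD[OF \<open>A \<in> sets borel\<close>] by (intro nn_integral_cong) (auto simp: indicator_def)
  moreover have "(\<lambda>n. emeasure D (U n)) \<longlonglongrightarrow> emeasure D (\<Inter>n. U n)"
  proof (rule Lim_emeasure_decseq)
    show "decseq U"
    proof (rule decseq_SucI)
      fix n
      have "level A n \<subseteq> level A (Suc n)" using incseq_level[of A] by (auto simp: incseq_Suc_iff)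
      then show "U (Suc n) \<subseteq> U n" by (auto simp: U_def)
    qed
  qed (use sD finD U in auto)
  ultimately have "(\<lambda>n. emeasure D (U n)) \<longlonglongrightarrow> 0" by simp
  from order_tendstoD(2)[OF this, of "ennreal e"] e
  have "\<forall>\<^sub>F n in sequentially. emeasure D (U n) \<le> ennreal e"
    by (auto elim!: eventually_mono)
  then show ?thesis unfolding emD[OF U] by (simp only: U_def)
qed

text \<open>The potential is the largest \<open>s\<close>-Lipschitz function below \<open>- v\<close> at the points \<open>p j\<close>, cut off by the
  distance to \<open>A\<close> and, for compactness of the support, far away from the points \<open>p j\<close>.\<close>

lemma potential_exists:
  fixes A :: "'a::metric_space set" and N :: nat
  assumes bc: "\<And>S :: 'a set. closed S \<Longrightarrow> bounded S \<Longrightarrow> compact S"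
    and a: "a \<in> A" and s: "0 \<le> s" and \<rho>: "0 \<le> \<rho>" "\<And>i. i < N \<Longrightarrow> dist (p i) a \<le> \<rho>"
    and u: "\<And>i. i < N \<Longrightarrow> u i \<le> s * infdist (p i) A"
    and v: "\<And>j. j < N \<Longrightarrow> v j \<le> s * infdist (p j) A"
    and uv: "\<And>i j. i < N \<Longrightarrow> j < N \<Longrightarrow> u i + v j \<le> s * dist (p i) (p j)"
  obtains \<phi> where "\<phi> \<in> Lip_c A" "s-lipschitz_on UNIV \<phi>"
    "\<And>i. i < N \<Longrightarrow> u i \<le> \<phi> (p i)" "\<And>i. i < N \<Longrightarrow> \<phi> (p i) \<le> - v i"
proof -
  \<comment> \<open>At \<open>p i\<close> the cutoff \<open>2 * \<rho> - dist x a\<close> is at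
    least \<open>\<rho>\<close>, hence at least \<open>infdist (p i) A\<close>, and does not lower
    \<open>\<psi> N\<close>. Beyond the radius \<open>2 * \<rho>\<close> it is 0, while
    \<open>x\<close> is then at distance at least \<open>infdist (p j) A\<close> from each
    \<open>p j\<close>; so the other \<open>\<psi> j\<close> are nonnegative and the minimum is
    0.\<close>
  define \<psi> where "\<psi> j x = (if j = N then s * min (infdist x A) (max 0 (2 * \<rho> - dist x a))
    else s * dist x (p j) - v j)" for j x
  define \<phi> where "\<phi> x = Min ((\<lambda>j. \<psi> j x) ` {..N})" for x
  have le: "\<phi> x \<le> \<psi> j x" if "j \<le> N" for j x
    unfolding \<phi>_def using that by (intro Min_le) auto
  have ge: "c \<le> \<phi> x" if "\<And>j. j \<le> N \<Longrightarrow> c \<le> \<psi> j x" for c x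
    unfolding \<phi>_def using that by (subst Min_ge_iff) auto
  have inf_le: "infdist x A \<le> dist x a" for x by (rule infdist_le[OF a])
  have \<psi>_lip: "\<psi> j x \<le> \<psi> j y + s * dist x y" for j x y
  proof -
    have "min (infdist x A) (max 0 (2 * \<rho> - dist x a))
        \<le> min (infdist y A) (max 0 (2 * \<rho> - dist y a)) + dist x y"
      using infdist_triangle[of x A y] dist_triangle[of y a x] zero_le_dist[of x y]
      unfolding dist_commute[of y x] by linarith
    then have 1: "s * min (infdist x A) (max 0 (2 * \<rho> - dist x a))
        \<le> s * min (infdist y A) (max 0 (2 * \<rho> - dist y a)) + s * dist x y"
      unfolding distrib_left[symmetric] by (rule mult_left_mono[OF _ s])
    have "s * dist x (p j) \<le> s * dist y (p j) + s * dist x y"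
      unfolding distrib_left[symmetric] using dist_triangle[of x "p j" y] by (intro mult_left_mono[OF _ s]) simp
    with 1 show ?thesis by (simp add: \<psi>_def)
  qed
  have \<phi>_lip: "\<phi> x - s * dist x y \<le> \<phi> y" for x y
    using le \<psi>_lip by (intro ge) (smt (verit))
  have lip: "s-lipschitz_on UNIV \<phi>"
    unfolding lipschitz_on_abs_diff
  proof (intro conjI ballI s)
    fix x y show "\<bar>\<phi> x - \<phi> y\<bar> \<le> s * dist x y"
      using \<phi>_lip[of x y] \<phi>_lip[of y x] by (simp add: dist_commute)
  qed
  have vanish: "\<phi> x = 0" if "\<psi> N x = 0" "\<And>j. j < N \<Longrightarrow> v j \<le> s * dist x (p j)" for x
  proof (rule antisym)
    show "\<phi> x \<le> 0" using le[of N x] that by simp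
    show "0 \<le> \<phi> x" using that by (intro ge) (metis \<psi>_def diff_ge_0_iff_ge le_neq_implies_less order_refl)
  qed
  have "\<phi> \<in> Lip_c A"
  proof (rule Lip_c_if_support[OF lip])
    show "compact (cball a (2 * \<rho>))" by (rule bc) auto
    show "\<phi> x = 0" if x: "x \<notin> cball a (2 * \<rho>)" for x
    proof (rule vanish)
      have far: "2 * \<rho> < dist x a" using x by (simp add: dist_commute)
      then show "\<psi> N x = 0" by (simp add: \<psi>_def infdist_nonneg)
      fix j assume j: "j < N"
      have "infdist (p j) A \<le> dist x (p j)"
        using inf_le[of "p j"] \<rho>(2)[OF j] far dist_triangle[of x a "p j"] by linarith
      then show "v j \<le> s * dist x (p j)" using v[OF j] mult_left_mono[OF _ s] by (meson order_trans)
    qed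
    show "\<phi> x = 0" if x: "x \<in> A" for x
    proof (rule vanish)
      show "\<psi> N x = 0" using x by (simp add: \<psi>_def)
      fix j assume j: "j < N"
      have "infdist (p j) A \<le> dist x (p j)" using infdist_le[OF x, of "p j"] by (simp add: dist_commute)
      then show "v j \<le> s * dist x (p j)" using v[OF j] mult_left_mono[OF _ s] by (meson order_trans)
    qed
  qed
  moreover have "u i \<le> \<phi> (p i)" if i: "i < N" for i
  proof (rule ge)
    fix j assume "j \<le> N"
    have "infdist (p i) A \<le> 2 * \<rho> - dist (p i) a" using inf_le[of "p i"] \<rho>(2)[OF i] by simp
    then have "\<psi> N (p i) = s * infdist (p i) A" by (simp add: \<psi>_def)
    then show "u i \<le> \<psi> j (p i)"
      using u[OF i] uv[OF i, of j] \<open>j \<le> N\<close> by (cases "j = N") (auto simp: \<psi>_def)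
  qed
  moreover have "\<phi> (p i) \<le> - v i" if "i < N" for i using le[of i "p i"] that by (simp add: \<psi>_def)
  ultimately show thesis using lip that by blast
qed

text \<open>The cells are the fibres of the index function \<open>r\<close> over the numbers below
  \<open>N\<close>; indices from \<open>N\<close> on mark the points outside \<open>C\<close>. In
  this form a cellwise constant function is a composition \<open>g (r x)\<close>, measurable for
  every \<open>g\<close>.\<close>

locale cell_partition =
  fixes C :: "'a::metric_space set" and r :: "'a \<Rightarrow> nat" and N :: nat
  assumes C_eq: "C = {x. r x < N}" and r [measurable]: "r \<in> borel \<rightarrow>\<^sub>M count_space UNIV"
begin

lemma C_borel [measurable]: "C \<in> sets borel"
  unfolding C_eq by measurable

lemma cell_borel [measurable]: "r -` {i} \<in> sets borel"
  using measurable_sets[OF r, of "{i}"] by simp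

lemma compose_r [measurable]: "(\<lambda>x. g (r x)) \<in> borel_measurable borel"
  by (rule measurable_compose[OF r]) simp

lemma nn_integral_cells:
  fixes g :: "nat \<Rightarrow> ennreal"
  assumes "sets \<mu> = sets borel"
  shows "(\<integral>\<^sup>+ x. g (r x) \<partial>density \<mu> (indicator C)) = (\<Sum>i<N. g i * emeasure \<mu> (r -` {i}))"
proof -
  note [measurable_cong] = assms
  have "(\<integral>\<^sup>+ x. g (r x) \<partial>density \<mu> (indicator C)) = (\<integral>\<^sup>+ x. indicator C x * g (r x) \<partial>\<mu>)"
    by (rule nn_integral_density) measurable
  also have "\<dots> = (\<integral>\<^sup>+ x. (\<Sum>i<N. g i * indicator (r -` {i}) x) \<partial>\<mu>)"
  proof (rule nn_integral_cong)
    fix x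
    have "(\<Sum>i<N. g i * indicator (r -` {i}) x) = (\<Sum>i<N. if r x = i then g i else 0)"
      by (rule sum.cong) (auto simp: indicator_def)
    also have "\<dots> = indicator C x * g (r x)" by (simp add: C_eq indicator_def)
    finally show "indicator C x * g (r x) = (\<Sum>i<N. g i * indicator (r -` {i}) x)" by simp
  qed
  also have "\<dots> = (\<Sum>i<N. \<integral>\<^sup>+ x. g i * indicator (r -` {i}) x \<partial>\<mu>)"
    by (rule nn_integral_sum) measurable
  also have "\<dots> = (\<Sum>i<N. g i * emeasure \<mu> (r -` {i}))"
    using assms by (intro sum.cong refl nn_integral_cmult_indicator) auto
  finally show ?thesis .
qed

lemma emeasure_cell:
  assumes "sets \<mu> = sets borel" "emeasure \<mu> C < \<infinity>" "i < N"
  shows "emeasure \<mu> (r -` {i}) = ennreal (measure \<mu> (r -` {i}))"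
proof -
  have "emeasure \<mu> (r -` {i}) \<le> emeasure \<mu> C"
    using assms by (intro emeasure_mono) (auto simp: C_eq)
  with assms(2) show ?thesis by (intro emeasure_eq_ennreal_measure) auto
qed

lemma measure_C:
  assumes "sets \<mu> = sets borel" "emeasure \<mu> C < \<infinity>"
  shows "measure \<mu> C = (\<Sum>i<N. measure \<mu> (r -` {i}))"
proof -
  have "emeasure \<mu> C = (\<integral>\<^sup>+ x. 1 \<partial>density \<mu> (indicator C))"
    using assms(1) by (simp add: emeasure_restricted sets_eq_imp_space_eq[OF assms(1)])
  also have "\<dots> = (\<Sum>i<N. emeasure \<mu> (r -` {i}))" using nn_integral_cells[OF assms(1), of "\<lambda>_. 1"] by simp
  also have "\<dots> = ennreal (\<Sum>i<N. measure \<mu> (r -` {i}))"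
    by (simp add: emeasure_cell[OF assms] sum_ennreal)
  finally show ?thesis by (simp add: measure_def sum_nonneg)
qed

text \<open>\<open>\<phi>\<close> has an explicit minorant \<open>l\<close>: on cell
  \<open>i\<close> it is \<open>u i\<close> minus \<open>s * \<delta>\<close>, the change of
  \<open>\<phi>\<close> allowed between \<open>p i\<close> and a point of the cell, and outside
  \<open>C\<close> it is \<open>- (s * infdist x A)\<close>. Its integral produces the two error
  terms.\<close>

lemma sum_le_integral:
  fixes A :: "'a set"
  assumes \<mu>: "sets \<mu> = sets borel" "emeasure \<mu> C < \<infinity>" "integrable \<mu> (\<lambda>x. infdist x A)" "integrable \<mu> \<phi>"
    and tail: "(\<integral>\<^sup>+ x. ennreal (infdist x A) * indicator (- C) x \<partial>\<mu>) \<le> ennreal e" "0 \<le> e"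
    and near: "\<And>x. r x < N \<Longrightarrow> dist x (p (r x)) \<le> \<delta>"
    and \<phi>: "s-lipschitz_on UNIV \<phi>" "A \<noteq> {}" "\<And>x. x \<in> A \<Longrightarrow> \<phi> x = (0 :: real)"
    and u: "\<And>i. i < N \<Longrightarrow> u i \<le> \<phi> (p i)"
  shows "(\<Sum>i<N. u i * measure \<mu> (r -` {i})) \<le> integral\<^sup>L \<mu> \<phi> + s * (\<delta> * measure \<mu> C + e)"
proof -
  note [measurable_cong] = \<mu>(1)
  have s0: "0 \<le> s" by (rule lipschitz_on_nonneg[OF \<phi>(1)])
  have ind: "integrable \<mu> (indicator (r -` {i}) :: 'a \<Rightarrow> real)" if "i < N" for i
    using \<mu> emeasure_cell[OF \<mu>(1,2) that] by (intro integrable_real_indicator) auto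
  have indC: "integrable \<mu> (indicator C :: 'a \<Rightarrow> real)" using \<mu> by (intro integrable_real_indicator) auto
  have it: "integrable \<mu> (\<lambda>x. infdist x A * indicator (- C) x)"
    by (rule integrable_real_mult_indicator[OF _ \<mu>(3)]) (simp add: \<mu>)
  have it_le: "(\<integral>x. infdist x A * indicator (- C) x \<partial>\<mu>) \<le> e"
  proof -
    have "ennreal (\<integral>x. infdist x A * indicator (- C) x \<partial>\<mu>) = (\<integral>\<^sup>+ x. ennreal (infdist x A * indicator (- C) x) \<partial>\<mu>)"
      by (rule nn_integral_eq_integral[symmetric, OF it]) (simp add: infdist_nonneg)
    also have "\<dots> = (\<integral>\<^sup>+ x. ennreal (infdist x A) * indicator (- C) x \<partial>\<mu>)"
      by (rule nn_integral_cong) (simp add: indicator_def)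
    also note tail(1)
    finally show ?thesis using tail(2) by simp
  qed
  define l where "l x = (\<Sum>i<N. u i * indicator (r -` {i}) x) - (s * \<delta>) * indicator C x - s * (infdist x A * indicator (- C) x)" for x
  have l_le: "l x \<le> \<phi> x" for x
  proof (cases "x \<in> C")
    case True
    then have rx: "r x < N" by (simp add: C_eq)
    have "(\<Sum>i<N. u i * indicator (r -` {i}) x) = (\<Sum>i<N. if r x = i then u i else 0)"
      by (rule sum.cong) (auto simp: indicator_def)
    also have "\<dots> = u (r x)" using rx by simp
    finally have "l x = u (r x) - s * \<delta>" using True by (simp add: l_def)
    also have "\<dots> \<le> \<phi> (p (r x)) - s * dist x (p (r x))"
      using u[OF rx] mult_left_mono[OF near[OF rx] s0] by linarith
    also have "\<dots> \<le> \<phi> x" using \<phi>(1) unfolding lipschitz_on_abs_diff by (smt (verit) UNIV_I)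
    finally show ?thesis .
  next
    case False
    then have "(\<Sum>i<N. u i * indicator (r -` {i}) x) = 0"
      by (intro sum.neutral) (auto simp: indicator_def C_eq)
    then have "l x = - (s * infdist x A)" using False by (simp add: l_def)
    then show ?thesis using lipschitz_abs_le_infdist[OF \<phi>, of x] by simp
  qed
  have l1: "integrable \<mu> (\<lambda>x. \<Sum>i<N. u i * indicator (r -` {i}) x)"
    by (intro Bochner_Integration.integrable_sum integrable_mult_right ind) auto
  have "integrable \<mu> l"
    unfolding l_def by (intro Bochner_Integration.integrable_diff l1 integrable_mult_right indC it)
  then have "integral\<^sup>L \<mu> l \<le> integral\<^sup>L \<mu> \<phi>" by (rule integral_mono[OF _ \<mu>(4) l_le])
  moreover have "integral\<^sup>L \<mu> l = (\<Sum>i<N. u i * measure \<mu> (r -` {i})) - s * \<delta> * measure \<mu> C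
      - s * (\<integral>x. infdist x A * indicator (- C) x \<partial>\<mu>)"
  proof -
    have "integral\<^sup>L \<mu> l = (\<integral>x. (\<Sum>i<N. u i * indicator (r -` {i}) x) \<partial>\<mu>)
        - (\<integral>x. (s * \<delta>) * indicator C x \<partial>\<mu>) - (\<integral>x. s * (infdist x A * indicator (- C) x) \<partial>\<mu>)"
      unfolding l_def using l1 indC it by (simp only: Bochner_Integration.integral_diff
          Bochner_Integration.integrable_diff integrable_mult_right)
    also have "(\<integral>x. (\<Sum>i<N. u i * indicator (r -` {i}) x) \<partial>\<mu>) = (\<Sum>i<N. \<integral>x. u i * indicator (r -` {i}) x \<partial>\<mu>)"
      by (rule Bochner_Integration.integral_sum) (use ind in \<open>auto intro!: integrable_mult_right\<close>)
    finally show ?thesis by (simp add: sets_eq_imp_space_eq[OF \<mu>(1)])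
  qed
  moreover have "s * (\<integral>x. infdist x A * indicator (- C) x \<partial>\<mu>) \<le> s * e"
    by (rule mult_left_mono[OF it_le s0])
  ultimately show ?thesis by (simp add: algebra_simps)
qed

text \<open>The plan \<open>h\<close> is spread with constant density over each product of cells.
  Integrating out \<open>y\<close> at a point of cell \<open>i\<close> leaves the sum of
  \<open>h i j\<close> over \<open>j\<close>, divided by the mass of the cell; the share
  \<open>q i\<close> completes it to 1. Division by 0 yields 0, which is right for null columns
  since \<open>h\<close> vanishes there by \<open>h0\<close>; null rows are avoided almost
  everywhere.\<close>

lemma AE_weight:
  fixes h :: "nat \<Rightarrow> nat \<Rightarrow> real" and q :: "nat \<Rightarrow> real"
  assumes s: "sets \<mu> = sets borel" "sets \<nu> = sets borel" and fin: "emeasure \<mu> C < \<infinity>" "emeasure \<nu> C < \<infinity>"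
    and h: "\<And>i j. i < N \<Longrightarrow> j < N \<Longrightarrow> 0 \<le> h i j" "\<And>i. i < N \<Longrightarrow> 0 \<le> q i"
    and h0: "\<And>i j. i < N \<Longrightarrow> j < N \<Longrightarrow> measure \<nu> (r -` {j}) = 0 \<Longrightarrow> h i j = 0"
    and row: "\<And>i. i < N \<Longrightarrow> (\<Sum>j<N. h i j) + q i = measure \<mu> (r -` {i})"
  shows "AE x in \<mu>. indicator C x * (\<integral>\<^sup>+ y. ennreal (h (r x) (r y) / (measure \<mu> (r -` {r x}) * measure \<nu> (r -` {r y})))
      \<partial>density \<nu> (indicator C)) + (if x \<in> C then ennreal (q (r x) / measure \<mu> (r -` {r x})) else 1) = 1"
proof -
  let ?m = "\<lambda>i. measure \<mu> (r -` {i})" and ?n = "\<lambda>i. measure \<nu> (r -` {i})"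
  have "AE x in \<mu>. r x = i \<longrightarrow> ?m i \<noteq> 0" if "i < N" for i
  proof (cases "?m i = 0")
    case True
    then have "r -` {i} \<in> null_sets \<mu>" using s emeasure_cell[OF s(1) fin(1) that] by (auto simp: null_sets_def)
    from AE_not_in[OF this] show ?thesis by eventually_elim auto
  qed simp
  then have "AE x in \<mu>. \<forall>i\<in>{..<N}. r x = i \<longrightarrow> ?m i \<noteq> 0" by (intro AE_finite_allI) auto
  then show ?thesis
  proof eventually_elim
    case (elim x)
    show ?case
    proof (cases "x \<in> C")
      case True
      then have i: "r x < N" by (simp add: C_eq)
      then have "?m (r x) \<noteq> 0" using elim by auto
      then have m: "?m (r x) > 0" by (simp add: zero_less_measure_iff measure_nonneg less_le)
      have "(\<integral>\<^sup>+ y. ennreal (h (r x) (r y) / (?m (r x) * ?n (r y))) \<partial>density \<nu> (indicator C))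
          = (\<Sum>j<N. ennreal (h (r x) j / (?m (r x) * ?n j)) * emeasure \<nu> (r -` {j}))"
        by (rule nn_integral_cells[OF s(2)])
      also have "\<dots> = (\<Sum>j<N. ennreal (h (r x) j / ?m (r x)))"
      proof (rule sum.cong[OF refl])
        fix j assume "j \<in> {..<N}"
        then have j: "j < N" by simp
        have "h (r x) j / (?m (r x) * ?n j) * ?n j = h (r x) j / ?m (r x)"
          using h0[OF i j] by (cases "?n j = 0") auto
        then show "ennreal (h (r x) j / (?m (r x) * ?n j)) * emeasure \<nu> (r -` {j}) = ennreal (h (r x) j / ?m (r x))"
          unfolding emeasure_cell[OF s(2) fin(2) j] by (subst ennreal_mult[symmetric]) (use h(1)[OF i j] in auto)
      qed
      also have "\<dots> = ennreal (\<Sum>j<N. h (r x) j / ?m (r x))"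
        using h(1)[OF i] by (intro sum_ennreal) auto
      finally have "(\<integral>\<^sup>+ y. ennreal (h (r x) (r y) / (?m (r x) * ?n (r y))) \<partial>density \<nu> (indicator C))
          + ennreal (q (r x) / ?m (r x)) = ennreal ((\<Sum>j<N. h (r x) j / ?m (r x)) + q (r x) / ?m (r x))"
        using h(1)[OF i] h(2)[OF i]
        by (simp only:) (rule ennreal_plus[symmetric], auto intro!: sum_nonneg)
      also have "(\<Sum>j<N. h (r x) j / ?m (r x)) + q (r x) / ?m (r x) = 1"
        using row[OF i] m unfolding sum_divide_distrib[symmetric] add_divide_distrib[symmetric] by simp
      finally show ?thesis using True by simp
    qed simp
  qed
qed

text \<open>Outside \<open>C\<close> the weight is 1, so all mass goes to the boundary and costs at
  most the tail \<open>e\<close>. Inside, the weight has total mass \<open>q i\<close> on cell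
  \<open>i\<close>, where \<open>d i\<close> bounds the distance to \<open>A\<close>.\<close>

lemma boundary_cost_le:
  fixes A :: "'a set" and q :: "nat \<Rightarrow> real"
  assumes s: "sets \<mu> = sets borel" and fin: "emeasure \<mu> C < \<infinity>"
    and q: "\<And>i. i < N \<Longrightarrow> 0 \<le> q i" "\<And>i. i < N \<Longrightarrow> measure \<mu> (r -` {i}) = 0 \<Longrightarrow> q i = 0"
    and d: "\<And>x. r x < N \<Longrightarrow> infdist x A \<le> d (r x)" "\<And>i. i < N \<Longrightarrow> 0 \<le> d i"
    and tail: "(\<integral>\<^sup>+ x. ennreal (infdist x A) * indicator (- C) x \<partial>\<mu>) \<le> ennreal e" "0 \<le> e"
  shows "(\<integral>\<^sup>+ x. (if x \<in> C then ennreal (q (r x) / measure \<mu> (r -` {r x})) else 1) * ennreal (infdist x A) \<partial>\<mu>)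
    \<le> ennreal ((\<Sum>i<N. q i * d i) + e)"
proof -
  note [measurable_cong] = s
  let ?m = "\<lambda>i. measure \<mu> (r -` {i})"
  have "(\<integral>\<^sup>+ x. (if x \<in> C then ennreal (q (r x) / ?m (r x)) else 1) * ennreal (infdist x A) \<partial>\<mu>)
      \<le> (\<integral>\<^sup>+ x. indicator C x * (ennreal (q (r x) / ?m (r x)) * ennreal (d (r x))) + ennreal (infdist x A) * indicator (- C) x \<partial>\<mu>)"
    by (intro nn_integral_mono) (auto simp: C_eq indicator_def intro!: mult_left_mono ennreal_leI d)
  also have "\<dots> = (\<integral>\<^sup>+ x. indicator C x * (ennreal (q (r x) / ?m (r x)) * ennreal (d (r x))) \<partial>\<mu>)
      + (\<integral>\<^sup>+ x. ennreal (infdist x A) * indicator (- C) x \<partial>\<mu>)"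
    by (rule nn_integral_add) measurable
  also have "(\<integral>\<^sup>+ x. indicator C x * (ennreal (q (r x) / ?m (r x)) * ennreal (d (r x))) \<partial>\<mu>)
      = (\<integral>\<^sup>+ x. ennreal (q (r x) / ?m (r x)) * ennreal (d (r x)) \<partial>density \<mu> (indicator C))"
    by (rule nn_integral_density[symmetric]) measurable
  also have "\<dots> = (\<Sum>i<N. ennreal (q i / ?m i) * ennreal (d i) * emeasure \<mu> (r -` {i}))"
    by (rule nn_integral_cells[OF s])
  also have "\<dots> = (\<Sum>i<N. ennreal (q i * d i))"
  proof (rule sum.cong[OF refl])
    fix i assume "i \<in> {..<N}"
    then have i: "i < N" by simp
    have "q i / ?m i * d i * ?m i = q i * d i" using q(2)[OF i] by (cases "?m i = 0") auto
    then show "ennreal (q i / ?m i) * ennreal (d i) * emeasure \<mu> (r -` {i}) = ennreal (q i * d i)"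
      unfolding emeasure_cell[OF s fin i] using q(1)[OF i] d(2)[OF i] by (simp add: ennreal_mult[symmetric])
  qed
  also have "\<dots> = ennreal (\<Sum>i<N. q i * d i)" using q(1) d(2) by (intro sum_ennreal) auto
  also have "ennreal (\<Sum>i<N. q i * d i) + (\<integral>\<^sup>+ x. ennreal (infdist x A) * indicator (- C) x \<partial>\<mu>)
      \<le> ennreal (\<Sum>i<N. q i * d i) + ennreal e" by (intro add_left_mono tail)
  also have "\<dots> = ennreal ((\<Sum>i<N. q i * d i) + e)"
    using q(1) d(2) tail(2) by (intro ennreal_plus[symmetric] sum_nonneg) auto
  finally show ?thesis by simp
qed

lemma interior_cost_le:
  fixes c h :: "nat \<Rightarrow> nat \<Rightarrow> real" and A :: "'a set"
  assumes s: "sets \<mu> = sets borel" "sets \<nu> = sets borel" and fin: "emeasure \<mu> C < \<infinity>" "emeasure \<nu> C < \<infinity>"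
    and h: "\<And>i j. i < N \<Longrightarrow> j < N \<Longrightarrow> 0 \<le> h i j" "\<And>i j. i < N \<Longrightarrow> j < N \<Longrightarrow> 0 \<le> c i j"
    and h0: "\<And>i j. i < N \<Longrightarrow> j < N \<Longrightarrow> measure \<mu> (r -` {i}) = 0 \<Longrightarrow> h i j = 0"
      "\<And>i j. i < N \<Longrightarrow> j < N \<Longrightarrow> measure \<nu> (r -` {j}) = 0 \<Longrightarrow> h i j = 0"
    and d: "\<And>x y. r x < N \<Longrightarrow> r y < N \<Longrightarrow> dbar A (x, y) \<le> c (r x) (r y)"
  shows "(\<integral>\<^sup>+ x. (\<integral>\<^sup>+ y. ennreal (h (r x) (r y) / (measure \<mu> (r -` {r x}) * measure \<nu> (r -` {r y})))
       * ennreal (dbar A (x, y)) \<partial>density \<nu> (indicator C)) \<partial>density \<mu> (indicator C))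
    \<le> ennreal (\<Sum>i<N. \<Sum>j<N. h i j * c i j)"
proof -
  let ?m = "\<lambda>i. measure \<mu> (r -` {i})" and ?n = "\<lambda>i. measure \<nu> (r -` {i})"
  let ?H = "\<lambda>i j. ennreal (h i j / (?m i * ?n j))"
  have AE_C: "AE x in density \<tau> (indicator C). r x < N" if "sets \<tau> = sets borel" for \<tau> :: "'a measure"
    using that by (subst AE_density) (auto simp: C_eq indicator_def)
  have "(\<integral>\<^sup>+ x. (\<integral>\<^sup>+ y. ?H (r x) (r y) * ennreal (dbar A (x, y)) \<partial>density \<nu> (indicator C)) \<partial>density \<mu> (indicator C))
      \<le> (\<integral>\<^sup>+ x. (\<integral>\<^sup>+ y. ?H (r x) (r y) * ennreal (c (r x) (r y)) \<partial>density \<nu> (indicator C)) \<partial>density \<mu> (indicator C))"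
    using AE_C[OF s(1)]
  proof (intro nn_integral_mono_AE, eventually_elim)
    case (elim x)
    show ?case using AE_C[OF s(2)]
      by (intro nn_integral_mono_AE, eventually_elim) (intro mult_left_mono ennreal_leI d elim, auto)
  qed
  also have "\<dots> = (\<integral>\<^sup>+ x. (\<Sum>j<N. ?H (r x) j * ennreal (c (r x) j) * emeasure \<nu> (r -` {j})) \<partial>density \<mu> (indicator C))"
    by (rule nn_integral_cong) (rule nn_integral_cells[OF s(2)])
  also have "\<dots> = (\<Sum>i<N. (\<Sum>j<N. ?H i j * ennreal (c i j) * emeasure \<nu> (r -` {j})) * emeasure \<mu> (r -` {i}))"
    by (rule nn_integral_cells[OF s(1)])
  also have "\<dots> = (\<Sum>i<N. \<Sum>j<N. ennreal (h i j * c i j))"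
    unfolding sum_distrib_right
  proof (intro sum.cong refl)
    fix i j assume "i \<in> {..<N}" "j \<in> {..<N}"
    then have ij: "i < N" "j < N" by simp_all
    have "h i j / (?m i * ?n j) * c i j * ?n j * ?m i = h i j * c i j"
      using h0(1)[OF ij] h0(2)[OF ij] by (cases "?m i = 0"; cases "?n j = 0") auto
    then show "?H i j * ennreal (c i j) * emeasure \<nu> (r -` {j}) * emeasure \<mu> (r -` {i}) = ennreal (h i j * c i j)"
      unfolding emeasure_cell[OF s(1) fin(1) ij(1)] emeasure_cell[OF s(2) fin(2) ij(2)]
      using h(1)[OF ij] h(2)[OF ij] by (simp add: ennreal_mult[symmetric])
  qed
  also have "\<dots> = ennreal (\<Sum>i<N. \<Sum>j<N. h i j * c i j)"
  proof -
    have "(\<Sum>j<N. ennreal (h i j * c i j)) = ennreal (\<Sum>j<N. h i j * c i j)" if "i < N" for i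
      using h that by (intro sum_ennreal) auto
    moreover have "(\<Sum>i<N. ennreal (\<Sum>j<N. h i j * c i j)) = ennreal (\<Sum>i<N. \<Sum>j<N. h i j * c i j)"
      using h by (intro sum_ennreal sum_nonneg) auto
    ultimately show ?thesis by simp
  qed
  finally show ?thesis .
qed

end

section \<open>From finite plans to couplings\<close>

lemma cell_partition_exists:
  fixes C :: "'a::metric_space set"
  assumes "compact C" "0 < \<delta>"
  obtains N r p where "cell_partition C r N" "\<And>x. r x < N \<Longrightarrow> dist x (p (r x)) < \<delta>" "\<And>i. i < N \<Longrightarrow> p i \<in> C"
proof -
  obtain F where F: "finite F" "F \<subseteq> C" "C \<subseteq> (\<Union>x\<in>F. ball x \<delta>)"
    using seq_compact_imp_totally_bounded[OF compact_imp_seq_compact[OF assms(1)], rule_format, OF assms(2)]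
    by (elim exE conjE)
  obtain p where p: "bij_betw p {0..<card F} F" using ex_bij_betw_nat_finite[OF F(1)] by blast
  define N where "N = card F"
  have pF: "p ` {..<N} = F" using p by (simp add: bij_betw_def N_def atLeast0LessThan)
  \<comment> \<open>Choosing the first admissible centre turns overlapping balls into disjoint
    cells.\<close>
  define r where "r x = (if x \<in> C then LEAST i. dist x (p i) < \<delta> else N)" for x
  have r: "r x < N" "dist x (p (r x)) < \<delta>" if x: "x \<in> C" for x
  proof -
    obtain y where y: "y \<in> F" "dist x y < \<delta>" using subsetD[OF F(3) x] by (auto simp: dist_commute)
    then obtain i where i: "i < N" "dist x (p i) < \<delta>" using pF by auto
    have "dist x (p (LEAST i. dist x (p i) < \<delta>)) < \<delta>" "(LEAST i. dist x (p i) < \<delta>) \<le> i"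
      by (rule LeastI[where P="\<lambda>i. dist x (p i) < \<delta>", OF i(2)], rule Least_le[where P="\<lambda>i. dist x (p i) < \<delta>", OF i(2)])
    with i x show "r x < N" "dist x (p (r x)) < \<delta>" by (auto simp: r_def)
  qed
  show thesis
  proof (rule that)
    have [measurable]: "C \<in> sets borel" using assms(1) by (rule borel_compact)
    have [measurable]: "(\<lambda>x. dist x y) \<in> borel_measurable borel" for y :: 'a
      by (intro borel_measurable_continuous_onI continuous_intros)
    have "r \<in> borel \<rightarrow>\<^sub>M count_space UNIV" unfolding r_def by measurable
    moreover have "C = {x. r x < N}" using r by (auto simp: r_def split: if_splits)
    ultimately show "cell_partition C r N" by unfold_locales
    show "dist x (p (r x)) < \<delta>" if "r x < N" for x using r that by (auto simp: r_def split: if_splits)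
    show "p i \<in> C" if "i < N" for i using F(2) pF that by auto
  qed
qed

lemma near_optimal_coupling:
  fixes A :: "'a::polish_space set"
  assumes A: "closed A" "A \<noteq> {}" and bc: "\<And>S :: 'a set. closed S \<Longrightarrow> bounded S \<Longrightarrow> compact S"
    and \<mu>: "\<mu> \<in> M1_pos A" and \<nu>: "\<nu> \<in> M1_pos A"
    and K: "0 \<le> K" "\<And>f s. f \<in> Lip_c A \<Longrightarrow> s-lipschitz_on UNIV f \<Longrightarrow> integral\<^sup>L \<mu> f - integral\<^sup>L \<nu> f \<le> s * K"
    and \<eta>: "0 < \<eta>"
  shows "\<exists>\<pi>\<in>rel_couplings A \<mu> \<nu>. (\<integral>\<^sup>+ z. ennreal (dbar A z) \<partial>\<pi>) \<le> ennreal (K + \<eta>)"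
proof -
  obtain a where a: "a \<in> A" using A by blast
  have s: "sets \<mu> = sets borel" "sets \<nu> = sets borel" using \<mu> \<nu> by (auto simp: M1_pos_iff[OF A])
  \<comment> \<open>Error budget: the tail enters twice through the potentials and twice through the
    boundary cost, together \<open>4 * e = \<eta> / 2\<close>. The other half of
    \<open>\<eta>\<close> pays for the size of the cells, \<open>2 * (\<delta> * V)\<close>.\<close>
  define e where "e = \<eta> / 8"
  have e: "0 < e" using \<eta> by (simp add: e_def)
  have "\<forall>\<^sub>F k in sequentially.
    (\<integral>\<^sup>+ x. ennreal (infdist x A) * indicator (- (level A k \<inter> cball a (real k))) x \<partial>\<mu>) \<le> ennreal e \<and>
    (\<integral>\<^sup>+ x. ennreal (infdist x A) * indicator (- (level A k \<inter> cball a (real k))) x \<partial>\<nu>) \<le> ennreal e"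
    by (intro eventually_conj eventually_tail_small A a \<mu> \<nu> e)
  then obtain k where k:
    "(\<integral>\<^sup>+ x. ennreal (infdist x A) * indicator (- (level A k \<inter> cball a (real k))) x \<partial>\<mu>) \<le> ennreal e"
    "(\<integral>\<^sup>+ x. ennreal (infdist x A) * indicator (- (level A k \<inter> cball a (real k))) x \<partial>\<nu>) \<le> ennreal e"
    by (auto simp: eventually_sequentially)
  define C where "C = level A k \<inter> cball a (real k)"
  have tail: "(\<integral>\<^sup>+ x. ennreal (infdist x A) * indicator (- C) x \<partial>\<mu>) \<le> ennreal e"
    "(\<integral>\<^sup>+ x. ennreal (infdist x A) * indicator (- C) x \<partial>\<nu>) \<le> ennreal e"
    using k unfolding C_def .
  have compC: "compact C"
    unfolding C_def by (intro bc closed_Int closed_level closed_cball bounded_Int disjI2 bounded_cball)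
  have finC: "emeasure \<tau> C < \<infinity>" if "\<tau> \<in> M1_pos A" for \<tau>
  proof -
    have st: "sets \<tau> = sets borel" "(\<integral>\<^sup>+ x. ennreal (infdist x A) \<partial>\<tau>) < \<infinity>"
      using that by (auto simp: M1_pos_iff[OF A])
    have "emeasure \<tau> C \<le> emeasure \<tau> (level A k)" using st(1) by (intro emeasure_mono) (auto simp: C_def)
    also have "\<dots> < \<infinity>" by (rule emeasure_level_finite[OF st])
    finally show ?thesis .
  qed
  note fin = finC[OF \<mu>] finC[OF \<nu>]
  define V where "V = measure \<mu> C + measure \<nu> C"
  have V: "0 \<le> V" by (simp add: V_def)
  \<comment> \<open>Gives \<open>2 * (\<delta> * V) \<le> \<eta> / 2\<close>; the summand 1 keeps
    the denominator positive when \<open>V = 0\<close>.\<close>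
  define \<delta> where "\<delta> = \<eta> / (4 * (1 + V))"
  have \<delta>: "0 < \<delta>" using \<eta> V by (simp add: \<delta>_def)
  have "4 * \<delta> * (1 + V) = \<eta>" using V by (simp add: \<delta>_def field_simps)
  then have \<delta>V: "4 * (\<delta> * V) \<le> \<eta>" using \<delta> by (simp add: algebra_simps)
  obtain N r p where cp: "cell_partition C r N" and near: "\<And>x. r x < N \<Longrightarrow> dist x (p (r x)) < \<delta>"
    and pC: "\<And>i. i < N \<Longrightarrow> p i \<in> C"
    using cell_partition_exists[OF compC \<delta>] by metis
  interpret cell_partition C r N by fact
  have p_bound: "dist (p i) a \<le> real k" if "i < N" for i
    using pC[OF that] by (simp add: C_def dist_commute)
  define m where "m i = measure \<mu> (r -` {i})" for i
  define n where "n i = measure \<nu> (r -` {i})" for i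
  have Vmn: "V = (\<Sum>i<N. m i) + (\<Sum>j<N. n j)"
    unfolding V_def m_def n_def by (simp only: measure_C[OF s(1) fin(1)] measure_C[OF s(2) fin(2)])
  \<comment> \<open>The vertex \<open>N\<close> stands for \<open>A\<close>. Its positive self-cost
    has two purposes: the constraint at \<open>(N, N)\<close> becomes \<open>0 \<le> t\<close>, and
    \<open>h N N\<close> absorbs the difference between the exact total cost demanded in the duality
    lemma and the cost of the actual transport.\<close>
  define c where "c i j = (if i = N \<and> j = N then 1 else if i = N then infdist (p j) A
    else if j = N then infdist (p i) A else dist (p i) (p j))" for i j
  have c_simps: "c N N = 1" "\<And>j. j < N \<Longrightarrow> c N j = infdist (p j) A" "\<And>i. i < N \<Longrightarrow> c i N = infdist (p i) A"
    "\<And>i j. i < N \<Longrightarrow> j < N \<Longrightarrow> c i j = dist (p i) (p j)"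
    by (auto simp: c_def)
  \<comment> \<open>Bounds the dual value per unit of Lipschitz constant: \<open>K\<close> by
    hypothesis, plus, for each of the two measures, the tail \<open>e\<close> and the error of
    evaluating the potential at the centres of the cells.\<close>
  define K' where "K' = K + 2 * e + \<delta> * V"
  have "finite {..<N}" "N \<notin> {..<N}" by auto
  then obtain h where h: "\<And>i j. i \<in> insert N {..<N} \<Longrightarrow> j \<in> insert N {..<N} \<Longrightarrow> 0 \<le> h i j"
    "\<And>i. i \<in> {..<N} \<Longrightarrow> (\<Sum>j\<in>insert N {..<N}. h i j) = m i"
    "\<And>j. j \<in> {..<N} \<Longrightarrow> (\<Sum>i\<in>insert N {..<N}. h i j) = n j"
    "(\<Sum>i\<in>insert N {..<N}. \<Sum>j\<in>insert N {..<N}. h i j * c i j) = K'"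
  proof (rule finite_transport_duality)
    fix t u v
    assume uN: "u N = 0" and vN: "v N = 0"
      and uv: "\<And>i j. i \<in> insert N {..<N} \<Longrightarrow> j \<in> insert N {..<N} \<Longrightarrow> u i + v j \<le> t * c i j"
    have t: "0 \<le> t" using uv[of N N] uN vN c_simps by simp
    obtain f where f: "f \<in> Lip_c A" "t-lipschitz_on UNIV f"
      "\<And>i. i < N \<Longrightarrow> u i \<le> f (p i)" "\<And>i. i < N \<Longrightarrow> f (p i) \<le> - v i"
    proof (rule potential_exists[OF bc a t, of "real k" N p u v])
      show "u i \<le> t * infdist (p i) A" if "i < N" for i using uv[of i N] that vN c_simps by simp
      show "v i \<le> t * infdist (p i) A" if "i < N" for i using uv[of N i] that uN c_simps by simp
      show "u i + v j \<le> t * dist (p i) (p j)" if "i < N" "j < N" for i j using uv[of i j] that c_simps by simp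
    qed (use p_bound in auto)
    have f0: "f x = 0" if "x \<in> A" for x by (rule Lip_c_zero_on[OF f(1) that])
    have near': "dist x (p (r x)) \<le> \<delta>" if "r x < N" for x using near[OF that] by simp
    have "(\<Sum>i<N. u i * measure \<mu> (r -` {i})) \<le> integral\<^sup>L \<mu> f + t * (\<delta> * measure \<mu> C + e)"
      by (rule sum_le_integral[OF s(1) fin(1) integrable_infdist[OF A \<mu>] integrable_lipschitz[OF A \<mu> f(2) f0]
            tail(1) less_imp_le[OF e] near' f(2) A(2) f0 f(3)])
    moreover have "(\<Sum>i<N. v i * measure \<nu> (r -` {i})) \<le> integral\<^sup>L \<nu> (\<lambda>x. - f x) + t * (\<delta> * measure \<nu> C + e)"
    proof (rule sum_le_integral[OF s(2) fin(2) integrable_infdist[OF A \<nu>] _ tail(2) less_imp_le[OF e] near'])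
      show lip: "t-lipschitz_on UNIV (\<lambda>x. - f x)" by (rule lipschitz_on_minus[OF f(2)])
      show "integrable \<nu> (\<lambda>x. - f x)" by (rule integrable_lipschitz[OF A \<nu> lip]) (simp add: f0)
      show "v i \<le> - f (p i)" if "i < N" for i using f(4)[OF that] by simp
    qed (use A f0 in auto)
    moreover have "integral\<^sup>L \<nu> (\<lambda>x. - f x) = - integral\<^sup>L \<nu> f" by simp
    ultimately have "(\<Sum>i<N. u i * m i) + (\<Sum>j<N. v j * n j)
        \<le> integral\<^sup>L \<mu> f - integral\<^sup>L \<nu> f + t * (\<delta> * measure \<mu> C + e) + t * (\<delta> * measure \<nu> C + e)"
      by (simp add: m_def n_def)
    also have "\<dots> \<le> t * K + t * (\<delta> * measure \<mu> C + e) + t * (\<delta> * measure \<nu> C + e)"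
      using K(2)[OF f(1,2)] by simp
    also have "\<dots> = t * K'" by (simp add: K'_def V_def algebra_simps)
    finally show "(\<Sum>i<N. u i * m i) + (\<Sum>j<N. v j * n j) \<le> t * K'" .
  qed (rule that)
  have h_nonneg: "0 \<le> h i j" if "i \<le> N" "j \<le> N" for i j
    by (rule h(1)) (use that in auto)
  have row: "(\<Sum>j<N. h i j) + h i N = m i" if "i < N" for i using h(2)[of i] that by simp
  have col: "(\<Sum>i<N. h i j) + h N j = n j" if "j < N" for j using h(3)[of j] that by simp
  have row0: "h i j = 0" if "i < N" "j \<le> N" "m i = 0" for i j
  proof -
    have "\<forall>j\<in>insert N {..<N}. h i j = 0"
      using h(2)[of i] that h_nonneg by (subst sum_nonneg_eq_0_iff[symmetric]) auto
    then show ?thesis using that(2) by (cases "j = N") auto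
  qed
  have col0: "h i j = 0" if "j < N" "i \<le> N" "n j = 0" for i j
  proof -
    have "\<forall>i\<in>insert N {..<N}. h i j = 0"
      using h(3)[of j] that h_nonneg by (subst sum_nonneg_eq_0_iff[symmetric]) auto
    then show ?thesis using that(2) by (cases "i = N") auto
  qed
  define H where "H = (\<lambda>(x, y). ennreal (h (r x) (r y) / (m (r x) * n (r y))))"
  define w where "w x = (if x \<in> C then ennreal (h (r x) N / m (r x)) else 1)" for x
  define w' where "w' y = (if y \<in> C then ennreal (h N (r y) / n (r y)) else 1)" for y
  have Hm: "H \<in> borel_measurable (borel \<Otimes>\<^sub>M borel)"
    unfolding H_def split_beta
  \<comment> \<open>The index takes countably many values, so measurability is checked with
    \<open>r (fst z)\<close> frozen.\<close>
  proof (rule measurable_compose_countable[where g="\<lambda>z. r (fst z)"])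
    show "(\<lambda>z. ennreal (h i (r (snd z)) / (m i * n (r (snd z))))) \<in> borel_measurable (borel \<Otimes>\<^sub>M borel)" for i
      by (rule measurable_compose[OF measurable_snd compose_r])
  qed measurable
  have wm: "w \<in> borel_measurable borel" "w' \<in> borel_measurable borel"
    unfolding w_def w'_def by measurable
  have W1: "AE x in \<mu>. indicator C x * (\<integral>\<^sup>+ y. H (x, y) \<partial>density \<nu> (indicator C)) + w x = 1"
    unfolding H_def w_def m_def n_def prod.case
    by (rule AE_weight[OF s fin]) (use h_nonneg row col0 in \<open>auto simp: m_def n_def\<close>)
  have H_swap: "H (x, y) = ennreal (h (r x) (r y) / (n (r y) * m (r x)))" for x y
    by (simp add: H_def mult.commute)
  have W2: "AE y in \<nu>. indicator C y * (\<integral>\<^sup>+ x. H (x, y) \<partial>density \<mu> (indicator C)) + w' y = 1"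
    unfolding H_swap w'_def m_def n_def
    by (rule AE_weight[OF s(2,1) fin(2,1), of "\<lambda>j i. h i j" "\<lambda>j. h N j"])
       (use h_nonneg col row0 in \<open>auto simp: m_def n_def\<close>)
  obtain \<pi> where \<pi>: "\<pi> \<in> rel_couplings A \<mu> \<nu>" and cost: "(\<integral>\<^sup>+ z. ennreal (dbar A z) \<partial>\<pi>) \<le>
    (\<integral>\<^sup>+ x. (\<integral>\<^sup>+ y. H (x, y) * ennreal (dbar A (x, y)) \<partial>density \<nu> (indicator C)) \<partial>density \<mu> (indicator C))
    + (\<integral>\<^sup>+ x. w x * ennreal (infdist x A) \<partial>\<mu>) + (\<integral>\<^sup>+ y. w' y * ennreal (infdist y A) \<partial>\<nu>)"
    using coupling_from_density[OF A(1) a s C_borel fin Hm wm W1 W2] by blast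
  \<comment> \<open>Replacing centres by arbitrary points of the cells costs \<open>\<delta>\<close>
    at each end off \<open>A\<close>; interior transport has two such ends, boundary transport
    one.\<close>
  define S where "S = (\<Sum>i<N. \<Sum>j<N. h i j * (dist (p i) (p j) + 2 * \<delta>))"
  define S1 where "S1 = (\<Sum>i<N. h i N * (infdist (p i) A + \<delta>))"
  define S2 where "S2 = (\<Sum>j<N. h N j * (infdist (p j) A + \<delta>))"
  have d_near: "infdist x A \<le> infdist (p (r x)) A + \<delta>" if "r x < N" for x
    using infdist_le_dist_add[of x A "p (r x)"] near[OF that] by simp
  have "(\<integral>\<^sup>+ x. (\<integral>\<^sup>+ y. H (x, y) * ennreal (dbar A (x, y)) \<partial>density \<nu> (indicator C)) \<partial>density \<mu> (indicator C))
      \<le> ennreal S"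
    unfolding H_def S_def m_def n_def prod.case
  proof (rule interior_cost_le[OF s fin])
    fix x y assume xy: "r x < N" "r y < N"
    have "dbar A (x, y) \<le> dist x y" by (rule dbar_le_dist)
    also have "\<dots> \<le> dist x (p (r x)) + dist (p (r x)) (p (r y)) + dist (p (r y)) y"
      using dist_triangle[of x y "p (r x)"] dist_triangle[of "p (r x)" y "p (r y)"] by simp
    also have "\<dots> \<le> dist (p (r x)) (p (r y)) + 2 * \<delta>"
      using near[OF xy(1)] near[OF xy(2)] by (simp add: dist_commute)
    finally show "dbar A (x, y) \<le> dist (p (r x)) (p (r y)) + 2 * \<delta>" .
  qed (use h_nonneg row0 col0 \<delta> in \<open>auto simp: m_def n_def\<close>)
  moreover have "(\<integral>\<^sup>+ x. w x * ennreal (infdist x A) \<partial>\<mu>) \<le> ennreal (S1 + e)"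
    unfolding w_def S1_def m_def
    by (rule boundary_cost_le[OF s(1) fin(1) _ _ d_near _ tail(1)])
       (use h_nonneg row0 \<delta> e in \<open>auto simp: m_def infdist_nonneg add_nonneg_nonneg\<close>)
  moreover have "(\<integral>\<^sup>+ y. w' y * ennreal (infdist y A) \<partial>\<nu>) \<le> ennreal (S2 + e)"
    unfolding w'_def S2_def n_def
    by (rule boundary_cost_le[OF s(2) fin(2) _ _ d_near _ tail(2)])
       (use h_nonneg col0 \<delta> e in \<open>auto simp: n_def infdist_nonneg add_nonneg_nonneg\<close>)
  moreover have S_nonneg: "0 \<le> S" "0 \<le> S1" "0 \<le> S2"
    unfolding S_def S1_def S2_def using h_nonneg \<delta>
    by (auto intro!: sum_nonneg mult_nonneg_nonneg add_nonneg_nonneg infdist_nonneg)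
  ultimately have "(\<integral>\<^sup>+ z. ennreal (dbar A z) \<partial>\<pi>) \<le> ennreal S + ennreal (S1 + e) + ennreal (S2 + e)"
    using cost by (meson add_mono order_trans)
  also have "\<dots> = ennreal (S + (S1 + e) + (S2 + e))" using S_nonneg e by (simp flip: ennreal_plus)
  also have "\<dots> \<le> ennreal (K + \<eta>)"
  proof (rule ennreal_leI)
    define B where "B = (\<Sum>i<N. \<Sum>j<N. h i j)"
    define B1 where "B1 = (\<Sum>i<N. h i N)"
    define B2 where "B2 = (\<Sum>j<N. h N j)"
    define D where "D = (\<Sum>i<N. \<Sum>j<N. h i j * dist (p i) (p j))"
    define D1 where "D1 = (\<Sum>i<N. h i N * infdist (p i) A)"
    define D2 where "D2 = (\<Sum>j<N. h N j * infdist (p j) A)"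
    have "(\<Sum>i<N. \<Sum>j\<in>insert N {..<N}. h i j * c i j) = (\<Sum>i<N. h i N * infdist (p i) A + (\<Sum>j<N. h i j * dist (p i) (p j)))"
      by (intro sum.cong refl) (simp add: c_simps)
    moreover have "(\<Sum>j<N. h N j * c N j) = D2" unfolding D2_def by (intro sum.cong refl) (simp add: c_simps)
    ultimately have K'_eq: "K' = h N N + D2 + (D1 + D)"
      using h(4) by (simp add: c_simps D_def D1_def sum.distrib)
    have "B + B1 = (\<Sum>i<N. m i)" unfolding B_def B1_def sum.distrib[symmetric] by (intro sum.cong refl row) auto
    moreover have "B + B2 = (\<Sum>j<N. n j)"
    proof -
      have "B = (\<Sum>j<N. \<Sum>i<N. h i j)" unfolding B_def by (rule sum.swap)
      then have "B + B2 = (\<Sum>j<N. (\<Sum>i<N. h i j) + h N j)" by (simp add: B2_def sum.distrib)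
      also have "\<dots> = (\<Sum>j<N. n j)" by (intro sum.cong refl col) auto
      finally show ?thesis .
    qed
    \<comment> \<open>Interior mass belongs to both marginals, boundary mass to one. With cell
      errors of \<open>2 * \<delta>\<close> and \<open>\<delta>\<close> per unit of mass, the total
      is exactly \<open>\<delta> * V\<close>.\<close>
    ultimately have V_eq: "V = 2 * B + B1 + B2" using Vmn by simp
    have "S = D + 2 * \<delta> * B" unfolding S_def D_def B_def
      by (simp add: distrib_left sum.distrib sum_distrib_left mult.commute)
    moreover have "S1 = D1 + \<delta> * B1" unfolding S1_def D1_def B1_def
      by (simp add: distrib_left sum.distrib sum_distrib_left mult.commute)
    moreover have "S2 = D2 + \<delta> * B2" unfolding S2_def D2_def B2_def
      by (simp add: distrib_left sum.distrib sum_distrib_left mult.commute)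
    ultimately have "S + (S1 + e) + (S2 + e) = K' - h N N + \<delta> * V + 2 * e"
      unfolding K'_eq V_eq by (simp add: algebra_simps)
    also have "\<dots> \<le> K + 4 * e + 2 * (\<delta> * V)" using h_nonneg[of N N] by (simp add: K'_def)
    also have "\<dots> \<le> K + \<eta>" using \<delta>V by (simp add: e_def)
    finally show "S + (S1 + e) + (S2 + e) \<le> K + \<eta>" .
  qed
  finally show ?thesis using \<pi> by blast
qed

section \<open>The lower bound for the transport cost\<close>

lemma integral_eq_off:
  fixes f :: "'a::metric_space \<Rightarrow> real"
  assumes "closed A" "sets \<mu> = sets borel" "sets \<nu> = sets borel"
    and eq: "\<And>E. E \<in> sets borel \<Longrightarrow> E \<subseteq> - A \<Longrightarrow> emeasure \<mu> E = emeasure \<nu> E"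
    and f: "f \<in> borel_measurable borel" "\<And>x. x \<in> A \<Longrightarrow> f x = 0" and int: "integrable \<nu> f"
  shows "integrable \<mu> f" "integral\<^sup>L \<mu> f = integral\<^sup>L \<nu> f"
proof -
  note nn = nn_integral_eq_off[OF assms(1-3) eq]
  have "(\<integral>\<^sup>+ x. ennreal (norm (f x)) \<partial>\<mu>) = (\<integral>\<^sup>+ x. ennreal (norm (f x)) \<partial>\<nu>)"
    using f by (intro nn) auto
  then show i: "integrable \<mu> f"
    using int f(1) assms(2,3) by (simp add: integrable_iff_bounded cong: measurable_cong_sets)
  have "(\<integral>\<^sup>+ x. ennreal (f x) \<partial>\<mu>) = (\<integral>\<^sup>+ x. ennreal (f x) \<partial>\<nu>)"
    "(\<integral>\<^sup>+ x. ennreal (- f x) \<partial>\<mu>) = (\<integral>\<^sup>+ x. ennreal (- f x) \<partial>\<nu>)"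
    using f by (auto intro!: nn)
  then show "integral\<^sup>L \<mu> f = integral\<^sup>L \<nu> f"
    by (simp add: real_lebesgue_integral_def i int)
qed

text \<open>The marginals of \<open>\<pi>\<close> agree with \<open>\<mu>\<close> and
  \<open>\<nu>\<close> only off \<open>A\<close>, which suffices as \<open>f\<close> vanishes on
  \<open>A\<close>. The same vanishing gives \<open>\<bar>f x\<bar> \<le> infdist x A\<close>, hence
  the bound by the second term of the minimum in \<open>dbar\<close>.\<close>

lemma integral_diff_le_cost:
  fixes A :: "'a::polish_space set"
  assumes A: "closed A" "A \<noteq> {}" and \<mu>: "\<mu> \<in> M1_pos A" and \<nu>: "\<nu> \<in> M1_pos A"
    and f: "1-lipschitz_on UNIV f" "\<And>x. x \<in> A \<Longrightarrow> f x = (0 :: real)"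
    and \<pi>: "\<pi> \<in> rel_couplings A \<mu> \<nu>"
  shows "ennreal (integral\<^sup>L \<mu> f - integral\<^sup>L \<nu> f) \<le> (\<integral>\<^sup>+ z. ennreal (dbar A z) \<partial>\<pi>)"
proof (cases "(\<integral>\<^sup>+ z. ennreal (dbar A z) \<partial>\<pi>) = \<infinity>")
  case False
  have s: "sets \<mu> = sets borel" "sets \<nu> = sets borel" using \<mu> \<nu> by (auto simp: M1_pos_iff[OF A])
  have s\<pi>: "sets \<pi> = sets borel"
    and eq: "rel_eq A (distr \<pi> borel fst) \<mu>" "rel_eq A (distr \<pi> borel snd) \<nu>"
    using \<pi> by (auto simp: rel_couplings_def borel_measures_def)
  note eq' = eq[unfolded rel_eq_iff[OF A(1) sets_distr s(1)] rel_eq_iff[OF A(1) sets_distr s(2)], rule_format]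
  have fm: "f \<in> borel_measurable borel"
    by (rule borel_measurable_continuous_onI[OF lipschitz_on_continuous_on[OF f(1)]])
  have m: "fst \<in> \<pi> \<rightarrow>\<^sub>M borel" "snd \<in> \<pi> \<rightarrow>\<^sub>M borel"
    using measurable_fst_snd_borel by (simp_all cong: measurable_cong_sets add: s\<pi>)
  note 1 = integral_eq_off[OF A(1) sets_distr s(1) eq'(1) fm f(2) integrable_lipschitz[OF A \<mu> f]]
  note 2 = integral_eq_off[OF A(1) sets_distr s(2) eq'(2) fm f(2) integrable_lipschitz[OF A \<nu> f]]
  have i1: "integrable \<pi> (\<lambda>z. f (fst z))" "integral\<^sup>L \<mu> f = (\<integral>z. f (fst z) \<partial>\<pi>)"
    using 1 fm m(1) by (simp_all add: integrable_distr_eq integral_distr)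
  have i2: "integrable \<pi> (\<lambda>z. f (snd z))" "integral\<^sup>L \<nu> f = (\<integral>z. f (snd z) \<partial>\<pi>)"
    using 2 fm m(2) by (simp_all add: integrable_distr_eq integral_distr)
  have id: "integrable \<pi> (dbar A)"
    using False dbar_borel[of A]
    by (intro integrableI_nonneg) (auto simp: s\<pi> dbar_nonneg less_top[symmetric] cong: measurable_cong_sets)
  have le: "f (fst z) - f (snd z) \<le> dbar A z" for z
  proof (cases z)
    case (Pair x y)
    have "\<bar>f x - f y\<bar> \<le> 1 * dist x y" using f(1) unfolding lipschitz_on_abs_diff by blast
    moreover have "\<bar>f x\<bar> \<le> 1 * infdist x A" "\<bar>f y\<bar> \<le> 1 * infdist y A"
      by (rule lipschitz_abs_le_infdist[OF f(1) A(2) f(2)]; assumption)+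
    ultimately have "f x - f y \<le> dist x y" "f x - f y \<le> infdist x A + infdist y A" by linarith+
    then show ?thesis by (simp add: Pair dbar_def)
  qed
  have "integral\<^sup>L \<mu> f - integral\<^sup>L \<nu> f = (\<integral>z. f (fst z) - f (snd z) \<partial>\<pi>)"
    unfolding i1(2) i2(2) by (rule Bochner_Integration.integral_diff[symmetric, OF i1(1) i2(1)])
  also have "\<dots> \<le> integral\<^sup>L \<pi> (dbar A)"
    by (rule integral_mono[OF Bochner_Integration.integrable_diff[OF i1(1) i2(1)] id le])
  finally have "ennreal (integral\<^sup>L \<mu> f - integral\<^sup>L \<nu> f) \<le> ennreal (integral\<^sup>L \<pi> (dbar A))" by (rule ennreal_leI)
  also have "\<dots> = (\<integral>\<^sup>+ z. ennreal (dbar A z) \<partial>\<pi>)"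
    by (rule nn_integral_eq_integral[symmetric, OF id]) (simp add: dbar_nonneg)
  finally show ?thesis .
qed simp

section \<open>The Lipschitz number and the operator norm\<close>

lemma Lip_number_le: "C-lipschitz_on UNIV f \<Longrightarrow> Lip_number f \<le> C"
  unfolding Lip_number_def by (rule cInf_lower) (auto intro!: bdd_belowI[of _ 0] dest: lipschitz_on_nonneg)

lemma lipschitz_on_Lip_number:
  assumes "f \<in> Lip_c A" shows "(Lip_number f)-lipschitz_on UNIV f"
  unfolding lipschitz_on_abs_diff
proof (intro conjI ballI)
  have ne: "{C. C-lipschitz_on UNIV f} \<noteq> {}" using assms by (auto simp: Lip_c_def)
  show "0 \<le> Lip_number f"
    unfolding Lip_number_def by (rule cInf_greatest[OF ne]) (auto dest: lipschitz_on_nonneg)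
  fix x y
  show "\<bar>f x - f y\<bar> \<le> Lip_number f * dist x y"
  proof (cases "x = y")
    case False
    then have d: "0 < dist x y" by simp
    have "\<bar>f x - f y\<bar> / dist x y \<le> Lip_number f"
      unfolding Lip_number_def
      by (rule cInf_greatest[OF ne]) (use d in \<open>auto simp: lipschitz_on_abs_diff pos_divide_le_eq\<close>)
    then show ?thesis using d by (simp add: pos_divide_le_eq)
  qed simp
qed

lemma Lip_number_nonneg: "f \<in> Lip_c A \<Longrightarrow> 0 \<le> Lip_number f"
  using lipschitz_on_nonneg[OF lipschitz_on_Lip_number] .

lemma Lip_number_le_one_iff: "f \<in> Lip_c A \<Longrightarrow> Lip_number f \<le> 1 \<longleftrightarrow> 1-lipschitz_on UNIV f"
  using Lip_number_le[of 1 f] lipschitz_on_le[OF lipschitz_on_Lip_number, of f A 1] by auto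

text \<open>The distance to \<open>A\<close> is in general no admissible test function, but cutting
  it off by \<open>max 0 (real n - dist x a)\<close> keeps it 1-Lipschitz and makes the support
  bounded, hence compact. These functions increase to the distance, and monotone convergence bounds
  the moment by \<open>B\<close>.\<close>

lemma moment_finite_if_Lip_bounded:
  fixes A :: "'a::polish_space set"
  assumes A: "closed A" "A \<noteq> {}" and bc: "\<And>S :: 'a set. closed S \<Longrightarrow> bounded S \<Longrightarrow> compact S"
    and s: "sets \<mu> = sets borel"
    and bound: "\<And>f. f \<in> Lip_pos A \<Longrightarrow> 1-lipschitz_on UNIV f \<Longrightarrow> (\<integral>\<^sup>+ x. ennreal (f x) \<partial>\<mu>) \<le> ennreal B"
  shows "\<mu> \<in> M1_pos A"
proof -
  note [measurable_cong] = s
  obtain a where a: "a \<in> A" using A by blast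
  define f where "f n x = min (infdist x A) (max 0 (real n - dist x a))" for n x
  have lip: "1-lipschitz_on UNIV (f n)" for n
    unfolding lipschitz_on_abs_diff
  proof (intro conjI ballI)
    fix x y
    show "\<bar>f n x - f n y\<bar> \<le> 1 * dist x y"
      using infdist_triangle_abs[of x A y] abs_dist_diff_le[of x a y]
      unfolding f_def dist_commute[of a y] by linarith
  qed simp
  have "f n \<in> Lip_pos A" for n
    unfolding Lip_pos_def
  proof safe
    show "f n \<in> Lip_c A"
      by (rule Lip_c_if_support[OF lip, of "cball a (real n)"])
         (auto intro: bc simp: f_def infdist_nonneg dist_commute)
  qed (simp add: f_def infdist_nonneg)
  then have f_le: "(\<integral>\<^sup>+ x. ennreal (f n x) \<partial>\<mu>) \<le> ennreal B" for n by (rule bound[OF _ lip])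
  have fm [measurable]: "f n \<in> borel_measurable borel" for n
    by (rule borel_measurable_continuous_onI[OF lipschitz_on_continuous_on[OF lip]])
  have sup: "(SUP n. ennreal (f n x)) = ennreal (infdist x A)" for x
  proof (rule antisym)
    show "(SUP n. ennreal (f n x)) \<le> ennreal (infdist x A)"
      by (intro SUP_least ennreal_leI) (simp add: f_def)
    obtain n where n: "dist x a + infdist x A \<le> real n" using real_arch_simple by blast
    then have "f n x = infdist x A" by (simp add: f_def)
    then show "ennreal (infdist x A) \<le> (SUP n. ennreal (f n x))" by (metis SUP_upper UNIV_I)
  qed
  have "(\<integral>\<^sup>+ x. ennreal (infdist x A) \<partial>\<mu>) = (SUP n. \<integral>\<^sup>+ x. ennreal (f n x) \<partial>\<mu>)"
    unfolding sup[symmetric]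
  proof (rule nn_integral_monotone_convergence_SUP)
    show "incseq (\<lambda>n x. ennreal (f n x))"
    proof (intro incseq_SucI le_funI ennreal_leI)
      show "f n x \<le> f (Suc n) x" for n x unfolding f_def of_nat_Suc by linarith
    qed
  qed simp
  also have "\<dots> \<le> ennreal B" by (rule SUP_least) (rule f_le)
  finally show ?thesis using s by (auto simp: M1_pos_iff[OF A] intro: le_less_trans)
qed

section \<open>Representation of order continuous functionals\<close>

lemma representation:
  fixes A :: "'a::polish_space set" and T absT :: "('a \<Rightarrow> real) \<Rightarrow> real"
  assumes A: "closed A" "A \<noteq> {}" and bc: "\<And>S :: 'a set. closed S \<Longrightarrow> bounded S \<Longrightarrow> compact S"
    and T: "T \<in> seq_order_continuous_dual (Lip_c A)"
    and abs: "is_functional_abs (Lip_c A) T absT" "Lip_bounded A absT"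
  obtains \<mu> \<nu> where "\<mu> \<in> M1_pos A" "\<nu> \<in> M1_pos A" "is_pos_neg_parts A (\<mu>, \<nu>) \<mu> \<nu>"
    "\<And>f. f \<in> Lip_c A \<Longrightarrow> T f = integral\<^sup>L \<mu> f - integral\<^sup>L \<nu> f"
proof -
  interpret p: positive_lip_functional A "pos_part A T"
    by (rule pos_part_positive_functional[OF T A])
  interpret n: positive_lip_functional A "\<lambda>f. pos_part A T f - T f"
    by (rule neg_part_positive_functional[OF T A])
  obtain B where B: "\<And>f. f \<in> Lip_c A \<Longrightarrow> \<bar>absT f\<bar> \<le> B * Lip_number f"
    using abs(2) by (auto simp: Lip_bounded_def)
  have absB: "absT f \<le> \<bar>B\<bar>" if f: "f \<in> Lip_pos A" "1-lipschitz_on UNIV f" for f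
  proof -
    have "absT f \<le> B * Lip_number f" using B[OF Lip_posD(1)[OF f(1)]] by linarith
    also have "\<dots> \<le> \<bar>B\<bar> * 1"
      using Lip_number_le[OF f(2)] Lip_number_nonneg[OF Lip_posD(1)[OF f(1)]] by (intro mult_mono) auto
    finally show ?thesis by simp
  qed
  define \<alpha> where "\<alpha> = p.representing"
  define \<beta> where "\<beta> = n.representing"
  have \<alpha>: "(\<integral>\<^sup>+ x. ennreal (f x) \<partial>\<alpha>) = ennreal (pos_part A T f)" if "f \<in> Lip_pos A" for f
    unfolding \<alpha>_def by (rule p.nn_integral_representing[OF that])
  have \<beta>: "(\<integral>\<^sup>+ x. ennreal (f x) \<partial>\<beta>) = ennreal (pos_part A T f - T f)" if "f \<in> Lip_pos A" for f
    unfolding \<beta>_def by (rule n.nn_integral_representing[OF that])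
  have \<alpha>M: "\<alpha> \<in> M1_pos A"
  proof (rule moment_finite_if_Lip_bounded[OF A bc])
    show "(\<integral>\<^sup>+ x. ennreal (f x) \<partial>\<alpha>) \<le> ennreal \<bar>B\<bar>" if "f \<in> Lip_pos A" "1-lipschitz_on UNIV f" for f
      unfolding \<alpha>[OF that(1)] using pos_neg_part_le_abs(1)[OF T abs(1) that(1)] absB[OF that]
      by (intro ennreal_leI) simp
  qed (simp_all add: \<alpha>_def)
  have \<beta>M: "\<beta> \<in> M1_pos A"
  proof (rule moment_finite_if_Lip_bounded[OF A bc])
    show "(\<integral>\<^sup>+ x. ennreal (f x) \<partial>\<beta>) \<le> ennreal \<bar>B\<bar>" if "f \<in> Lip_pos A" "1-lipschitz_on UNIV f" for f
      unfolding \<beta>[OF that(1)] using pos_neg_part_le_abs(2)[OF T abs(1) that(1)] absB[OF that]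
      by (intro ennreal_leI) simp
  qed (simp_all add: \<beta>_def)
  have null: "emeasure \<alpha> A = 0" "emeasure \<beta> A = 0"
    unfolding \<alpha>_def \<beta>_def by (rule p.representing_A, rule n.representing_A)
  \<comment> \<open>Whether \<open>\<alpha>\<close> and \<open>\<beta>\<close> are mutually singular
    is left open; subtracting their common part makes them so and leaves the difference of the
    integrals unchanged.\<close>
  obtain \<mu> \<nu> P where \<mu>: "\<mu> \<in> M1_pos A" and \<nu>: "\<nu> \<in> M1_pos A"
    and P: "P \<in> sets borel" "emeasure \<mu> (- P) = 0" "emeasure \<nu> P = 0"
    and J: "\<And>f. f \<in> borel_measurable borel \<Longrightarrow>
      (\<integral>\<^sup>+ x. f x \<partial>\<alpha>) + (\<integral>\<^sup>+ x. f x \<partial>\<nu>) = (\<integral>\<^sup>+ x. f x \<partial>\<beta>) + (\<integral>\<^sup>+ x. f x \<partial>\<mu>)"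
    by (rule Jordan_parts[OF A \<alpha>M \<beta>M null]) blast
  have int: "integrable \<tau> f" if "f \<in> Lip_c A" "\<tau> \<in> M1_pos A" for f \<tau>
    using integrable_lipschitz[OF A that(2) lipschitz_on_Lip_number[OF that(1)] Lip_c_zero_on[OF that(1)]] .
  have pos: "T f = integral\<^sup>L \<mu> f - integral\<^sup>L \<nu> f" if f: "f \<in> Lip_pos A" for f
  proof -
    have fc: "f \<in> Lip_c A" and f0: "\<And>x. 0 \<le> f x" using Lip_posD[OF f] by auto
    have nn: "(\<integral>\<^sup>+ x. ennreal (f x) \<partial>\<tau>) = ennreal (integral\<^sup>L \<tau> f)" if "\<tau> \<in> M1_pos A" for \<tau>
      using f0 by (intro nn_integral_eq_integral int fc that) auto
    have i0: "0 \<le> integral\<^sup>L \<mu> f" "0 \<le> integral\<^sup>L \<nu> f" using f0 by simp_all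
    have "(\<lambda>x. ennreal (f x)) \<in> borel_measurable borel" using Lip_c_borel[OF fc] by simp
    from J[OF this] have "ennreal (pos_part A T f) + ennreal (integral\<^sup>L \<nu> f)
        = ennreal (pos_part A T f - T f) + ennreal (integral\<^sup>L \<mu> f)"
      by (simp only: \<alpha>[OF f] \<beta>[OF f] nn[OF \<mu>] nn[OF \<nu>])
    \<comment> \<open>All four terms are finite, so the identity descends to the reals, where it can
      be rearranged.\<close>
    then have "pos_part A T f + integral\<^sup>L \<nu> f = pos_part A T f - T f + integral\<^sup>L \<mu> f"
      using i0 p.nonneg[OF f] n.nonneg[OF f] by (simp add: ennreal_plus[symmetric] del: ennreal_plus)
    then show ?thesis by simp
  qed
  have "T f = integral\<^sup>L \<mu> f - integral\<^sup>L \<nu> f" if f: "f \<in> Lip_c A" for f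
  proof -
    define g where "g x = max (f x) 0" for x
    define k where "k x = max (- f x) 0" for x
    have g: "g \<in> Lip_pos A" and k: "k \<in> Lip_pos A"
      unfolding Lip_pos_def g_def k_def using Lip_c_max[OF f Lip_c_zero] Lip_c_max[OF Lip_c_minus[OF f] Lip_c_zero]
      by auto
    have f_eq: "f = (\<lambda>x. g x - k x)" by (auto simp: g_def k_def max_def)
    have "T f = T g - T k" unfolding f_eq by (rule functional_diff[OF T Lip_posD(1)[OF g] Lip_posD(1)[OF k]])
    moreover have "integral\<^sup>L \<tau> f = integral\<^sup>L \<tau> g - integral\<^sup>L \<tau> k" if "\<tau> \<in> M1_pos A" for \<tau>
      unfolding f_eq using that Lip_posD(1)[OF g] Lip_posD(1)[OF k]
      by (intro Bochner_Integration.integral_diff int)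
    ultimately show ?thesis using pos[OF g] pos[OF k] \<mu> \<nu> by simp
  qed
  with \<mu> \<nu> is_pos_neg_parts_if_singular[OF A \<mu> \<nu> P] show thesis by (rule that)
qed

lemma Lip_op_norm_eq_W1:
  fixes A :: "'a::polish_space set" and T :: "('a \<Rightarrow> real) \<Rightarrow> real"
  assumes A: "closed A" "A \<noteq> {}" and bc: "\<And>S :: 'a set. closed S \<Longrightarrow> bounded S \<Longrightarrow> compact S"
    and \<mu>: "\<mu> \<in> M1_pos A" and \<nu>: "\<nu> \<in> M1_pos A"
    and T: "\<And>f. f \<in> Lip_c A \<Longrightarrow> T f = integral\<^sup>L \<mu> f - integral\<^sup>L \<nu> f"
    and bounded: "Lip_bounded A T"
  shows "ennreal (Lip_op_norm A T) = W1 A \<mu> \<nu>"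
proof -
  let ?K = "Lip_op_norm A T" and ?U = "{f \<in> Lip_c A. Lip_number f \<le> 1}"
  have zero: "(\<lambda>_. 0) \<in> ?U"
    using Lip_c_zero[of A] Lip_number_le_one_iff[OF Lip_c_zero[of A]]
    by (auto simp: lipschitz_on_abs_diff)
  obtain B where B: "\<And>f. f \<in> Lip_c A \<Longrightarrow> \<bar>T f\<bar> \<le> B * Lip_number f"
    using bounded by (auto simp: Lip_bounded_def)
  have "\<bar>T f\<bar> \<le> \<bar>B\<bar>" if "f \<in> ?U" for f
  proof -
    have "\<bar>T f\<bar> \<le> B * Lip_number f" using B that by auto
    also have "\<dots> \<le> \<bar>B\<bar> * 1" using that Lip_number_nonneg[of f A] by (intro mult_mono) auto
    finally show ?thesis by simp
  qed
  \<comment> \<open>Boundedness of \<open>T\<close> enters here: over an unbounded set the real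
    supremum in \<open>Lip_op_norm\<close> would be an unspecified value.\<close>
  then have bdd: "bdd_above ((\<lambda>f. \<bar>T f\<bar>) ` ?U)" by (auto intro!: bdd_aboveI[of _ "\<bar>B\<bar>"])
  have le_K: "\<bar>T f\<bar> \<le> ?K" if "f \<in> Lip_c A" "1-lipschitz_on UNIV f" for f
    unfolding Lip_op_norm_def using that Lip_number_le_one_iff[OF that(1)] by (intro cSUP_upper bdd) auto
  have K0: "0 \<le> ?K"
    using le_K[OF Lip_c_zero] by (auto simp: lipschitz_on_abs_diff intro: order_trans[OF abs_ge_zero])
  \<comment> \<open>Rescales the bound from the unit ball. An arbitrary constant \<open>t\<close> is
    allowed because the potentials built from the finite problem have the Lipschitz constant that
    occurs there as a free variable. For \<open>t = 0\<close> the function is 0.\<close>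
  have lipK: "integral\<^sup>L \<mu> f - integral\<^sup>L \<nu> f \<le> t * ?K" if f: "f \<in> Lip_c A" "t-lipschitz_on UNIV f" for f t
  proof (cases "t = 0")
    case True
    then have "f x = 0" for x
      using lipschitz_abs_le_infdist[OF f(2) A(2) Lip_c_zero_on[OF f(1)], of x] by simp
    then have "f = (\<lambda>_. 0)" by (simp add: fun_eq_iff)
    then show ?thesis using True by simp
  next
    case False
    with lipschitz_on_nonneg[OF f(2)] have t: "0 < t" by simp
    have "(1 / t * t)-lipschitz_on UNIV (\<lambda>x. 1 / t * f x)"
      by (rule lipschitz_on_cmult_real_nonneg[OF f(2)]) (use t in simp)
    with t have "1-lipschitz_on UNIV (\<lambda>x. 1 / t * f x)" by simp
    from le_K[OF Lip_c_cmult[OF f(1)] this] have "T (\<lambda>x. 1 / t * f x) \<le> ?K" by linarith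
    then have "(integral\<^sup>L \<mu> f - integral\<^sup>L \<nu> f) / t \<le> ?K"
      using T[OF Lip_c_cmult[OF f(1)], of "1 / t"] by (simp add: diff_divide_distrib)
    then show ?thesis using t by (simp add: pos_divide_le_eq mult.commute)
  qed
  show ?thesis
  proof (rule antisym)
    show "W1 A \<mu> \<nu> \<le> ennreal ?K"
    proof (rule ennreal_le_epsilon)
      fix e :: real assume e: "0 < e"
      obtain \<pi> where "\<pi> \<in> rel_couplings A \<mu> \<nu>" "(\<integral>\<^sup>+ z. ennreal (dbar A z) \<partial>\<pi>) \<le> ennreal (?K + e)"
        using near_optimal_coupling[OF A bc \<mu> \<nu> K0 lipK e] by blast
      then have "W1 A \<mu> \<nu> \<le> ennreal (?K + e)" unfolding W1_def by (meson INF_lower2)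
      also have "\<dots> = ennreal ?K + ennreal e" using K0 e by (simp add: ennreal_plus)
      finally show "W1 A \<mu> \<nu> \<le> ennreal ?K + ennreal e" .
    qed
    show "ennreal ?K \<le> W1 A \<mu> \<nu>"
      unfolding W1_def
    proof (rule INF_greatest)
      fix \<pi> assume \<pi>: "\<pi> \<in> rel_couplings A \<mu> \<nu>"
      let ?c = "\<integral>\<^sup>+ z. ennreal (dbar A z) \<partial>\<pi>"
      show "ennreal ?K \<le> ?c"
      proof (cases "?c = \<infinity>")
        case False
        then obtain c where c: "?c = ennreal c" "0 \<le> c" by (cases ?c) auto
        have *: "T f \<le> c" if "f \<in> Lip_c A" "1-lipschitz_on UNIV f" for f
          using integral_diff_le_cost[OF A \<mu> \<nu> that(2) Lip_c_zero_on[OF that(1)] \<pi>] c(2)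
          unfolding c(1) T[OF that(1)] by simp
        have "\<bar>T f\<bar> \<le> c" if f: "f \<in> ?U" for f
        proof -
          have fc: "f \<in> Lip_c A" "1-lipschitz_on UNIV f" using f Lip_number_le_one_iff by auto
          \<comment> \<open>The unit ball is symmetric, which turns the one-sided bound into one for
            the absolute value.\<close>
          have "T (\<lambda>x. - f x) = - T f" using T[OF fc(1)] T[OF Lip_c_minus[OF fc(1)]] by simp
          then show ?thesis
            using *[OF fc] *[OF Lip_c_minus[OF fc(1)] lipschitz_on_minus[OF fc(2)]] by simp
        qed
        then have "?K \<le> c" unfolding Lip_op_norm_def using zero by (intro cSUP_least) auto
        then show ?thesis unfolding c(1) by (rule ennreal_leI)
      qed simp
    qed
  qed
qed

theorem theorem1p11:
  fixes A :: "'a::polish_space set"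
    and T absT :: "('a \<Rightarrow> real) \<Rightarrow> real"
  assumes "closed A" and "A \<noteq> {}"
    and boundedly_compact: "\<And>S :: 'a set. closed S \<Longrightarrow> bounded S \<Longrightarrow> compact S"
    and "T \<in> seq_order_continuous_dual (Lip_c A)"
    and "is_functional_abs (Lip_c A) T absT"
    and "Lip_bounded A T" and "Lip_bounded A absT"
  shows "\<exists>\<mu>\<in>M1 A. \<exists>\<mu>p \<mu>n. is_pos_neg_parts A \<mu> \<mu>p \<mu>n \<and>
           (\<forall>f\<in>Lip_c A. T f = integral\<^sup>L \<mu>p f - integral\<^sup>L \<mu>n f) \<and>
           ennreal (Lip_op_norm A T) = W1 A \<mu>p \<mu>n"
proof -
  obtain \<mu> \<nu> where \<mu>\<nu>: "\<mu> \<in> M1_pos A" "\<nu> \<in> M1_pos A" "is_pos_neg_parts A (\<mu>, \<nu>) \<mu> \<nu>"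
    and T: "\<And>f. f \<in> Lip_c A \<Longrightarrow> T f = integral\<^sup>L \<mu> f - integral\<^sup>L \<nu> f"
    using representation[OF assms(1,2) boundedly_compact assms(4,5,7)] by blast
  moreover have "ennreal (Lip_op_norm A T) = W1 A \<mu> \<nu>"
    by (rule Lip_op_norm_eq_W1[OF assms(1,2) boundedly_compact \<mu>\<nu>(1,2) T assms(6)])
  moreover have "(\<mu>, \<nu>) \<in> M1 A" using \<mu>\<nu> by (simp add: M1_def)
  ultimately show ?thesis by blast
qed

end
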